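(* Let $\mathbb K\in\{\mathbb R,\mathbb C\}$ and let $L$ be a weakly complete Lie algebra over $\mathbb K$. Then the weakly complete enveloping algebra $\mathbf U(L)$ is a weakly complete Hopf algebra with the comultiplication $\gamma_L\colon\mathbf U(L)\to\mathbf U(L)\otimes_{\mathcal W}\mathbf U(L)$ and the coidentity $\mathbf U(k_L)\colon\mathbf U(L)\to\mathbb K$.
   Context: A topological $\mathbb K$-vector space is weakly complete if it is isomorphic to $\mathbb K^J$ for some set $J$. A weakly complete algebra is an associative unital algebra on a weakly complete vector space with continuous multiplication (morphisms: continuous unital homomorphisms); a weakly complete Lie algebra is a weakly complete vector space with continuous Lie bracket (morphisms: continuous Lie homomorphisms). $A_{\rm Lie}$ is $A$ with bracket $[x,y]=xy-yx$. $\otimes_{\mathcal W}$ is the tensor product of weakly complete vector spaces, universal for continuous bilinear maps into weakly complete vector spaces, so $\mathbb K^I\otimes_{\mathcal W}\mathbb K^J\cong\mathbb K^{I\times J}$. A weakly complete Hopf algebra is a Hopf algebra in the symmetric monoidal category of weakly complete vector spaces with $\otimes_{\mathcal W}$ (all structure maps being continuous). $\mathbf U$ is the left adjoint of $A\mapsto A_{\rm Lie}$, with unit $\lambda_L\colon L\to\mathbf U(L)_{\rm Lie}$: every morphism $f\colon L\to A_{\rm Lie}$ of weakly complete Lie algebras factors as $f=f'\circ\lambda_L$ for a unique morphism $f'\colon\mathbf U(L)\to A$ of weakly complete algebras. $\gamma_L$ is the unique morphism of weakly complete algebras with $\gamma_L(\lambda_L(x))=\lambda_L(x)\otimes1+1\otimes\lambda_L(x)$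 for all $x\in L$ (it exists by the universal property because $y\mapsto y\otimes1+1\otimes y$ is a morphism of Lie algebras). $k_L\colon L\to\{0\}$ is the constant morphism, and $\mathbf U(\{0\})=\mathbb K$. *)

theory Defs
  imports "HOL-Analysis.Analysis" "HOL-Algebra.Module" "HOL-Library.Function_Algebras"
begin

section \<open>Weakly complete vector spaces\<close>

text \<open>
  Vector spaces and algebras share the record \<open>module\<close> of HOL-Algebra, extended by a topology.
  For a mere vector space the ring fields \<open>mult\<close> and \<open>one\<close> are irrelevant.
  The ground field is given by its type \<^typ>\<open>'k::real_normed_field\<close>, to be instantiated by
  \<^typ>\<open>real\<close> and \<^typ>\<open>complex\<close>. Maps between carriers are extensional functions, so that
  equality of morphisms is equality in HOL.
\<close>

record ('k, 'v) top_module = "('k, 'v) module" +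
  topol :: "'v topology"

definition ground :: "('k::real_normed_field, 'k) top_module" where
  "ground = \<lparr>carrier = UNIV, monoid.mult = (*), one = 1, zero = 0, add = (+),
     smult = (*), topol = euclidean\<rparr>"

definition topological_vector_space ::
    "('k::real_normed_field, 'v, 'm) top_module_scheme \<Rightarrow> bool" where
  "topological_vector_space V \<longleftrightarrow>
     Module.module (ground :: ('k, 'k) top_module) V \<and>
     topspace (topol V) = carrier V \<and>
     continuous_map (prod_topology (topol V) (topol V)) (topol V) (\<lambda>(x, y). x \<oplus>\<^bsub>V\<^esub> y) \<and>
     continuous_map (prod_topology euclidean (topol V)) (topol V) (\<lambda>(c, x). c \<odot>\<^bsub>V\<^esub> x)"

definition cont_linear ::
    "('k, 'v, 'm) top_module_scheme \<Rightarrow> ('k, 'w, 'n) top_module_scheme \<Rightarrow> ('v \<Rightarrow> 'w) set" where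
  "cont_linear V W = {f \<in> carrier V \<rightarrow>\<^sub>E carrier W.
     (\<forall>x\<in>carrier V. \<forall>y\<in>carrier V. f (x \<oplus>\<^bsub>V\<^esub> y) = f x \<oplus>\<^bsub>W\<^esub> f y) \<and>
     (\<forall>c. \<forall>x\<in>carrier V. f (c \<odot>\<^bsub>V\<^esub> x) = c \<odot>\<^bsub>W\<^esub> f x) \<and>
     continuous_map (topol V) (topol W) f}"

definition power_space :: "'j set \<Rightarrow> ('k::real_normed_field, 'j \<Rightarrow> 'k) top_module" where
  "power_space J = \<lparr>carrier = J \<rightarrow>\<^sub>E UNIV, monoid.mult = undefined, one = undefined,
     zero = (\<lambda>j\<in>J. 0), add = (\<lambda>x y. \<lambda>j\<in>J. x j + y j), smult = (\<lambda>c x. \<lambda>j\<in>J. c * x j),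
     topol = product_topology (\<lambda>_. euclidean) J\<rparr>"

text \<open>
  Taking the index set inside the type of vectors is no restriction:
  if \<open>V\<close> is isomorphic to \<open>K\<^sup>J\<close>, then \<open>J\<close> embeds into \<open>V\<close> via the unit vectors.
\<close>

definition weakly_complete ::
    "('k::real_normed_field, 'v, 'm) top_module_scheme \<Rightarrow> bool" where
  "weakly_complete V \<longleftrightarrow> topological_vector_space V \<and>
     (\<exists>(J :: 'v set) h. h \<in> cont_linear V (power_space J) \<and>
        homeomorphic_map (topol V) (topol (power_space J :: ('k, 'v \<Rightarrow> 'k) top_module)) h)"


section \<open>Weakly complete algebras and Lie algebras\<close>

definition wc_algebra :: "('k::real_normed_field, 'a, 'm) top_module_scheme \<Rightarrow> bool" where
  "wc_algebra A \<longleftrightarrow> weakly_complete A \<and> Ring.ring A \<and>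
     (\<forall>c. \<forall>x\<in>carrier A. \<forall>y\<in>carrier A.
        (c \<odot>\<^bsub>A\<^esub> x) \<otimes>\<^bsub>A\<^esub> y = c \<odot>\<^bsub>A\<^esub> (x \<otimes>\<^bsub>A\<^esub> y) \<and>
        x \<otimes>\<^bsub>A\<^esub> (c \<odot>\<^bsub>A\<^esub> y) = c \<odot>\<^bsub>A\<^esub> (x \<otimes>\<^bsub>A\<^esub> y)) \<and>
     continuous_map (prod_topology (topol A) (topol A)) (topol A) (\<lambda>(x, y). x \<otimes>\<^bsub>A\<^esub> y)"

definition alg_hom ::
    "('k, 'a, 'm) top_module_scheme \<Rightarrow> ('k, 'b, 'n) top_module_scheme \<Rightarrow> ('a \<Rightarrow> 'b) set" where
  "alg_hom A B = {f \<in> cont_linear A B. f \<one>\<^bsub>A\<^esub> = \<one>\<^bsub>B\<^esub> \<and>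
     (\<forall>x\<in>carrier A. \<forall>y\<in>carrier A. f (x \<otimes>\<^bsub>A\<^esub> y) = f x \<otimes>\<^bsub>B\<^esub> f y)}"

record ('k, 'v) top_lie = "('k, 'v) top_module" +
  bracket :: "'v \<Rightarrow> 'v \<Rightarrow> 'v"

definition wc_lie :: "('k::real_normed_field, 'l, 'm) top_lie_scheme \<Rightarrow> bool" where
  "wc_lie L \<longleftrightarrow> weakly_complete L \<and>
     (\<forall>x\<in>carrier L. \<forall>y\<in>carrier L. bracket L x y \<in> carrier L) \<and>
     (\<forall>x\<in>carrier L. \<forall>y\<in>carrier L. \<forall>z\<in>carrier L.
        bracket L (x \<oplus>\<^bsub>L\<^esub> y) z = bracket L x z \<oplus>\<^bsub>L\<^esub> bracket L y z \<and>
        bracket L z (x \<oplus>\<^bsub>L\<^esub> y) = bracket L z x \<oplus>\<^bsub>L\<^esub> bracket L z y) \<and>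
     (\<forall>c. \<forall>x\<in>carrier L. \<forall>y\<in>carrier L.
        bracket L (c \<odot>\<^bsub>L\<^esub> x) y = c \<odot>\<^bsub>L\<^esub> bracket L x y \<and>
        bracket L x (c \<odot>\<^bsub>L\<^esub> y) = c \<odot>\<^bsub>L\<^esub> bracket L x y) \<and>
     (\<forall>x\<in>carrier L. bracket L x x = \<zero>\<^bsub>L\<^esub>) \<and>
     (\<forall>x\<in>carrier L. \<forall>y\<in>carrier L. \<forall>z\<in>carrier L.
        bracket L x (bracket L y z) \<oplus>\<^bsub>L\<^esub> bracket L y (bracket L z x)
          \<oplus>\<^bsub>L\<^esub> bracket L z (bracket L x y) = \<zero>\<^bsub>L\<^esub>) \<and>
     continuous_map (prod_topology (topol L) (topol L)) (topol L) (\<lambda>(x, y). bracket L x y)"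

definition lie_hom ::
    "('k, 'l, 'm) top_lie_scheme \<Rightarrow> ('k, 'n, 'o) top_lie_scheme \<Rightarrow> ('l \<Rightarrow> 'n) set" where
  "lie_hom L M = {f \<in> cont_linear L M.
     \<forall>x\<in>carrier L. \<forall>y\<in>carrier L. f (bracket L x y) = bracket M (f x) (f y)}"

definition lie_of :: "('k, 'a, 'm) top_module_scheme \<Rightarrow> ('k, 'a) top_lie" where
  "lie_of A = \<lparr>carrier = carrier A, monoid.mult = monoid.mult A, one = one A, zero = zero A,
     add = add A, smult = smult A, topol = topol A,
     bracket = (\<lambda>x y. x \<otimes>\<^bsub>A\<^esub> y \<ominus>\<^bsub>A\<^esub> y \<otimes>\<^bsub>A\<^esub> x)\<rparr>"


section \<open>The weakly complete tensor product\<close>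

definition cont_bilinear ::
    "('k, 'v, 'm) top_module_scheme \<Rightarrow> ('k, 'w, 'n) top_module_scheme \<Rightarrow>
     ('k, 'x, 'o) top_module_scheme \<Rightarrow> ('v \<times> 'w \<Rightarrow> 'x) set" where
  "cont_bilinear V W X = {b \<in> carrier V \<times> carrier W \<rightarrow>\<^sub>E carrier X.
     (\<forall>v\<in>carrier V. \<forall>v'\<in>carrier V. \<forall>w\<in>carrier W.
        b (v \<oplus>\<^bsub>V\<^esub> v', w) = b (v, w) \<oplus>\<^bsub>X\<^esub> b (v', w)) \<and>
     (\<forall>v\<in>carrier V. \<forall>w\<in>carrier W. \<forall>w'\<in>carrier W.
        b (v, w \<oplus>\<^bsub>W\<^esub> w') = b (v, w) \<oplus>\<^bsub>X\<^esub> b (v, w')) \<and>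
     (\<forall>c. \<forall>v\<in>carrier V. \<forall>w\<in>carrier W.
        b (c \<odot>\<^bsub>V\<^esub> v, w) = c \<odot>\<^bsub>X\<^esub> b (v, w) \<and> b (v, c \<odot>\<^bsub>W\<^esub> w) = c \<odot>\<^bsub>X\<^esub> b (v, w)) \<and>
     continuous_map (prod_topology (topol V) (topol W)) (topol X) b}"

text \<open>
  The tensor product is realised as the space of all linear functionals on the vector space of
  continuous bilinear forms on \<open>V \<times> W\<close>, with the topology of pointwise convergence. Lemmas
  \<open>weakly_complete_tensor\<close> and \<open>tensor_universal\<close> below show that it is a weakly complete vector
  space with the defining universal property, so the choice of the model is immaterial.
\<close>

abbreviation bilin_forms ::
    "('k::real_normed_field, 'v, 'm) top_module_scheme \<Rightarrow> ('k, 'w, 'n) top_module_scheme \<Rightarrow>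
     ('v \<times> 'w \<Rightarrow> 'k) set" where
  "bilin_forms V W \<equiv> cont_bilinear V W ground"

definition tensor ::
    "('k::real_normed_field, 'v, 'm) top_module_scheme \<Rightarrow> ('k, 'w, 'n) top_module_scheme \<Rightarrow>
     ('k, ('v \<times> 'w \<Rightarrow> 'k) \<Rightarrow> 'k) top_module" where
  "tensor V W =
    (let B = bilin_forms V W;
         D = carrier V \<times> carrier W;
         T = {t \<in> B \<rightarrow>\<^sub>E UNIV.
               (\<forall>b\<in>B. \<forall>b'\<in>B. t (\<lambda>p\<in>D. b p + b' p) = t b + t b') \<and>
               (\<forall>c. \<forall>b\<in>B. t (\<lambda>p\<in>D. c * b p) = c * t b)}
     in \<lparr>carrier = T, monoid.mult = undefined, one = undefined,
         zero = (\<lambda>b\<in>B. 0), add = (\<lambda>s t. \<lambda>b\<in>B. s b + t b), smult = (\<lambda>c t. \<lambda>b\<in>B. c * t b),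
         topol = subtopology (product_topology (\<lambda>_. euclidean) B) T\<rparr>)"

definition pure_tensor ::
    "('k::real_normed_field, 'v, 'm) top_module_scheme \<Rightarrow> ('k, 'w, 'n) top_module_scheme \<Rightarrow>
     'v \<Rightarrow> 'w \<Rightarrow> ('v \<times> 'w \<Rightarrow> 'k) \<Rightarrow> 'k" where
  "pure_tensor V W v w = (\<lambda>b\<in>bilin_forms V W. b (v, w))"

text \<open>
  The continuous linear map on \<open>V \<otimes> W\<close> induced by a continuous bilinear map \<open>\<phi>\<close> into a weakly
  complete space; well defined by \<open>tensor_universal\<close>. All further maps on tensor products are
  obtained from it by prescribing their values on pure tensors.
\<close>

definition tensor_lift ::
    "('k::real_normed_field, 'v, 'm) top_module_scheme \<Rightarrow> ('k, 'w, 'n) top_module_scheme \<Rightarrow>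
     ('k, 'x, 'o) top_module_scheme \<Rightarrow> ('v \<times> 'w \<Rightarrow> 'x) \<Rightarrow> (('v \<times> 'w \<Rightarrow> 'k) \<Rightarrow> 'k) \<Rightarrow> 'x" where
  "tensor_lift V W X \<phi> = (THE f. f \<in> cont_linear (tensor V W) X \<and>
     (\<forall>v\<in>carrier V. \<forall>w\<in>carrier W. f (pure_tensor V W v w) = \<phi> (v, w)))"

definition tensor_map where
  "tensor_map V W V' W' f g =
     tensor_lift V W (tensor V' W') (\<lambda>(v, w). pure_tensor V' W' (f v) (g w))"

definition tensor_assoc where
  "tensor_assoc U V W = tensor_lift (tensor U V) W (tensor U (tensor V W))
     (\<lambda>(t, w). tensor_lift U V (tensor U (tensor V W))
        (\<lambda>(u, v). pure_tensor U (tensor V W) u (pure_tensor V W v w)) t)"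

text \<open>The algebra with \<open>(a \<otimes> b) (a' \<otimes> b') = a a' \<otimes> b b'\<close>.\<close>

definition tensor_algebra ::
    "('k::real_normed_field, 'a, 'm) top_module_scheme \<Rightarrow> ('k, 'b, 'n) top_module_scheme \<Rightarrow>
     ('k, ('a \<times> 'b \<Rightarrow> 'k) \<Rightarrow> 'k) top_module" where
  "tensor_algebra A B = (tensor A B)
     \<lparr>monoid.mult := (\<lambda>s t. tensor_lift A B (tensor A B)
        (\<lambda>(a, b). tensor_lift A B (tensor A B)
           (\<lambda>(a', b'). pure_tensor A B (a \<otimes>\<^bsub>A\<^esub> a') (b \<otimes>\<^bsub>B\<^esub> b')) t) s),
      one := pure_tensor A B \<one>\<^bsub>A\<^esub> \<one>\<^bsub>B\<^esub>\<rparr>"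


section \<open>Weakly complete Hopf algebras\<close>

text \<open>
  A bimonoid with antipode in the monoidal category of weakly complete spaces: the monoid part is
  a weakly complete algebra, and compatibility says that \<open>\<Delta>\<close> and \<open>\<epsilon>\<close> are algebra morphisms.
  \<open>I\<close> is the identity, \<open>\<mu>\<close> the multiplication as a map on the tensor product, \<open>S\<close> the antipode.
\<close>

definition wc_hopf_algebra ::
    "('k::real_normed_field, 'a, 'm) top_module_scheme \<Rightarrow> ('a \<Rightarrow> ('a \<times> 'a \<Rightarrow> 'k) \<Rightarrow> 'k) \<Rightarrow>
     ('a \<Rightarrow> 'k) \<Rightarrow> bool" where
  "wc_hopf_algebra A \<Delta> \<epsilon> \<longleftrightarrow>
     wc_algebra A \<and> \<Delta> \<in> alg_hom A (tensor_algebra A A) \<and> \<epsilon> \<in> alg_hom A ground \<and>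
     (let I = (\<lambda>x\<in>carrier A. x);
          \<mu> = tensor_lift A A A (\<lambda>(x, y). x \<otimes>\<^bsub>A\<^esub> y)
      in
        (\<forall>x\<in>carrier A.
           tensor_assoc A A A (tensor_map A A (tensor A A) A \<Delta> I (\<Delta> x)) =
           tensor_map A A A (tensor A A) I \<Delta> (\<Delta> x)) \<and>
        (\<forall>x\<in>carrier A.
           tensor_lift ground A A (\<lambda>(c, y). c \<odot>\<^bsub>A\<^esub> y) (tensor_map A A ground A \<epsilon> I (\<Delta> x)) = x \<and>
           tensor_lift A ground A (\<lambda>(y, c). c \<odot>\<^bsub>A\<^esub> y) (tensor_map A A A ground I \<epsilon> (\<Delta> x)) = x) \<and>
        (\<exists>S\<in>cont_linear A A. \<forall>x\<in>carrier A.
           \<mu> (tensor_map A A A A S I (\<Delta> x)) = \<epsilon> x \<odot>\<^bsub>A\<^esub> \<one>\<^bsub>A\<^esub> \<and>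
           \<mu> (tensor_map A A A A I S (\<Delta> x)) = \<epsilon> x \<odot>\<^bsub>A\<^esub> \<one>\<^bsub>A\<^esub>))"


section \<open>The weakly complete enveloping algebra\<close>

text \<open>
  \<open>U\<close> with the unit \<open>lam\<close> is an enveloping algebra of \<open>L\<close>. Since a formula of HOL cannot quantify
  over types, the test algebras \<open>A\<close> are those whose elements are taken from \<^typ>\<open>'u list \<Rightarrow> 'k\<close>.
  This type contains \<open>K\<^sup>J\<close> for every set \<open>J\<close> of lists over \<^typ>\<open>'u\<close>, hence up to isomorphism every
  finite-dimensional algebra as well as the weakly complete algebras on \<open>U\<close> and its tensor powers.
  Consequently nothing is lost: as every weakly complete algebra is a projective limit of
  finite-dimensional ones, the universal property for these \<open>A\<close> is equivalent to the one for
  weakly complete algebras of arbitrary size.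
\<close>

definition enveloping_algebra ::
    "('k::real_normed_field, 'l, 'm) top_lie_scheme \<Rightarrow> ('k, 'u, 'n) top_module_scheme \<Rightarrow>
     ('l \<Rightarrow> 'u) \<Rightarrow> bool" where
  "enveloping_algebra L U lam \<longleftrightarrow>
     wc_algebra U \<and> lam \<in> lie_hom L (lie_of U) \<and>
     (\<forall>A :: ('k, 'u list \<Rightarrow> 'k) top_module. wc_algebra A \<longrightarrow>
        (\<forall>f\<in>lie_hom L (lie_of A).
           \<exists>!f'. f' \<in> alg_hom U A \<and> (\<forall>x\<in>carrier L. f' (lam x) = f x)))"

text \<open>The functor \<open>U\<close> on a morphism \<open>k\<close> from \<open>L\<close> to a Lie algebra with enveloping algebra \<open>U'\<close>.\<close>

definition env_map ::
    "('k, 'l, 'm) top_lie_scheme \<Rightarrow> ('k, 'u, 'n) top_module_scheme \<Rightarrow> ('l \<Rightarrow> 'u) \<Rightarrow>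
     ('k, 'v, 'o) top_module_scheme \<Rightarrow> ('l' \<Rightarrow> 'v) \<Rightarrow> ('l \<Rightarrow> 'l') \<Rightarrow> 'u \<Rightarrow> 'v" where
  "env_map L U lam U' lam' k =
     (THE f. f \<in> alg_hom U U' \<and> (\<forall>x\<in>carrier L. f (lam x) = lam' (k x)))"

definition zero_lie :: "('k::real_normed_field, unit) top_lie" where
  "zero_lie = \<lparr>carrier = UNIV, monoid.mult = (\<lambda>_ _. ()), one = (), zero = (),
     add = (\<lambda>_ _. ()), smult = (\<lambda>_ _. ()), topol = discrete_topology UNIV, bracket = (\<lambda>_ _. ())\<rparr>"

text \<open>By lemma \<open>enveloping_algebra_zero_lie\<close> below, \<open>U({0}) = K\<close> with unit \<open>0\<close>.\<close>

definition env_coidentity ::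
    "('k::real_normed_field, 'l, 'm) top_lie_scheme \<Rightarrow> ('k, 'u, 'n) top_module_scheme \<Rightarrow>
     ('l \<Rightarrow> 'u) \<Rightarrow> 'u \<Rightarrow> 'k" where
  "env_coidentity L U lam =
     env_map L U lam ground (\<lambda>x\<in>carrier (zero_lie :: ('k, unit) top_lie). 0)
       (\<lambda>x\<in>carrier L. \<zero>\<^bsub>zero_lie :: ('k, unit) top_lie\<^esub>)"

definition env_comult ::
    "('k::real_normed_field, 'l, 'm) top_lie_scheme \<Rightarrow> ('k, 'u, 'n) top_module_scheme \<Rightarrow>
     ('l \<Rightarrow> 'u) \<Rightarrow> 'u \<Rightarrow> ('u \<times> 'u \<Rightarrow> 'k) \<Rightarrow> 'k" where
  "env_comult L U lam = (THE g. g \<in> alg_hom U (tensor_algebra U U) \<and>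
     (\<forall>x\<in>carrier L. g (lam x) =
        pure_tensor U U (lam x) \<one>\<^bsub>U\<^esub> \<oplus>\<^bsub>tensor U U\<^esub> pure_tensor U U \<one>\<^bsub>U\<^esub> (lam x)))"


section \<open>Correctness of the models\<close>

lemma cring_ground: "cring (ground :: ('k::real_normed_field, 'k) top_module)"
proof (rule cringI)
  have "\<exists>y. y + x = 0" for x :: 'k
    by (rule exI[of _ "- x"]) simp
  then show "abelian_group (ground :: ('k, 'k) top_module)"
    by (intro abelian_groupI) (simp_all add: ground_def algebra_simps)
  show "comm_monoid (ground :: ('k, 'k) top_module)"
    by (intro comm_monoidI) (simp_all add: ground_def algebra_simps)
qed (simp add: ground_def algebra_simps)

lemma continuous_map_cmult:
  fixes f :: "'a \<Rightarrow> 'k::real_normed_field"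
  assumes "continuous_map X euclidean f"
  shows "continuous_map X euclidean (\<lambda>x. c * f x)"
proof -
  have "continuous_map euclidean euclidean ((*) c)"
    by (simp add: continuous_on_mult_const)
  from continuous_map_compose[OF assms this] show ?thesis
    by (simp add: o_def)
qed

lemma continuous_map_times:
  fixes f g :: "'a \<Rightarrow> 'k::real_normed_field"
  assumes "continuous_map X euclidean f" "continuous_map X euclidean g"
  shows "continuous_map X euclidean (\<lambda>x. f x * g x)"
proof -
  have "continuous_map euclidean euclidean (\<lambda>p :: 'k \<times> 'k. fst p * snd p)"
    by (simp add: continuous_on_mult continuous_on_fst continuous_on_snd)
  moreover have "continuous_map X (prod_topology euclidean euclidean) (\<lambda>x. (f x, g x))"
    using assms by (rule continuous_map_pairedI)
  ultimately show ?thesis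
    using continuous_map_compose[of X euclidean "\<lambda>x. (f x, g x)" euclidean "\<lambda>p. fst p * snd p"]
    by (simp add: o_def)
qed

lemma bilin_forms_iff:
  "b \<in> bilin_forms V W \<longleftrightarrow> b \<in> extensional (carrier V \<times> carrier W) \<and>
     (\<forall>v\<in>carrier V. \<forall>v'\<in>carrier V. \<forall>w\<in>carrier W.
        b (v \<oplus>\<^bsub>V\<^esub> v', w) = b (v, w) + b (v', w)) \<and>
     (\<forall>v\<in>carrier V. \<forall>w\<in>carrier W. \<forall>w'\<in>carrier W.
        b (v, w \<oplus>\<^bsub>W\<^esub> w') = b (v, w) + b (v, w')) \<and>
     (\<forall>c. \<forall>v\<in>carrier V. \<forall>w\<in>carrier W.
        b (c \<odot>\<^bsub>V\<^esub> v, w) = c * b (v, w) \<and> b (v, c \<odot>\<^bsub>W\<^esub> w) = c * b (v, w)) \<and>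
     continuous_map (prod_topology (topol V) (topol W)) euclidean b"
  by (auto simp: cont_bilinear_def ground_def PiE_def Pi_def)

lemma tvs_closed:
  assumes "topological_vector_space V"
  shows "topspace (topol V) = carrier V"
    and "\<And>x y. x \<in> carrier V \<Longrightarrow> y \<in> carrier V \<Longrightarrow> x \<oplus>\<^bsub>V\<^esub> y \<in> carrier V"
    and "\<And>c x. x \<in> carrier V \<Longrightarrow> c \<odot>\<^bsub>V\<^esub> x \<in> carrier V"
proof -
  interpret Module.module "ground" V
    using assms by (simp add: topological_vector_space_def)
  show "topspace (topol V) = carrier V"
    using assms by (simp add: topological_vector_space_def)
  show "\<And>x y. x \<in> carrier V \<Longrightarrow> y \<in> carrier V \<Longrightarrow> x \<oplus>\<^bsub>V\<^esub> y \<in> carrier V"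
    by simp
  show "\<And>c x. x \<in> carrier V \<Longrightarrow> c \<odot>\<^bsub>V\<^esub> x \<in> carrier V"
    by (rule smult_closed) (auto simp: ground_def)
qed

lemma bilin_forms_lincomb:
  assumes V: "topological_vector_space V" and W: "topological_vector_space W"
    and b: "b \<in> bilin_forms V W" and b': "b' \<in> bilin_forms V W"
  shows "(\<lambda>p\<in>carrier V \<times> carrier W. c * b p + d * b' p) \<in> bilin_forms V W"
proof -
  let ?X = "prod_topology (topol V) (topol W)"
  note cl = tvs_closed[OF V] tvs_closed[OF W]
  have "continuous_map ?X euclidean (\<lambda>p. c * b p + d * b' p)"
    using b b' unfolding bilin_forms_iff
    by (intro continuous_map_add continuous_map_cmult) simp_all
  then have "continuous_map ?X euclidean (\<lambda>p\<in>carrier V \<times> carrier W. c * b p + d * b' p)"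
    by (rule continuous_map_eq) (auto simp: cl)
  then show ?thesis
    using b b' cl unfolding bilin_forms_iff
    by (auto simp: algebra_simps)
qed

lemma bilin_forms_closed:
  assumes V: "topological_vector_space V" and W: "topological_vector_space W"
    and b: "b \<in> bilin_forms V W"
  shows "b' \<in> bilin_forms V W \<Longrightarrow>
      (\<lambda>p\<in>carrier V \<times> carrier W. b p + b' p) \<in> bilin_forms V W"
    and "(\<lambda>p\<in>carrier V \<times> carrier W. c * b p) \<in> bilin_forms V W"
  using bilin_forms_lincomb[OF V W b, of b' 1 1] bilin_forms_lincomb[OF V W b b, of c 0]
  by simp_all

lemma carrier_tensor:
  "t \<in> carrier (tensor V W) \<longleftrightarrow> t \<in> extensional (bilin_forms V W) \<and>
     (\<forall>b\<in>bilin_forms V W. \<forall>b'\<in>bilin_forms V W.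
        t (\<lambda>p\<in>carrier V \<times> carrier W. b p + b' p) = t b + t b') \<and>
     (\<forall>c. \<forall>b\<in>bilin_forms V W. t (\<lambda>p\<in>carrier V \<times> carrier W. c * b p) = c * t b)"
  by (simp add: tensor_def Let_def PiE_def)

lemma tensor_simps:
  "zero (tensor V W) = (\<lambda>b\<in>bilin_forms V W. 0)"
  "add (tensor V W) = (\<lambda>s t. \<lambda>b\<in>bilin_forms V W. s b + t b)"
  "smult (tensor V W) = (\<lambda>c t. \<lambda>b\<in>bilin_forms V W. c * t b)"
  "topol (tensor V W) =
     subtopology (product_topology (\<lambda>_. euclidean) (bilin_forms V W)) (carrier (tensor V W))"
  by (simp_all add: tensor_def Let_def)

lemma tensor_lincomb:
  assumes V: "topological_vector_space V" and W: "topological_vector_space W"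
    and s: "s \<in> carrier (tensor V W)" and t: "t \<in> carrier (tensor V W)"
  shows "(\<lambda>b\<in>bilin_forms V W. c * s b + d * t b) \<in> carrier (tensor V W)"
  using s t unfolding carrier_tensor
  by (auto simp: bilin_forms_closed[OF V W] algebra_simps)

lemma tensor_closed:
  assumes V: "topological_vector_space V" and W: "topological_vector_space W"
    and s: "s \<in> carrier (tensor V W)"
  shows "t \<in> carrier (tensor V W) \<Longrightarrow> s \<oplus>\<^bsub>tensor V W\<^esub> t \<in> carrier (tensor V W)"
    and "c \<odot>\<^bsub>tensor V W\<^esub> s \<in> carrier (tensor V W)"
  using tensor_lincomb[OF V W s, of t 1 1] tensor_lincomb[OF V W s s, of c 0]
  by (simp_all add: tensor_simps)

lemma pure_tensor_closed:
  assumes V: "topological_vector_space V" and W: "topological_vector_space W"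
    and "v \<in> carrier V" "w \<in> carrier W"
  shows "pure_tensor V W v w \<in> carrier (tensor V W)"
  using assms(3,4) unfolding carrier_tensor pure_tensor_def
  by (auto simp: bilin_forms_closed[OF V W])

lemma topspace_tensor: "topspace (topol (tensor V W)) = carrier (tensor V W)"
  by (auto simp: tensor_simps carrier_tensor PiE_def)

lemma continuous_tensor_coord:
  assumes "b \<in> bilin_forms V W"
  shows "continuous_map (topol (tensor V W)) euclidean (\<lambda>t. t b)"
  unfolding tensor_simps
  by (rule continuous_map_from_subtopology)
     (rule continuous_map_product_projection[OF assms])

lemma continuous_into_tensor:
  "continuous_map X (topol (tensor V W)) f \<longleftrightarrow>
     f ` topspace X \<subseteq> carrier (tensor V W) \<and>
     (\<forall>b\<in>bilin_forms V W. continuous_map X euclidean (\<lambda>x. f x b))"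
  unfolding tensor_simps continuous_map_in_subtopology continuous_map_componentwise
  by (fastforce simp: carrier_tensor image_subset_iff_funcset[symmetric])

lemma tensor_tvs:
  fixes V :: "('k::real_normed_field, 'v, 'm) top_module_scheme"
    and W :: "('k, 'w, 'n) top_module_scheme"
  assumes V: "topological_vector_space V" and W: "topological_vector_space W"
  shows "topological_vector_space (tensor V W)"
  unfolding topological_vector_space_def
proof (intro conjI)
  let ?T = "tensor V W"
  show "Module.module (ground :: ('k, 'k) top_module) ?T"
  proof (rule Module.moduleI)
    show "cring (ground :: ('k, 'k) top_module)"
      by (rule cring_ground)
    show "abelian_group ?T"
    proof (rule abelian_groupI)
      fix x assume x: "x \<in> carrier ?T"
      show "\<exists>y\<in>carrier ?T. y \<oplus>\<^bsub>?T\<^esub> x = \<zero>\<^bsub>?T\<^esub>"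
        by (rule bexI[of _ "(-1) \<odot>\<^bsub>?T\<^esub> x"])
           (auto simp: tensor_closed[OF V W x], auto simp: tensor_simps)
      show "\<zero>\<^bsub>?T\<^esub> \<oplus>\<^bsub>?T\<^esub> x = x"
        using x by (auto simp: tensor_simps carrier_tensor extensional_def)
    next
      show "\<zero>\<^bsub>?T\<^esub> \<in> carrier ?T"
        by (auto simp: tensor_simps carrier_tensor bilin_forms_closed[OF V W])
    qed (auto simp: tensor_closed[OF V W], auto simp: tensor_simps algebra_simps)
    fix x assume x: "x \<in> carrier ?T"
    show "\<one>\<^bsub>ground\<^esub> \<odot>\<^bsub>?T\<^esub> x = x"
      using x by (auto simp: tensor_simps carrier_tensor extensional_def ground_def)
  qed (auto simp: tensor_closed[OF V W], auto simp: tensor_simps algebra_simps ground_def)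
  show "topspace (topol ?T) = carrier ?T"
    by (rule topspace_tensor)
  show "continuous_map (prod_topology (topol ?T) (topol ?T)) (topol ?T) (\<lambda>(x, y). x \<oplus>\<^bsub>?T\<^esub> y)"
    unfolding continuous_into_tensor
  proof (intro conjI ballI)
    show "(\<lambda>(x, y). x \<oplus>\<^bsub>?T\<^esub> y) ` topspace (prod_topology (topol ?T) (topol ?T)) \<subseteq> carrier ?T"
      by (auto simp: topspace_tensor tensor_closed[OF V W])
    fix b assume b: "b \<in> bilin_forms V W"
    have "continuous_map (prod_topology (topol ?T) (topol ?T)) euclidean (\<lambda>p. fst p b + snd p b)"
      by (intro continuous_map_add continuous_map_compose[OF continuous_map_fst continuous_tensor_coord[OF b], unfolded o_def]
          continuous_map_compose[OF continuous_map_snd continuous_tensor_coord[OF b], unfolded o_def])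
    then show "continuous_map (prod_topology (topol ?T) (topol ?T)) euclidean
        (\<lambda>p. (case p of (x, y) \<Rightarrow> x \<oplus>\<^bsub>?T\<^esub> y) b)"
      using b by (simp add: tensor_simps case_prod_beta)
  qed
  show "continuous_map (prod_topology euclidean (topol ?T)) (topol ?T) (\<lambda>(c, x). c \<odot>\<^bsub>?T\<^esub> x)"
    unfolding continuous_into_tensor
  proof (intro conjI ballI)
    show "(\<lambda>(c, x). c \<odot>\<^bsub>?T\<^esub> x) ` topspace (prod_topology euclidean (topol ?T)) \<subseteq> carrier ?T"
      by (auto simp: topspace_tensor tensor_closed[OF V W])
    fix b assume b: "b \<in> bilin_forms V W"
    have "continuous_map (prod_topology euclidean (topol ?T)) euclidean (\<lambda>p. fst p * snd p b)"
      by (intro continuous_map_times continuous_map_fst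
          continuous_map_compose[OF continuous_map_snd continuous_tensor_coord[OF b], unfolded o_def])
    then show "continuous_map (prod_topology euclidean (topol ?T)) euclidean
        (\<lambda>p. (case p of (c, x) \<Rightarrow> c \<odot>\<^bsub>?T\<^esub> x) b)"
      using b by (simp add: tensor_simps case_prod_beta)
  qed
qed

lemma tensor_functional_finite:
  fixes V :: "('k::real_normed_field, 'v, 'm) top_module_scheme"
    and W :: "('k, 'w, 'n) top_module_scheme"
  assumes V: "topological_vector_space V" and W: "topological_vector_space W"
    and S: "finite S" "S \<subseteq> bilin_forms V W"
    and F: "\<And>x y s t. s \<in> carrier (tensor V W) \<Longrightarrow> t \<in> carrier (tensor V W) \<Longrightarrow>
        F (\<lambda>b\<in>bilin_forms V W. x * s b + y * t b) = x * F s + y * F t"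
    and F0: "\<And>t. t \<in> carrier (tensor V W) \<Longrightarrow> \<forall>b\<in>S. t b = 0 \<Longrightarrow> F t = (0::'k)"
  shows "\<exists>c. \<forall>t\<in>carrier (tensor V W). F t = (\<Sum>b\<in>S. c b * t b)"
  using S F F0
proof (induction S arbitrary: F rule: finite_induct)
  case empty
  then show ?case by simp
next
  case (insert a S)
  let ?T = "carrier (tensor V W)" and ?B = "bilin_forms V W"
  show ?case
  proof (cases "\<exists>t\<in>?T. (\<forall>b\<in>S. t b = 0) \<and> t a \<noteq> 0")
    case False
    then have "\<And>t. t \<in> ?T \<Longrightarrow> \<forall>b\<in>S. t b = 0 \<Longrightarrow> F t = 0"
      using insert.prems(3) by blast
    with insert.IH[of F] insert.prems(1,2)
    obtain c where c: "\<forall>t\<in>?T. F t = (\<Sum>b\<in>S. c b * t b)"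
      by blast
    have "\<forall>t\<in>?T. F t = (\<Sum>b\<in>insert a S. (c(a := 0)) b * t b)"
      using c insert.hyps by (auto intro!: sum.cong)
    then show ?thesis by blast
  next
    case True
    then obtain t0 where t0: "t0 \<in> ?T" "\<forall>b\<in>S. t0 b = 0" "t0 a \<noteq> 0"
      by blast
    define d where "d = F t0 / t0 a"
    define G where "G t = F t - d * t a" for t
    have a: "a \<in> ?B"
      using insert.prems by blast
    have G: "G (\<lambda>b\<in>?B. x * s b + y * t b) = x * G s + y * G t" if "s \<in> ?T" "t \<in> ?T" for x y s t
    proof -
      have "F (\<lambda>b\<in>?B. x * s b + y * t b) = x * F s + y * F t"
        by (rule insert.prems(2)[OF that])
      then show ?thesis
        unfolding G_def using a by (simp add: algebra_simps del: restrict_apply add: restrict_apply')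
    qed
    have G0: "G t = 0" if t: "t \<in> ?T" "\<forall>b\<in>S. t b = 0" for t
    proof -
      let ?u = "\<lambda>b\<in>?B. 1 * t b + (- (t a / t0 a)) * t0 b"
      have "?u \<in> ?T"
        by (rule tensor_lincomb[OF V W t(1) t0(1)])
      moreover have "\<forall>b\<in>insert a S. ?u b = 0"
        using t t0 insert.prems(1) by auto
      ultimately have "F ?u = 0"
        by (rule insert.prems(3))
      moreover have "F ?u = 1 * F t + (- (t a / t0 a)) * F t0"
        by (rule insert.prems(2)[OF t(1) t0(1)])
      ultimately have "F t - (t a / t0 a) * F t0 = 0"
        by simp
      then show ?thesis
        by (simp add: G_def d_def algebra_simps)
    qed
    have "S \<subseteq> ?B"
      using insert.prems by blast
    from insert.IH[of G, OF this G G0]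
    obtain c where c: "\<forall>t\<in>?T. G t = (\<Sum>b\<in>S. c b * t b)"
      by blast
    have "F t = (\<Sum>b\<in>insert a S. (c(a := d)) b * t b)" if "t \<in> ?T" for t
    proof -
      have "(\<Sum>b\<in>S. (c(a := d)) b * t b) = (\<Sum>b\<in>S. c b * t b)"
        using insert.hyps by (intro sum.cong) auto
      then show ?thesis
        using c that insert.hyps by (simp add: G_def algebra_simps)
    qed
    then show ?thesis by blast
  qed
qed

lemma tensor_sum:
  fixes V :: "('k::real_normed_field, 'v, 'm) top_module_scheme"
    and W :: "('k, 'w, 'n) top_module_scheme"
  assumes V: "topological_vector_space V" and W: "topological_vector_space W"
    and "finite S" "f ` S \<subseteq> bilin_forms V W"
  shows "(\<lambda>p\<in>carrier V \<times> carrier W. \<Sum>i\<in>S. c i * f i p) \<in> bilin_forms V W \<and>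
    (\<forall>t\<in>carrier (tensor V W).
       t (\<lambda>p\<in>carrier V \<times> carrier W. \<Sum>i\<in>S. c i * f i p) = (\<Sum>i\<in>S. c i * t (f i)))"
  using assms(3,4)
proof (induction S rule: finite_induct)
  case empty
  let ?D = "carrier V \<times> carrier W"
  let ?z = "\<lambda>p\<in>?D. 0 :: 'k"
  have z: "?z \<in> bilin_forms V W"
    unfolding bilin_forms_iff using tvs_closed[OF V] tvs_closed[OF W]
    by (auto intro: continuous_map_eq[where f = "\<lambda>_. 0"])
  have "t ?z = 0" if "t \<in> carrier (tensor V W)" for t
  proof -
    have "t (\<lambda>p\<in>?D. 0 * ?z p) = 0 * t ?z"
      using that z unfolding carrier_tensor by blast
    moreover have "(\<lambda>p\<in>?D. 0 * ?z p) = ?z"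
      by auto
    ultimately show ?thesis by simp
  qed
  with z show ?case unfolding sum.empty by blast
next
  case (insert a S)
  let ?D = "carrier V \<times> carrier W"
  define s where "s = (\<lambda>p\<in>?D. \<Sum>i\<in>S. c i * f i p)"
  define u where "u = (\<lambda>p\<in>?D. c a * f a p)"
  have s: "s \<in> bilin_forms V W"
    using insert unfolding s_def by blast
  have u: "u \<in> bilin_forms V W"
    using insert.prems by (simp add: u_def bilin_forms_closed[OF V W])
  have eq: "(\<lambda>p\<in>?D. \<Sum>i\<in>insert a S. c i * f i p) = (\<lambda>p\<in>?D. u p + s p)"
    using insert.hyps by (auto simp: s_def u_def)
  have "t (\<lambda>p\<in>?D. u p + s p) = (\<Sum>i\<in>insert a S. c i * t (f i))" if t: "t \<in> carrier (tensor V W)" for t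
  proof -
    have "t (\<lambda>p\<in>?D. u p + s p) = t u + t s"
      using t s u unfolding carrier_tensor by blast
    also have "t u = c a * t (f a)"
      using t insert.prems unfolding carrier_tensor u_def by blast
    also have "t s = (\<Sum>i\<in>S. c i * t (f i))"
      using insert t unfolding s_def by blast
    finally show ?thesis
      unfolding sum.insert[OF insert.hyps] .
  qed
  then show ?case
    unfolding eq using bilin_forms_closed(1)[OF V W u s] by blast
qed

lemma tensor_functional_zero:
  fixes V :: "('k::real_normed_field, 'v, 'm) top_module_scheme"
    and W :: "('k, 'w, 'n) top_module_scheme"
  assumes V: "topological_vector_space V" and W: "topological_vector_space W"
    and F: "\<And>x y s t. s \<in> carrier (tensor V W) \<Longrightarrow> t \<in> carrier (tensor V W) \<Longrightarrow>
        F (\<lambda>b\<in>bilin_forms V W. x * s b + y * t b) = x * F s + y * F t"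
    and cont: "continuous_map (topol (tensor V W)) euclidean F"
    and F0: "\<And>v w. v \<in> carrier V \<Longrightarrow> w \<in> carrier W \<Longrightarrow> F (pure_tensor V W v w) = (0::'k)"
    and t: "t \<in> carrier (tensor V W)"
  shows "F t = 0"
proof -
  let ?T = "carrier (tensor V W)" and ?B = "bilin_forms V W" and ?D = "carrier V \<times> carrier W"
  have z: "(\<lambda>b\<in>?B. 0) \<in> ?T"
    using tensor_lincomb[OF V W t t, of 0 0] by simp
  have Fz: "F (\<lambda>b\<in>?B. 0) = 0"
    using F[OF t t, of 0 0] by simp
  have "openin (topol (tensor V W)) {s \<in> topspace (topol (tensor V W)). F s \<in> ball 0 1}"
    using cont by (rule openin_continuous_map_preimage) simp
  then obtain O' where O': "openin (product_topology (\<lambda>_. euclidean) ?B) O'"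
      "{s \<in> ?T. F s \<in> ball 0 1} = O' \<inter> ?T"
    unfolding topspace_tensor unfolding tensor_simps openin_subtopology by blast
  have "(\<lambda>b\<in>?B. 0) \<in> {s \<in> ?T. F s \<in> ball 0 1}"
    unfolding mem_Collect_eq Fz using z by simp
  then have "(\<lambda>b\<in>?B. 0) \<in> O'"
    unfolding O'(2) by (rule IntD1)
  with O'(1) obtain U where U: "finite {b \<in> ?B. U b \<noteq> topspace (euclidean :: 'k topology)}"
      "(\<lambda>b\<in>?B. 0) \<in> Pi\<^sub>E ?B U" "Pi\<^sub>E ?B U \<subseteq> O'"
    unfolding openin_product_topology_alt by blast
  define S where "S = {b \<in> ?B. U b \<noteq> UNIV}"
  have S: "finite S" "S \<subseteq> ?B"
    using U(1) by (auto simp: S_def)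
  have FS: "F s = 0" if s: "s \<in> ?T" "\<forall>b\<in>S. s b = 0" for s
  proof (rule ccontr)
    assume nz: "F s \<noteq> 0"
    define r where "r = (\<lambda>b\<in>?B. inverse (F s) * s b + 0 * s b)"
    have r: "r \<in> ?T"
      unfolding r_def by (rule tensor_lincomb[OF V W s(1) s(1)])
    have "r \<in> Pi\<^sub>E ?B U"
    proof (rule PiE_I)
      fix b assume b: "b \<in> ?B"
      show "r b \<in> U b"
      proof (cases "b \<in> S")
        case True
        then have "r b = 0"
          using s b by (simp add: r_def)
        then show ?thesis
          using U(2) b by (auto simp: PiE_def Pi_def)
      qed (use b in \<open>auto simp: S_def\<close>)
    qed (simp add: r_def)
    then have "r \<in> {s \<in> ?T. F s \<in> ball 0 1}"
      unfolding O'(2) using U(3) r by blast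
    then have "norm (F r) < 1"
      by simp
    moreover have "F r = 1"
      unfolding r_def F[OF s(1) s(1)] using nz by simp
    ultimately show False by simp
  qed
  obtain c where c: "\<forall>t\<in>?T. F t = (\<Sum>b\<in>S. c b * t b)"
    using tensor_functional_finite[OF V W S, of F] F FS by blast
  define g where "g = (\<lambda>p\<in>?D. \<Sum>b\<in>S. c b * b p)"
  have g: "t g = (\<Sum>b\<in>S. c b * t b)"
    using tensor_sum[OF V W S(1), of "\<lambda>b. b" c] S(2) t by (simp add: g_def)
  have "(\<Sum>b\<in>S. c b * b (v, w)) = 0" if "v \<in> carrier V" "w \<in> carrier W" for v w
  proof -
    have "(\<Sum>b\<in>S. c b * b (v, w)) = (\<Sum>b\<in>S. c b * pure_tensor V W v w b)"
      using S(2) by (intro sum.cong) (auto simp: pure_tensor_def)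
    also have "\<dots> = F (pure_tensor V W v w)"
      using c pure_tensor_closed[OF V W that] by simp
    finally show ?thesis
      using F0[OF that] by simp
  qed
  then have "g = (\<lambda>p\<in>?D. 0)"
    by (auto simp: g_def)
  moreover have "t (\<lambda>p\<in>?D. 0) = 0"
    using tensor_sum[OF V W, of "{}" "\<lambda>b. b" c] t by simp
  ultimately show ?thesis
    using g c t by simp
qed

lemma weakly_complete_iso:
  fixes X :: "('k::real_normed_field, 'x, 'o) top_module_scheme"
  assumes "weakly_complete X"
  obtains J :: "'x set" and h g where
    "h \<in> carrier X \<rightarrow> J \<rightarrow>\<^sub>E (UNIV :: 'k set)" "g \<in> (J \<rightarrow>\<^sub>E UNIV) \<rightarrow> carrier X"
    "\<And>x. x \<in> carrier X \<Longrightarrow> g (h x) = x" "\<And>a. a \<in> J \<rightarrow>\<^sub>E UNIV \<Longrightarrow> h (g a) = a"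
    "\<And>x y j. x \<in> carrier X \<Longrightarrow> y \<in> carrier X \<Longrightarrow> j \<in> J \<Longrightarrow> h (x \<oplus>\<^bsub>X\<^esub> y) j = h x j + h y j"
    "\<And>c x j. x \<in> carrier X \<Longrightarrow> j \<in> J \<Longrightarrow> h (c \<odot>\<^bsub>X\<^esub> x) j = c * h x j"
    "continuous_map (topol X) (product_topology (\<lambda>_. euclidean) J) h"
    "continuous_map (product_topology (\<lambda>_. euclidean) J) (topol X) g"
proof -
  from assms obtain J :: "'x set" and h where
    h: "h \<in> cont_linear X (power_space J)" and
    "homeomorphic_map (topol X) (topol (power_space J :: ('k, 'x \<Rightarrow> 'k) top_module)) h"
    unfolding weakly_complete_def by blast
  then obtain g where g: "homeomorphic_maps (topol X) (product_topology (\<lambda>_. euclidean) J) h g"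
    by (auto simp: homeomorphic_map_maps power_space_def)
  have X: "topspace (topol X) = carrier X"
    using assms by (simp add: weakly_complete_def topological_vector_space_def)
  show ?thesis
  proof (rule that[of h J g])
    show "h \<in> carrier X \<rightarrow> J \<rightarrow>\<^sub>E UNIV"
      using h by (auto simp: cont_linear_def power_space_def)
    show "g \<in> (J \<rightarrow>\<^sub>E UNIV) \<rightarrow> carrier X"
      using g X continuous_map_funspace[of "product_topology (\<lambda>_. euclidean) J" "topol X" g]
      by (simp add: homeomorphic_maps_def)
  qed (use g h X in \<open>auto simp: homeomorphic_maps_def cont_linear_def power_space_def\<close>)
qed

lemma tensor_universal:
  fixes V :: "('k::real_normed_field, 'v, 'm) top_module_scheme"
    and W :: "('k, 'w, 'n) top_module_scheme"
    and X :: "('k, 'x, 'o) top_module_scheme"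
  assumes V: "topological_vector_space V" and W: "topological_vector_space W"
    and X: "weakly_complete X" and \<phi>: "\<phi> \<in> cont_bilinear V W X"
  shows "\<exists>!f. f \<in> cont_linear (tensor V W) X \<and>
     (\<forall>v\<in>carrier V. \<forall>w\<in>carrier W. f (pure_tensor V W v w) = \<phi> (v, w))"
proof -
  let ?T = "carrier (tensor V W)" and ?B = "bilin_forms V W" and ?D = "carrier V \<times> carrier W"
  obtain h and J :: "'x set" and g where
    h: "h \<in> carrier X \<rightarrow> J \<rightarrow>\<^sub>E (UNIV :: 'k set)" and g: "g \<in> (J \<rightarrow>\<^sub>E UNIV) \<rightarrow> carrier X" and
    gh: "\<And>x. x \<in> carrier X \<Longrightarrow> g (h x) = x" and hg: "\<And>a. a \<in> J \<rightarrow>\<^sub>E UNIV \<Longrightarrow> h (g a) = a" and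
    hadd: "\<And>x y j. x \<in> carrier X \<Longrightarrow> y \<in> carrier X \<Longrightarrow> j \<in> J \<Longrightarrow> h (x \<oplus>\<^bsub>X\<^esub> y) j = h x j + h y j" and
    hsc: "\<And>c x j. x \<in> carrier X \<Longrightarrow> j \<in> J \<Longrightarrow> h (c \<odot>\<^bsub>X\<^esub> x) j = c * h x j" and
    hcont: "continuous_map (topol X) (product_topology (\<lambda>_. euclidean) J) h" and
    gcont: "continuous_map (product_topology (\<lambda>_. euclidean) J) (topol X) g"
    by (rule weakly_complete_iso[OF X]) (rule that, assumption+)
  have Xt: "topological_vector_space X"
    using X by (simp add: weakly_complete_def)
  have hcoord: "continuous_map (topol X) euclidean (\<lambda>x. h x j)" if "j \<in> J" for j
    using hcont that by (simp add: continuous_map_componentwise)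
  have hinj: "x = y" if "x \<in> carrier X" "y \<in> carrier X" "\<And>j. j \<in> J \<Longrightarrow> h x j = h y j" for x y
  proof -
    have "h x = h y"
      using h that by (intro PiE_ext[of _ J "\<lambda>_. UNIV"]) auto
    then show ?thesis
      using gh that by metis
  qed
  have \<phi>c: "\<phi> (v, w) \<in> carrier X" if "v \<in> carrier V" "w \<in> carrier W" for v w
    using \<phi> that by (auto simp: cont_bilinear_def)
  define \<beta> where "\<beta> j = (\<lambda>p\<in>?D. h (\<phi> p) j)" for j
  have \<beta>: "\<beta> j \<in> ?B" if j: "j \<in> J" for j
  proof -
    have "continuous_map (prod_topology (topol V) (topol W)) euclidean (\<lambda>p. h (\<phi> p) j)"
      using continuous_map_compose[OF _ hcoord[OF j]] \<phi> by (auto simp: o_def cont_bilinear_def)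
    then have "continuous_map (prod_topology (topol V) (topol W)) euclidean (\<beta> j)"
      by (rule continuous_map_eq) (auto simp: \<beta>_def tvs_closed[OF V] tvs_closed[OF W])
    then show ?thesis
      using \<phi> j \<phi>c tvs_closed[OF V] tvs_closed[OF W]
      unfolding bilin_forms_iff by (auto simp: \<beta>_def cont_bilinear_def hadd hsc)
  qed
  define f where "f = (\<lambda>t\<in>?T. g (\<lambda>j\<in>J. t (\<beta> j)))"
  have fc: "f t \<in> carrier X" if "t \<in> ?T" for t
    using g that by (auto simp: f_def)
  have hf: "h (f t) j = t (\<beta> j)" if "t \<in> ?T" "j \<in> J" for t j
    using that by (simp add: f_def hg)
  note Tc = tensor_closed[OF V W]
  have "f \<in> cont_linear (tensor V W) X"
    unfolding cont_linear_def
  proof (intro CollectI conjI ballI allI)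
    show "f \<in> ?T \<rightarrow>\<^sub>E carrier X"
      using fc by (auto simp: f_def)
    show "f (s \<oplus>\<^bsub>tensor V W\<^esub> t) = f s \<oplus>\<^bsub>X\<^esub> f t" if "s \<in> ?T" "t \<in> ?T" for s t
      using that by (intro hinj) (simp_all add: fc Tc tvs_closed[OF Xt] hadd hf \<beta>, simp add: tensor_simps \<beta>)
    show "f (c \<odot>\<^bsub>tensor V W\<^esub> t) = c \<odot>\<^bsub>X\<^esub> f t" if "t \<in> ?T" for c t
      using that by (intro hinj) (simp_all add: fc Tc tvs_closed[OF Xt] hsc hf \<beta>, simp add: tensor_simps \<beta>)
    have "continuous_map (topol (tensor V W)) (product_topology (\<lambda>_. euclidean) J) (\<lambda>t. \<lambda>j\<in>J. t (\<beta> j))"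
      by (auto simp: continuous_map_componentwise continuous_tensor_coord \<beta>)
    from continuous_map_compose[OF this gcont]
    show "continuous_map (topol (tensor V W)) (topol X) f"
      by (rule continuous_map_eq) (simp add: f_def topspace_tensor)
  qed
  moreover have "f (pure_tensor V W v w) = \<phi> (v, w)" if "v \<in> carrier V" "w \<in> carrier W" for v w
    using that by (intro hinj) (simp_all add: fc hf pure_tensor_closed[OF V W] \<phi>c,
      simp add: pure_tensor_def \<beta>, simp add: \<beta>_def)
  moreover have "f1 = f2"
    if f1: "f1 \<in> cont_linear (tensor V W) X"
      "\<forall>v\<in>carrier V. \<forall>w\<in>carrier W. f1 (pure_tensor V W v w) = \<phi> (v, w)"
    and f2: "f2 \<in> cont_linear (tensor V W) X"
      "\<forall>v\<in>carrier V. \<forall>w\<in>carrier W. f2 (pure_tensor V W v w) = \<phi> (v, w)" for f1 f2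
  proof (rule PiE_ext[of _ ?T "\<lambda>_. carrier X"])
    show "f1 \<in> ?T \<rightarrow>\<^sub>E carrier X" "f2 \<in> ?T \<rightarrow>\<^sub>E carrier X"
      using f1 f2 by (auto simp: cont_linear_def)
    fix t assume t: "t \<in> ?T"
    have fX: "f1 s \<in> carrier X" "f2 s \<in> carrier X" if "s \<in> ?T" for s
      using f1 f2 that by (auto simp: cont_linear_def)
    have lin: "h (F (\<lambda>b\<in>?B. x * s b + y * s' b)) j = x * h (F s) j + y * h (F s') j"
      if F: "F \<in> cont_linear (tensor V W) X" and s: "s \<in> ?T" "s' \<in> ?T" and j: "j \<in> J" for F x y s s' j
    proof -
      have "(\<lambda>b\<in>?B. x * s b + y * s' b) =
          (x \<odot>\<^bsub>tensor V W\<^esub> s) \<oplus>\<^bsub>tensor V W\<^esub> (y \<odot>\<^bsub>tensor V W\<^esub> s')"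
        by (auto simp: tensor_simps)
      moreover have "F s \<in> carrier X" "F s' \<in> carrier X"
        using F s by (auto simp: cont_linear_def)
      moreover have "F ((x \<odot>\<^bsub>tensor V W\<^esub> s) \<oplus>\<^bsub>tensor V W\<^esub> (y \<odot>\<^bsub>tensor V W\<^esub> s')) =
          (x \<odot>\<^bsub>X\<^esub> F s) \<oplus>\<^bsub>X\<^esub> (y \<odot>\<^bsub>X\<^esub> F s')"
        using F s by (simp add: cont_linear_def Tc)
      ultimately show ?thesis
        using j by (simp add: hadd hsc tvs_closed[OF Xt])
    qed
    show "f1 t = f2 t"
    proof (rule hinj)
      fix j assume j: "j \<in> J"
      have "h (f1 t) j - h (f2 t) j = 0"
      proof (rule tensor_functional_zero[OF V W _ _ _ t, of "\<lambda>t. h (f1 t) j - h (f2 t) j"])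
        show "continuous_map (topol (tensor V W)) euclidean (\<lambda>t. h (f1 t) j - h (f2 t) j)"
          using f1 f2 by (intro continuous_map_diff continuous_map_compose[OF _ hcoord[OF j], unfolded o_def])
            (auto simp: cont_linear_def)
      qed (use f1 f2 j in \<open>simp_all add: lin algebra_simps\<close>)
      then show "h (f1 t) j = h (f2 t) j" by simp
    qed (use fX t in auto)
  qed
  ultimately show ?thesis by blast
qed

lemma weakly_completeI:
  fixes V :: "('k::real_normed_field, 'v, 'm) top_module_scheme"
  assumes V: "topological_vector_space V" and h: "h \<in> cont_linear V (power_space (J :: 'v set))"
    and g: "continuous_map (product_topology (\<lambda>_. euclidean) J) (topol V) g"
    and "\<And>x. x \<in> carrier V \<Longrightarrow> g (h x) = x"
    and "\<And>a. a \<in> J \<rightarrow>\<^sub>E UNIV \<Longrightarrow> h (g a) = a"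
  shows "weakly_complete V"
proof -
  have "homeomorphic_maps (topol V) (topol (power_space J :: ('k, 'v \<Rightarrow> 'k) top_module)) h g"
    using assms tvs_closed(1)[OF V]
    by (auto simp: homeomorphic_maps_def cont_linear_def power_space_def)
  then show ?thesis
    using V h by (auto simp: weakly_complete_def homeomorphic_map_maps)
qed

lemma weakly_complete_tensor:
  fixes V :: "('k::real_normed_field, 'v, 'm) top_module_scheme"
    and W :: "('k, 'w, 'n) top_module_scheme"
  assumes V: "topological_vector_space V" and W: "topological_vector_space W"
  shows "weakly_complete (tensor V W)"
proof -
  let ?T = "carrier (tensor V W)" and ?B = "bilin_forms V W" and ?D = "carrier V \<times> carrier W"
  let ?sc = "\<lambda>(c :: 'k) (f :: 'v \<times> 'w \<Rightarrow> 'k) p. c * f p"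
  interpret fs: vector_space ?sc
    by unfold_locales (auto simp: fun_eq_iff algebra_simps)
  interpret ks: vector_space "(*) :: 'k \<Rightarrow> 'k \<Rightarrow> 'k"
    by unfold_locales (auto simp: algebra_simps)
  interpret fk: vector_space_pair ?sc "(*) :: 'k \<Rightarrow> 'k \<Rightarrow> 'k"
    by unfold_locales
  define Z where "Z b = (\<lambda>p. if p \<in> ?D then b p else 0)" for b :: "'v \<times> 'w \<Rightarrow> 'k"
  define R where "R x = (\<lambda>p\<in>?D. x p)" for x :: "'v \<times> 'w \<Rightarrow> 'k"
  obtain E where E: "E \<subseteq> Z ` ?B" "fs.independent E" "Z ` ?B \<subseteq> fs.span E"
    using fs.maximal_independent_subset[of "Z ` ?B"] by blast
  have RZ: "R (Z b) = b" if "b \<in> ?B" for b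
    using that by (auto simp: R_def Z_def bilin_forms_iff extensional_def)
  have RE: "R x \<in> ?B" "Z (R x) = x" if "x \<in> E" for x
    using that E(1) RZ by auto
  define rep where "rep b = fs.representation E (Z b)" for b
  define supp where "supp b = {x. rep b x \<noteq> 0}" for b
  have supp: "finite (supp b)" "supp b \<subseteq> E" for b
    using fs.finite_representation[of E "Z b"] fs.representation_ne_zero[of E "Z b"]
    by (auto simp: supp_def rep_def)
  have expand: "t b = (\<Sum>x\<in>supp b. rep b x * t (R x))" if t: "t \<in> ?T" and b: "b \<in> ?B" for t b
  proof -
    have sumfun: "(\<Sum>x\<in>A. F x) p = (\<Sum>x\<in>A. F x p)" for A p and F :: "_ \<Rightarrow> 'v \<times> 'w \<Rightarrow> 'k"
      by (induction A rule: infinite_finite_induct) auto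
    have "Z b \<in> fs.span E"
      using E(3) b by blast
    then have "(\<Sum>x\<in>supp b. ?sc (rep b x) x) = Z b"
      using fs.sum_nonzero_representation_eq[OF E(2)] by (simp add: supp_def rep_def)
    then have *: "(\<Sum>x\<in>supp b. rep b x * x p) = Z b p" for p
      using sumfun[of "\<lambda>x. ?sc (rep b x) x" "supp b" p] by simp
    have "(\<lambda>p\<in>?D. \<Sum>x\<in>supp b. rep b x * R x p) = R (Z b)"
      unfolding R_def by (rule restrict_ext) (simp add: *)
    then have eq: "b = (\<lambda>p\<in>?D. \<Sum>x\<in>supp b. rep b x * R x p)"
      using RZ[OF b] by simp
    have "R ` supp b \<subseteq> ?B"
      using supp(2) RE(1) by blast
    from tensor_sum[OF V W supp(1) this] t
    have "t (\<lambda>p\<in>?D. \<Sum>x\<in>supp b. rep b x * R x p) = (\<Sum>x\<in>supp b. rep b x * t (R x))"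
      by blast
    then show ?thesis
      by (simp only: eq[symmetric])
  qed
  define e where "e x = (\<lambda>y. if y = x then 1 else 0 :: 'k)" for x :: "'v \<times> 'w \<Rightarrow> 'k"
  have "inj e"
  proof (rule injI)
    fix x y assume "e x = e y"
    then have "e x x = e y x" by simp
    then show "x = y" by (simp add: e_def split: if_splits)
  qed
  then have de: "inv_into UNIV e (e x) = x" for x
    by simp
  define J where "J = e ` E"
  define h where "h = (\<lambda>t\<in>?T. \<lambda>j\<in>J. t (R (inv_into UNIV e j)))"
  define g where "g s = (\<lambda>b\<in>?B. \<Sum>x\<in>supp b. rep b x * s (e x))" for s :: "_ \<Rightarrow> 'k"
  have JB: "R (inv_into UNIV e j) \<in> ?B" if "j \<in> J" for j
    using that RE by (auto simp: J_def de)
  have gh: "g (h t) = t" if t: "t \<in> ?T" for t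
  proof (rule extensionalityI[of _ ?B])
    show "t \<in> extensional ?B"
      using t by (simp add: carrier_tensor)
    fix b assume b: "b \<in> ?B"
    have "h t (e x) = t (R x)" if "x \<in> supp b" for x
      using that t supp(2) by (auto simp: h_def J_def de)
    then show "g (h t) b = t b"
      using b expand[OF t b] by (simp add: g_def)
  qed (simp add: g_def)
  have surj: "\<exists>t\<in>?T. h t = s" if s: "s \<in> J \<rightarrow>\<^sub>E UNIV" for s
  proof -
    obtain L where L: "Vector_Spaces.linear ?sc (*) L" "\<And>x. x \<in> E \<Longrightarrow> L x = s (e x)"
      using fk.linear_independent_extend[OF E(2), of "\<lambda>x. s (e x)"] by blast
    interpret L: Vector_Spaces.linear ?sc "(*)" L
      by (rule L(1))
    define t where "t = (\<lambda>b\<in>?B. L (Z b))"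
    have "Z (\<lambda>p\<in>?D. b p + b' p) = Z b + Z b'" "Z (\<lambda>p\<in>?D. c * b p) = ?sc c (Z b)" for b b' c
      by (auto simp: Z_def)
    then have "t \<in> ?T"
      unfolding carrier_tensor
      by (auto simp: t_def bilin_forms_closed[OF V W] L.add L.scale)
    moreover have "h t = s"
    proof (rule PiE_ext[of _ J "\<lambda>_. UNIV"])
      show "h t \<in> J \<rightarrow>\<^sub>E UNIV" "s \<in> J \<rightarrow>\<^sub>E UNIV"
        using s \<open>t \<in> ?T\<close> by (auto simp: h_def)
      fix j assume "j \<in> J"
      then show "h t j = s j"
        using \<open>t \<in> ?T\<close> by (auto simp: h_def J_def de t_def RE L(2))
    qed
    ultimately show ?thesis by blast
  qed
  show ?thesis
  proof (rule weakly_completeI[OF tensor_tvs[OF V W], of h J g])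
    show "h \<in> cont_linear (tensor V W) (power_space J)"
      unfolding cont_linear_def
    proof (intro CollectI conjI ballI allI)
      show "h \<in> ?T \<rightarrow>\<^sub>E carrier (power_space J)"
        by (auto simp: h_def power_space_def)
      show "h (s \<oplus>\<^bsub>tensor V W\<^esub> t) = h s \<oplus>\<^bsub>power_space J\<^esub> h t" if "s \<in> ?T" "t \<in> ?T" for s t
        using that tensor_closed[OF V W]
        by (auto simp: h_def power_space_def JB) (auto simp: tensor_simps JB)
      show "h (c \<odot>\<^bsub>tensor V W\<^esub> t) = c \<odot>\<^bsub>power_space J\<^esub> h t" if "t \<in> ?T" for c t
        using that tensor_closed[OF V W]
        by (auto simp: h_def power_space_def JB) (auto simp: tensor_simps JB)
      have "continuous_map (topol (tensor V W)) (product_topology (\<lambda>_. euclidean) J)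
          (\<lambda>t. \<lambda>j\<in>J. t (R (inv_into UNIV e j)))"
        by (auto simp: continuous_map_componentwise continuous_tensor_coord JB)
      then have "continuous_map (topol (tensor V W)) (product_topology (\<lambda>_. euclidean) J) h"
        by (rule continuous_map_eq) (simp add: h_def topspace_tensor)
      then show "continuous_map (topol (tensor V W)) (topol (power_space J)) h"
        by (simp add: power_space_def)
    qed
    show "continuous_map (product_topology (\<lambda>_. euclidean) J) (topol (tensor V W)) g"
      unfolding continuous_into_tensor
    proof (intro conjI ballI)
      show "g ` topspace (product_topology (\<lambda>_. euclidean) J) \<subseteq> ?T"
        using surj gh by fastforce
      fix b assume b: "b \<in> ?B"
      have "continuous_map (product_topology (\<lambda>_. euclidean) J) euclidean
          (\<lambda>s. \<Sum>x\<in>supp b. rep b x * s (e x))"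
        using supp by (intro continuous_map_sum continuous_map_cmult continuous_map_product_projection)
          (auto simp: J_def)
      then show "continuous_map (product_topology (\<lambda>_. euclidean) J) euclidean (\<lambda>s. g s b)"
        using b by (simp add: g_def)
    qed
    show "g (h t) = t" if "t \<in> ?T" for t
      using that by (rule gh)
    show "h (g s) = s" if "s \<in> J \<rightarrow>\<^sub>E UNIV" for s
      using surj[OF that] gh by auto
  qed
qed

lemma wc_algebra_ground: "wc_algebra (ground :: ('k::real_normed_field, 'k) top_module)"
proof -
  let ?K = "ground :: ('k, 'k) top_module"
  interpret K: cring ?K
    by (rule cring_ground)
  have "continuous_map (prod_topology euclidean euclidean) euclidean (\<lambda>(x, y). x + y :: 'k)"
    unfolding case_prod_beta
    by (intro continuous_map_add continuous_map_fst continuous_map_snd)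
  moreover have mult: "continuous_map (prod_topology euclidean euclidean) euclidean (\<lambda>(x, y). x * y :: 'k)"
    unfolding case_prod_beta
    by (intro continuous_map_times continuous_map_fst continuous_map_snd)
  moreover have "Module.module ?K ?K"
    by (rule Module.moduleI[OF cring_ground K.abelian_group_axioms])
       (auto simp: ground_def algebra_simps)
  ultimately have tvs: "topological_vector_space ?K"
    unfolding topological_vector_space_def by (simp add: ground_def)
  have "weakly_complete ?K"
  proof (rule weakly_completeI[OF tvs, of "\<lambda>x. \<lambda>j\<in>{0}. x" "{0}" "\<lambda>a. a 0"])
    show "(\<lambda>x. \<lambda>j\<in>{0}. x) \<in> cont_linear ?K (power_space {0})"
      by (auto simp: cont_linear_def ground_def power_space_def continuous_map_componentwise split: if_splits)
    show "continuous_map (product_topology (\<lambda>_. euclidean) {0}) (topol ?K) (\<lambda>a. a 0)"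
      using continuous_map_product_projection[of 0 "{0}" "\<lambda>_. euclidean"]
      by (simp add: ground_def)
    show "(\<lambda>j\<in>{0}. a 0) = a" if "a \<in> {0} \<rightarrow>\<^sub>E UNIV" for a :: "'k \<Rightarrow> 'k"
      using that by (auto simp: PiE_def extensional_def)
  qed simp
  then show ?thesis
    unfolding wc_algebra_def using mult K.ring_axioms
    by (simp add: ground_def algebra_simps)
qed

lemma enveloping_algebra_zero_lie:
  "enveloping_algebra (zero_lie :: ('k::real_normed_field, unit) top_lie) ground
     (\<lambda>x\<in>carrier (zero_lie :: ('k, unit) top_lie). 0)"
  unfolding enveloping_algebra_def
proof (intro conjI allI impI ballI)
  let ?K = "ground :: ('k, 'k) top_module" and ?L = "zero_lie :: ('k, unit) top_lie"
  interpret K: cring ?K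
    by (rule cring_ground)
  show "wc_algebra ?K"
    by (rule wc_algebra_ground)
  have "x \<ominus>\<^bsub>?K\<^esub> x = 0" for x
    using K.r_neg[of x] by (simp add: a_minus_def) (simp add: ground_def)
  then show "(\<lambda>x\<in>carrier ?L. 0) \<in> lie_hom ?L (lie_of ?K)"
    by (auto simp: lie_hom_def lie_of_def cont_linear_def zero_lie_def ground_def)
  fix A :: "('k, 'k list \<Rightarrow> 'k) top_module" and f
  assume A: "wc_algebra A" and f: "f \<in> lie_hom ?L (lie_of A)"
  interpret A: Ring.ring A
    using A by (simp add: wc_algebra_def)
  have At: "topological_vector_space A"
    using A by (simp add: wc_algebra_def weakly_complete_def)
  interpret M: Module.module ?K A
    using At by (simp add: topological_vector_space_def)
  have "f () \<in> carrier A" "f () \<oplus>\<^bsub>A\<^esub> f () = f ()"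
    using f by (auto simp: lie_hom_def cont_linear_def lie_of_def zero_lie_def)
  then have f0: "f x = \<zero>\<^bsub>A\<^esub>" for x
    by (cases x) (metis A.add.l_cancel_one A.add.l_cancel_one')
  show "\<exists>!f'. f' \<in> alg_hom ?K A \<and> (\<forall>x\<in>carrier ?L. f' ((\<lambda>x\<in>carrier ?L. 0) x) = f x)"
  proof (rule ex1I[of _ "\<lambda>c. c \<odot>\<^bsub>A\<^esub> \<one>\<^bsub>A\<^esub>"])
    have K: "carrier ?K = UNIV" "add ?K = (+)" "monoid.mult ?K = (*)" "one ?K = 1" "zero ?K = 0"
      "smult ?K = (*)" "topol ?K = euclidean"
      by (simp_all add: ground_def)
    have "continuous_map euclidean (prod_topology euclidean (topol A)) (\<lambda>c :: 'k. (c, \<one>\<^bsub>A\<^esub>))"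
      using tvs_closed(1)[OF At] by (intro continuous_map_pairedI) auto
    moreover have "continuous_map (prod_topology euclidean (topol A)) (topol A) (\<lambda>(c, x). c \<odot>\<^bsub>A\<^esub> x)"
      using At by (simp add: topological_vector_space_def)
    ultimately have cont: "continuous_map euclidean (topol A) (\<lambda>c. c \<odot>\<^bsub>A\<^esub> \<one>\<^bsub>A\<^esub>)"
      using continuous_map_compose[of euclidean _ "\<lambda>c. (c, \<one>\<^bsub>A\<^esub>)" "topol A" "\<lambda>(c, x). c \<odot>\<^bsub>A\<^esub> x"]
      by (simp add: o_def)
    have sc: "c \<odot>\<^bsub>A\<^esub> x \<in> carrier A" if "x \<in> carrier A" for c x
      using tvs_closed(3)[OF At that] .
    have alg: "(c \<odot>\<^bsub>A\<^esub> x) \<otimes>\<^bsub>A\<^esub> y = c \<odot>\<^bsub>A\<^esub> (x \<otimes>\<^bsub>A\<^esub> y)" if "x \<in> carrier A" "y \<in> carrier A" for c x y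
      using A that by (simp add: wc_algebra_def)
    have dist: "(c + d) \<odot>\<^bsub>A\<^esub> \<one>\<^bsub>A\<^esub> = c \<odot>\<^bsub>A\<^esub> \<one>\<^bsub>A\<^esub> \<oplus>\<^bsub>A\<^esub> d \<odot>\<^bsub>A\<^esub> \<one>\<^bsub>A\<^esub>"
      "(c * d) \<odot>\<^bsub>A\<^esub> \<one>\<^bsub>A\<^esub> = c \<odot>\<^bsub>A\<^esub> (d \<odot>\<^bsub>A\<^esub> \<one>\<^bsub>A\<^esub>)" for c d
      using M.smult_l_distr[of c d "\<one>\<^bsub>A\<^esub>"] M.smult_assoc1[of c d "\<one>\<^bsub>A\<^esub>"] by (simp_all add: K)
    have one: "1 \<odot>\<^bsub>A\<^esub> x = x" if "x \<in> carrier A" for x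
      using M.smult_one[OF that] by (simp add: K)
    have "0 \<odot>\<^bsub>A\<^esub> \<one>\<^bsub>A\<^esub> = \<zero>\<^bsub>A\<^esub>"
      using M.smult_l_null[of "\<one>\<^bsub>A\<^esub>"] by (simp add: K)
    then show "(\<lambda>c. c \<odot>\<^bsub>A\<^esub> \<one>\<^bsub>A\<^esub>) \<in> alg_hom ?K A \<and>
        (\<forall>x\<in>carrier ?L. ((\<lambda>x\<in>carrier ?L. 0) x) \<odot>\<^bsub>A\<^esub> \<one>\<^bsub>A\<^esub> = f x)"
      by (auto simp: alg_hom_def cont_linear_def K f0 cont sc alg dist one)
    fix f' assume "f' \<in> alg_hom ?K A \<and> (\<forall>x\<in>carrier ?L. f' ((\<lambda>x\<in>carrier ?L. 0) x) = f x)"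
    then have "f' (c * 1) = c \<odot>\<^bsub>A\<^esub> \<one>\<^bsub>A\<^esub>" for c
      by (auto simp: alg_hom_def cont_linear_def K simp del: mult_1_right)
    then show "f' = (\<lambda>c. c \<odot>\<^bsub>A\<^esub> \<one>\<^bsub>A\<^esub>)"
      by auto
  qed
qed

end

theory Submission
  imports Defs
begin

text \<open>
  A continuous multilinear map on spaces \<open>K\<^sup>I\<close> depends on finitely many coordinates only, locally
  uniformly in further parameters. Hence the lift of a jointly continuous map to the tensor product
  is jointly continuous again, \<open>U \<otimes> U\<close> is a weakly complete algebra, and an identity of continuous
  linear maps on a tensor product may be checked on pure tensors. If \<open>U\<close> is
  isomorphic to \<open>K\<^sup>J\<close>, then every test algebra needed below is isomorphic to a power of \<open>K\<close> indexed by
  lists over \<open>J\<close>, so the universal property applies to it.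

  Coassociativity and the counit laws are equalities of algebra morphisms on \<open>U\<close>, hence hold since
  they hold on \<open>\<lambda>(L)\<close>. The antipode \<open>S\<close> is the morphism from \<open>U\<close> to the opposite algebra that extends
  \<open>- \<lambda>\<close>. The antipode laws do not compare algebra morphisms. Instead,
  \<open>D x = \<Sum> x\<^sub>1 S(x\<^sub>2) - \<epsilon>(x) 1\<close> is a derivation from \<open>U\<close> into \<open>U\<close> with the bimodule structure
  \<open>x \<cdot> m = \<Sum> x\<^sub>1 m S(x\<^sub>2)\<close> and \<open>m \<cdot> y = \<epsilon>(y) m\<close>. As \<open>D\<close> vanishes on \<open>\<lambda>(L)\<close>, the morphisms
  \<open>x \<mapsto> (x, D x)\<close> and \<open>x \<mapsto> (x, 0)\<close> into the square-zero extension agree on \<open>\<lambda>(L)\<close>, so \<open>D = 0\<close>.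
\<close>

text \<open>The elements of \<open>tensor V W\<close> are functionals on the space of continuous
  bilinear forms, with pointwise convergence. So \<open>t b\<close> is continuous in
  \<open>t\<close> for a fixed form \<open>b\<close>, while the product of two tensors evaluates one
  of them at a form that varies with the other. Joint continuity there is the analytic obstacle.
  Locally the moving form is a combination of one fixed finite set of forms, and the evaluation
  becomes a finite sum of products of continuous functions.

  The derivation comes from a computation. \<open>S\<close> reverses products and the
  comultiplication preserves them, so P(x) = \<Sum> x1 S(x2) satisfies P(x y) = x . P(y) for the
  action x . m = \<Sum> x1 m S(x2). As x . 1 = P(x), it follows that P(x y) - \<epsilon>(x)
  \<epsilon>(y) = x . (P(y) - \<epsilon>(y)) + \<epsilon>(y) (P(x) - \<epsilon>(x)), the Leibniz
  rule for P - \<epsilon>. For \<Sum> S(x1) x2 the sides are exchanged: the action m \<mapsto>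
  \<Sum> S(x1) m x2 is a right action, and the counit acts on the left.\<close>

section \<open>Continuous linear and bilinear maps\<close>

text \<open>Unlike \<open>cont_linear\<close> and \<open>cont_bilinear\<close>, these predicates do not demand extensionality,
  which makes them closed under composition of functions; bilinear maps are curried.\<close>

definition clin ::
    "('k::real_normed_field, 'v, 'm) top_module_scheme \<Rightarrow> ('k, 'w, 'n) top_module_scheme \<Rightarrow>
     ('v \<Rightarrow> 'w) \<Rightarrow> bool" where
  "clin V W f \<longleftrightarrow> f \<in> carrier V \<rightarrow> carrier W \<and>
     (\<forall>x\<in>carrier V. \<forall>y\<in>carrier V. f (x \<oplus>\<^bsub>V\<^esub> y) = f x \<oplus>\<^bsub>W\<^esub> f y) \<and>
     (\<forall>c. \<forall>x\<in>carrier V. f (c \<odot>\<^bsub>V\<^esub> x) = c \<odot>\<^bsub>W\<^esub> f x) \<and>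
     continuous_map (topol V) (topol W) f"

definition cbilin ::
    "('k::real_normed_field, 'v, 'm) top_module_scheme \<Rightarrow> ('k, 'w, 'n) top_module_scheme \<Rightarrow>
     ('k, 'x, 'o) top_module_scheme \<Rightarrow> ('v \<Rightarrow> 'w \<Rightarrow> 'x) \<Rightarrow> bool" where
  "cbilin V W X b \<longleftrightarrow>
     (\<forall>w\<in>carrier W. clin V X (\<lambda>v. b v w)) \<and> (\<forall>v\<in>carrier V. clin W X (b v)) \<and>
     continuous_map (prod_topology (topol V) (topol W)) (topol X) (\<lambda>p. b (fst p) (snd p))"

lemma ground_simps [simp]:
  "carrier ground = UNIV" "add ground = (+)" "monoid.mult ground = (*)" "one ground = 1"
  "zero ground = 0" "smult ground = (*)" "topol ground = euclidean"
  by (simp_all add: ground_def)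

lemma cont_linear_iff: "f \<in> cont_linear V W \<longleftrightarrow> clin V W f \<and> f \<in> extensional (carrier V)"
  by (auto simp: cont_linear_def clin_def PiE_def)

lemma clinI:
  assumes "\<And>x. x \<in> carrier V \<Longrightarrow> f x \<in> carrier W"
    and "\<And>x y. x \<in> carrier V \<Longrightarrow> y \<in> carrier V \<Longrightarrow> f (x \<oplus>\<^bsub>V\<^esub> y) = f x \<oplus>\<^bsub>W\<^esub> f y"
    and "\<And>c x. x \<in> carrier V \<Longrightarrow> f (c \<odot>\<^bsub>V\<^esub> x) = c \<odot>\<^bsub>W\<^esub> f x"
    and "continuous_map (topol V) (topol W) f"
  shows "clin V W f"
  using assms by (auto simp: clin_def)

lemma clinD:
  assumes "clin V W f"
  shows "\<And>x. x \<in> carrier V \<Longrightarrow> f x \<in> carrier W"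
    and "\<And>x y. x \<in> carrier V \<Longrightarrow> y \<in> carrier V \<Longrightarrow> f (x \<oplus>\<^bsub>V\<^esub> y) = f x \<oplus>\<^bsub>W\<^esub> f y"
    and "\<And>c x. x \<in> carrier V \<Longrightarrow> f (c \<odot>\<^bsub>V\<^esub> x) = c \<odot>\<^bsub>W\<^esub> f x"
    and "continuous_map (topol V) (topol W) f"
  using assms by (auto simp: clin_def)

lemma clin_cong:
  assumes "topological_vector_space V" "clin V W f" "\<And>x. x \<in> carrier V \<Longrightarrow> f x = g x"
  shows "clin V W g"
proof (rule clinI)
  note cl = tvs_closed[OF assms(1)]
  show "continuous_map (topol V) (topol W) g"
    using clinD(4)[OF assms(2)] by (rule continuous_map_eq) (simp add: cl assms(3))
  show "g x \<in> carrier W" if "x \<in> carrier V" for x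
    using clinD(1)[OF assms(2) that] assms(3)[OF that] by simp
  show "g (x \<oplus>\<^bsub>V\<^esub> y) = g x \<oplus>\<^bsub>W\<^esub> g y" if "x \<in> carrier V" "y \<in> carrier V" for x y
    using clinD(2)[OF assms(2) that] assms(3) that cl(2) by simp
  show "g (c \<odot>\<^bsub>V\<^esub> x) = c \<odot>\<^bsub>W\<^esub> g x" if "x \<in> carrier V" for c x
    using clinD(3)[OF assms(2) that] assms(3) that cl(3) by simp
qed

lemma clin_restrict:
  assumes "topological_vector_space V" "clin V W f"
  shows "(\<lambda>x\<in>carrier V. f x) \<in> cont_linear V W"
  unfolding cont_linear_iff using clin_cong[OF assms, of "\<lambda>x\<in>carrier V. f x"] by simp

lemma clin_id: "clin V V (\<lambda>x. x)"
  by (intro clinI) auto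

lemma clin_comp: "clin V W f \<Longrightarrow> clin W X g \<Longrightarrow> clin V X (\<lambda>x. g (f x))"
  using continuous_map_compose[of "topol V" "topol W" f "topol X" g]
  by (intro clinI) (auto simp: clinD o_def)

lemma cont_comp2:
  assumes "continuous_map (prod_topology X Y) Z (\<lambda>p. b (fst p) (snd p))"
    and "continuous_map T X f" "continuous_map T Y g"
  shows "continuous_map T Z (\<lambda>z. b (f z) (g z))"
  using continuous_map_compose[OF continuous_map_pairedI[OF assms(2,3)] assms(1)]
  by (simp add: o_def)

lemma cont_fst: "continuous_map T (prod_topology X Y) f \<Longrightarrow> continuous_map T X (\<lambda>z. fst (f z))"
  using continuous_map_fst_of[of T X Y f] by (simp add: o_def)

lemma cont_snd: "continuous_map T (prod_topology X Y) f \<Longrightarrow> continuous_map T Y (\<lambda>z. snd (f z))"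
  using continuous_map_snd_of[of T X Y f] by (simp add: o_def)

lemma cont_comp: "continuous_map T X f \<Longrightarrow> continuous_map X Y g \<Longrightarrow> continuous_map T Y (\<lambda>z. g (f z))"
  using continuous_map_compose[of T X f Y g] by (simp add: o_def)

lemma cont_id: "continuous_map T T (\<lambda>z. z)"
  using continuous_map_id[of T] by (simp add: id_def)

lemmas cont_intros = continuous_map_fst continuous_map_snd cont_fst cont_snd cont_id

lemma tvs_cont:
  assumes "topological_vector_space V" "continuous_map T (topol V) f"
  shows "continuous_map T (topol V) g \<Longrightarrow> continuous_map T (topol V) (\<lambda>z. f z \<oplus>\<^bsub>V\<^esub> g z)"
    and "continuous_map T euclidean c \<Longrightarrow> continuous_map T (topol V) (\<lambda>z. c z \<odot>\<^bsub>V\<^esub> f z)"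
proof -
  show "continuous_map T (topol V) g \<Longrightarrow> continuous_map T (topol V) (\<lambda>z. f z \<oplus>\<^bsub>V\<^esub> g z)"
    using assms by (intro cont_comp2[of "topol V" "topol V" "topol V" "add V" T f g])
      (simp_all add: topological_vector_space_def case_prod_unfold)
  show "continuous_map T euclidean c \<Longrightarrow> continuous_map T (topol V) (\<lambda>z. c z \<odot>\<^bsub>V\<^esub> f z)"
    using assms by (intro cont_comp2[of euclidean "topol V" "topol V" "smult V" T c f])
      (simp_all add: topological_vector_space_def case_prod_unfold)
qed

lemma tvs_module:
  fixes V :: "('k::real_normed_field, 'v, 'm) top_module_scheme"
  assumes "topological_vector_space V"
  shows "Module.module (ground :: ('k, 'k) top_module) V"
  using assms by (simp add: topological_vector_space_def)

lemma tvs_laws: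
  fixes V :: "('k::real_normed_field, 'v, 'm) top_module_scheme"
  assumes "topological_vector_space V"
  shows "abelian_group V"
    and "\<And>x. x \<in> carrier V \<Longrightarrow> 0 \<odot>\<^bsub>V\<^esub> x = \<zero>\<^bsub>V\<^esub>"
    and "\<And>x. x \<in> carrier V \<Longrightarrow> 1 \<odot>\<^bsub>V\<^esub> x = x"
    and "\<And>x. x \<in> carrier V \<Longrightarrow> (-1) \<odot>\<^bsub>V\<^esub> x = \<ominus>\<^bsub>V\<^esub> x"
    and "\<And>c d x. x \<in> carrier V \<Longrightarrow> c \<odot>\<^bsub>V\<^esub> (d \<odot>\<^bsub>V\<^esub> x) = (c * d) \<odot>\<^bsub>V\<^esub> x"
    and "\<And>c d x. x \<in> carrier V \<Longrightarrow> (c + d) \<odot>\<^bsub>V\<^esub> x = c \<odot>\<^bsub>V\<^esub> x \<oplus>\<^bsub>V\<^esub> d \<odot>\<^bsub>V\<^esub> x"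
    and "\<And>c x y. x \<in> carrier V \<Longrightarrow> y \<in> carrier V \<Longrightarrow>
          c \<odot>\<^bsub>V\<^esub> (x \<oplus>\<^bsub>V\<^esub> y) = c \<odot>\<^bsub>V\<^esub> x \<oplus>\<^bsub>V\<^esub> c \<odot>\<^bsub>V\<^esub> y"
    and "\<And>c. c \<odot>\<^bsub>V\<^esub> \<zero>\<^bsub>V\<^esub> = \<zero>\<^bsub>V\<^esub>"
proof -
  interpret M: Module.module "ground :: ('k, 'k) top_module" V
    by (rule tvs_module[OF assms])
  show "abelian_group V" ..
  show z: "0 \<odot>\<^bsub>V\<^esub> x = \<zero>\<^bsub>V\<^esub>" and o: "1 \<odot>\<^bsub>V\<^esub> x = x" if "x \<in> carrier V" for x
    using M.smult_l_null[OF that] M.smult_one[OF that] by simp_all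
  show d: "(c + d) \<odot>\<^bsub>V\<^esub> x = c \<odot>\<^bsub>V\<^esub> x \<oplus>\<^bsub>V\<^esub> d \<odot>\<^bsub>V\<^esub> x" if "x \<in> carrier V" for c d x
    using M.smult_l_distr[of c d x] that by simp
  show "c \<odot>\<^bsub>V\<^esub> (d \<odot>\<^bsub>V\<^esub> x) = (c * d) \<odot>\<^bsub>V\<^esub> x" if "x \<in> carrier V" for c d x
    using M.smult_assoc1[of c d x] that by simp
  show "c \<odot>\<^bsub>V\<^esub> (x \<oplus>\<^bsub>V\<^esub> y) = c \<odot>\<^bsub>V\<^esub> x \<oplus>\<^bsub>V\<^esub> c \<odot>\<^bsub>V\<^esub> y" if "x \<in> carrier V" "y \<in> carrier V" for c x y
    using M.smult_r_distr[of c x y] that by simp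
  show "c \<odot>\<^bsub>V\<^esub> \<zero>\<^bsub>V\<^esub> = \<zero>\<^bsub>V\<^esub>" for c
    using M.smult_r_null[of c] by simp
  show "(-1) \<odot>\<^bsub>V\<^esub> x = \<ominus>\<^bsub>V\<^esub> x" if x: "x \<in> carrier V" for x
  proof -
    have "(-1) \<odot>\<^bsub>V\<^esub> x \<oplus>\<^bsub>V\<^esub> x = \<zero>\<^bsub>V\<^esub>"
      using d[OF x, of "-1" 1] z[OF x] o[OF x] by simp
    then show ?thesis
      using x tvs_closed(3)[OF assms x] M.minus_equality by metis
  qed
qed

lemma tvs_zero_closed: "topological_vector_space V \<Longrightarrow> \<zero>\<^bsub>V\<^esub> \<in> carrier V"
  using tvs_laws(1) by (metis abelian_group.axioms(1) abelian_monoid.zero_closed)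

lemma clin_zero:
  assumes "clin V W f" "topological_vector_space V" "topological_vector_space W"
  shows "f \<zero>\<^bsub>V\<^esub> = \<zero>\<^bsub>W\<^esub>"
proof -
  have "f (0 \<odot>\<^bsub>V\<^esub> \<zero>\<^bsub>V\<^esub>) = 0 \<odot>\<^bsub>W\<^esub> f \<zero>\<^bsub>V\<^esub>"
    by (intro clinD(3)[OF assms(1)] tvs_zero_closed assms)
  then show ?thesis
    using clinD(1)[OF assms(1) tvs_zero_closed[OF assms(2)]]
    by (simp add: tvs_laws(2)[OF assms(2)] tvs_laws(2)[OF assms(3)] tvs_zero_closed[OF assms(2)])
qed

lemma cbilinI:
  assumes "topological_vector_space V" "topological_vector_space W"
    and "\<And>v w. v \<in> carrier V \<Longrightarrow> w \<in> carrier W \<Longrightarrow> b v w \<in> carrier X"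
    and "\<And>v v' w. v \<in> carrier V \<Longrightarrow> v' \<in> carrier V \<Longrightarrow> w \<in> carrier W \<Longrightarrow>
      b (v \<oplus>\<^bsub>V\<^esub> v') w = b v w \<oplus>\<^bsub>X\<^esub> b v' w"
    and "\<And>v w w'. v \<in> carrier V \<Longrightarrow> w \<in> carrier W \<Longrightarrow> w' \<in> carrier W \<Longrightarrow>
      b v (w \<oplus>\<^bsub>W\<^esub> w') = b v w \<oplus>\<^bsub>X\<^esub> b v w'"
    and "\<And>c v w. v \<in> carrier V \<Longrightarrow> w \<in> carrier W \<Longrightarrow> b (c \<odot>\<^bsub>V\<^esub> v) w = c \<odot>\<^bsub>X\<^esub> b v w"
    and "\<And>c v w. v \<in> carrier V \<Longrightarrow> w \<in> carrier W \<Longrightarrow> b v (c \<odot>\<^bsub>W\<^esub> w) = c \<odot>\<^bsub>X\<^esub> b v w"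
    and cont: "continuous_map (prod_topology (topol V) (topol W)) (topol X) (\<lambda>p. b (fst p) (snd p))"
  shows "cbilin V W X b"
  unfolding cbilin_def
  by (intro conjI ballI clinI assms cont_comp2[OF cont] cont_id continuous_map_const[THEN iffD2])
    (auto simp: assms tvs_closed)

lemma cbilinD:
  assumes "cbilin V W X b"
  shows "\<And>v w. v \<in> carrier V \<Longrightarrow> w \<in> carrier W \<Longrightarrow> b v w \<in> carrier X"
    and "\<And>v v' w. v \<in> carrier V \<Longrightarrow> v' \<in> carrier V \<Longrightarrow> w \<in> carrier W \<Longrightarrow>
      b (v \<oplus>\<^bsub>V\<^esub> v') w = b v w \<oplus>\<^bsub>X\<^esub> b v' w"
    and "\<And>v w w'. v \<in> carrier V \<Longrightarrow> w \<in> carrier W \<Longrightarrow> w' \<in> carrier W \<Longrightarrow>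
      b v (w \<oplus>\<^bsub>W\<^esub> w') = b v w \<oplus>\<^bsub>X\<^esub> b v w'"
    and "\<And>c v w. v \<in> carrier V \<Longrightarrow> w \<in> carrier W \<Longrightarrow> b (c \<odot>\<^bsub>V\<^esub> v) w = c \<odot>\<^bsub>X\<^esub> b v w"
    and "\<And>c v w. v \<in> carrier V \<Longrightarrow> w \<in> carrier W \<Longrightarrow> b v (c \<odot>\<^bsub>W\<^esub> w) = c \<odot>\<^bsub>X\<^esub> b v w"
    and "continuous_map (prod_topology (topol V) (topol W)) (topol X) (\<lambda>p. b (fst p) (snd p))"
  using assms by (auto simp: cbilin_def clin_def Pi_def)

lemma cbilin_left: "cbilin V W X b \<Longrightarrow> clin Z V f \<Longrightarrow> w \<in> carrier W \<Longrightarrow> clin Z X (\<lambda>z. b (f z) w)"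
  using clin_comp[of Z V f X "\<lambda>v. b v w"] by (auto simp: cbilin_def)

lemma cbilin_right: "cbilin V W X b \<Longrightarrow> clin Z W f \<Longrightarrow> v \<in> carrier V \<Longrightarrow> clin Z X (\<lambda>z. b v (f z))"
  using clin_comp[of Z W f X "b v"] by (auto simp: cbilin_def)

lemma cbilin_cont: "cbilin V W X b \<Longrightarrow> continuous_map T (topol V) f \<Longrightarrow> continuous_map T (topol W) g
    \<Longrightarrow> continuous_map T (topol X) (\<lambda>z. b (f z) (g z))"
  using cont_comp2[of "topol V" "topol W" "topol X" b T f g] by (auto simp: cbilin_def)

lemma clin_cont: "clin V W g \<Longrightarrow> continuous_map T (topol V) f \<Longrightarrow> continuous_map T (topol W) (\<lambda>z. g (f z))"
  using cont_comp[of T "topol V" f "topol W" g] by (auto simp: clin_def)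

lemma cbilin_comp:
  assumes "topological_vector_space V'" "topological_vector_space W'"
    "cbilin V W X b" "clin V' V f" "clin W' W g"
  shows "cbilin V' W' X (\<lambda>v w. b (f v) (g w))"
  by (intro cbilinI assms(1,2) cbilin_cont[OF assms(3)] clin_cont[OF assms(4)] clin_cont[OF assms(5)] cont_intros)
    (simp_all add: cbilinD[OF assms(3)] clinD[OF assms(4)] clinD[OF assms(5)])

lemma cbilin_clin:
  assumes "topological_vector_space V" "topological_vector_space W" "cbilin V W X b" "clin X Y f"
  shows "cbilin V W Y (\<lambda>v w. f (b v w))"
  by (intro cbilinI assms(1,2) clin_cont[OF assms(4)] cbilin_cont[OF assms(3)] cont_intros)
    (simp_all add: cbilinD[OF assms(3)] clinD[OF assms(4)])

lemma cbilin_cont_bilinear: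
  assumes V: "topological_vector_space V" and W: "topological_vector_space W" and b: "cbilin V W X b"
  shows "(\<lambda>p\<in>carrier V \<times> carrier W. b (fst p) (snd p)) \<in> cont_bilinear V W X"
proof -
  have "continuous_map (prod_topology (topol V) (topol W)) (topol X)
      (\<lambda>p\<in>carrier V \<times> carrier W. b (fst p) (snd p))"
    using cbilinD(6)[OF b] by (rule continuous_map_eq) (simp add: tvs_closed[OF V] tvs_closed[OF W])
  then show ?thesis
    using cbilinD[OF b] unfolding cont_bilinear_def
    by (auto simp: tvs_closed[OF V] tvs_closed[OF W])
qed

lemma cont_bilinear_cbilin:
  assumes V: "topological_vector_space V" and W: "topological_vector_space W"
    and b: "b \<in> cont_bilinear V W X"
  shows "cbilin V W X (\<lambda>v w. b (v, w))"
  using b by (intro cbilinI V W) (auto simp: cont_bilinear_def)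

section \<open>Coordinates\<close>

text \<open>The index type is independent of the vectors, whereas \<open>weakly_complete\<close>
  keeps the index set inside the type of vectors; products, disjoint sums and lists of indices can
  thus serve as index sets. Outside \<open>carrier V\<close> the values of \<open>h\<close> are left
  open.\<close>

locale coordinates =
  fixes V :: "('k::real_normed_field, 'v, 'm) top_module_scheme"
    and I :: "'i set" and h :: "'v \<Rightarrow> 'i \<Rightarrow> 'k" and g :: "('i \<Rightarrow> 'k) \<Rightarrow> 'v"
  assumes tvs: "topological_vector_space V"
    and h_ext: "\<And>x. x \<in> carrier V \<Longrightarrow> h x \<in> extensional I"
    and g_closed: "\<And>a. a \<in> extensional I \<Longrightarrow> g a \<in> carrier V"
    and gh: "\<And>x. x \<in> carrier V \<Longrightarrow> g (h x) = x"
    and hg: "\<And>a. a \<in> extensional I \<Longrightarrow> h (g a) = a"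
    and h_add: "\<And>x y i. x \<in> carrier V \<Longrightarrow> y \<in> carrier V \<Longrightarrow> i \<in> I \<Longrightarrow> h (x \<oplus>\<^bsub>V\<^esub> y) i = h x i + h y i"
    and h_smult: "\<And>c x i. x \<in> carrier V \<Longrightarrow> i \<in> I \<Longrightarrow> h (c \<odot>\<^bsub>V\<^esub> x) i = c * h x i"
    and h_cont: "\<And>i. i \<in> I \<Longrightarrow> continuous_map (topol V) euclidean (\<lambda>x. h x i)"
    and g_cont: "continuous_map (product_topology (\<lambda>_. euclidean) I) (topol V) g"
begin

definition e :: "'i \<Rightarrow> 'v" where "e i = g (\<lambda>k\<in>I. if k = i then 1 else 0)"

lemma e_closed: "e i \<in> carrier V"
  by (simp add: e_def g_closed)

lemma h_e: "k \<in> I \<Longrightarrow> h (e i) k = (if k = i then 1 else 0)"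
  by (simp add: e_def hg)

lemma h_zero: "i \<in> I \<Longrightarrow> h \<zero>\<^bsub>V\<^esub> i = 0"
  using h_smult[of "\<zero>\<^bsub>V\<^esub>" i 0] tvs_laws(8)[OF tvs, of 0] tvs_zero_closed[OF tvs] by simp

lemma h_cont_all: "continuous_map (topol V) (product_topology (\<lambda>_. euclidean) I) h"
  using h_cont by (auto simp: continuous_map_componentwise tvs_closed[OF tvs] h_ext)

text \<open>The topology of \<open>V\<close> is initial for the coordinates: \<open>f\<close> is
  recovered as \<open>g\<close> after the coordinate map of \<open>f\<close>.\<close>

lemma continuous_into:
  assumes "\<And>z. z \<in> topspace T \<Longrightarrow> f z \<in> carrier V"
    and "\<And>i. i \<in> I \<Longrightarrow> continuous_map T euclidean (\<lambda>z. h (f z) i)"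
  shows "continuous_map T (topol V) f"
proof -
  have "continuous_map T (product_topology (\<lambda>_. euclidean) I) (\<lambda>z. h (f z))"
    using assms h_ext by (auto simp: continuous_map_componentwise)
  from cont_comp[OF this g_cont] show ?thesis
    by (rule continuous_map_eq) (simp add: gh assms(1))
qed

text \<open>A basic open set of a product restricts only finitely many factors, so a neighbourhood
  of zero contains a whole subspace of finite codimension.\<close>

lemma zero_nbhd:
  assumes N: "openin (topol V) N" "\<zero>\<^bsub>V\<^esub> \<in> N"
  obtains F where "finite F" "F \<subseteq> I"
    "\<And>v. v \<in> carrier V \<Longrightarrow> \<forall>i\<in>F. h v i = 0 \<Longrightarrow> v \<in> N"
proof -
  let ?P = "product_topology (\<lambda>_. euclidean :: 'k topology) I"
  define O' where "O' = {a \<in> topspace ?P. g a \<in> N}"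
  have O': "openin ?P O'"
    unfolding O'_def using g_cont N(1) by (rule openin_continuous_map_preimage)
  have z: "\<zero>\<^bsub>V\<^esub> \<in> carrier V"
    using N openin_subset tvs_closed(1)[OF tvs] by fastforce
  then have "h \<zero>\<^bsub>V\<^esub> \<in> O'"
    using N by (simp add: O'_def gh h_ext PiE_def)
  with O' obtain U where U: "finite {i \<in> I. U i \<noteq> topspace (euclidean :: 'k topology)}"
      "h \<zero>\<^bsub>V\<^esub> \<in> Pi\<^sub>E I U" "Pi\<^sub>E I U \<subseteq> O'"
    unfolding openin_product_topology_alt by blast
  show ?thesis
  proof (rule that[of "{i \<in> I. U i \<noteq> UNIV}"])
    show "finite {i \<in> I. U i \<noteq> UNIV}"
      using U(1) by simp
    fix v assume v: "v \<in> carrier V" "\<forall>i\<in>{i \<in> I. U i \<noteq> UNIV}. h v i = 0"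
    have "h v \<in> Pi\<^sub>E I U"
    proof (rule PiE_I)
      fix i assume i: "i \<in> I"
      show "h v i \<in> U i"
      proof (cases "U i = UNIV")
        case False
        then have "h v i = h \<zero>\<^bsub>V\<^esub> i"
          using v i h_zero by simp
        then show ?thesis using U(2) i by auto
      qed simp
    qed (use v h_ext in \<open>auto simp: extensional_def\<close>)
    then show "v \<in> N"
      using U(3) v by (auto simp: O'_def gh)
  qed auto
qed

text \<open>A functional that kills the common kernel of the coordinates in \<open>F\<close> factors
  through the finite power over \<open>F\<close>. The induction peels off one coordinate at a
  time.\<close>

lemma functional_expand:
  assumes F: "finite F" "F \<subseteq> I"
    and "\<And>x y. x \<in> carrier V \<Longrightarrow> y \<in> carrier V \<Longrightarrow> \<psi> (x \<oplus>\<^bsub>V\<^esub> y) = \<psi> x + \<psi> y"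
    and "\<And>c x. x \<in> carrier V \<Longrightarrow> \<psi> (c \<odot>\<^bsub>V\<^esub> x) = c * \<psi> x"
    and "\<And>x. x \<in> carrier V \<Longrightarrow> \<forall>i\<in>F. h x i = 0 \<Longrightarrow> \<psi> x = 0"
    and "x \<in> carrier V"
  shows "\<psi> x = (\<Sum>i\<in>F. h x i * \<psi> (e i))"
  using assms
proof (induction F arbitrary: \<psi> x rule: finite_induct)
  case empty
  then show ?case by simp
next
  case (insert a F)
  \<comment> \<open>Removes the contribution of \<open>e a\<close>. If the coordinates of
    \<open>v\<close> in \<open>F\<close> vanish, then subtracting \<open>h v a\<close> times
    \<open>e a\<close> from \<open>v\<close> clears the coordinate \<open>a\<close> as well, so
    \<open>\<rho>\<close> kills \<open>v\<close>.\<close>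
  define \<rho> where "\<rho> v = \<psi> v - h v a * \<psi> (e a)" for v
  have a: "a \<in> I"
    using insert.prems by blast
  note cl = tvs_closed[OF tvs]
  have "\<rho> v = 0" if v: "v \<in> carrier V" "\<forall>i\<in>F. h v i = 0" for v
  proof -
    have "\<psi> (v \<oplus>\<^bsub>V\<^esub> (- h v a) \<odot>\<^bsub>V\<^esub> e a) = 0"
      using insert.prems(1) insert.hyps v
      by (intro insert.prems(4)) (auto simp: cl e_closed h_add h_smult h_e)
    then show ?thesis
      using v by (simp add: insert.prems cl e_closed \<rho>_def)
  qed
  then have "\<rho> x = (\<Sum>i\<in>F. h x i * \<rho> (e i))"
    using insert.prems a by (intro insert.IH) (auto simp: \<rho>_def h_add h_smult algebra_simps)
  also have "\<dots> = (\<Sum>i\<in>F. h x i * \<psi> (e i))"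
    using insert.hyps a by (intro sum.cong) (auto simp: \<rho>_def h_e)
  finally show ?case
    using insert.hyps by (simp add: \<rho>_def algebra_simps)
qed

text \<open>Renames the indices along an injection. It moves index sets into lists, as the test
  algebras require, and into the type of vectors, as \<open>weakly_complete\<close>
  requires.\<close>

lemma reindex:
  assumes "inj_on \<sigma> I"
  shows "coordinates V (\<sigma> ` I) (\<lambda>x. \<lambda>k\<in>\<sigma> ` I. h x (inv_into I \<sigma> k)) (\<lambda>a. g (\<lambda>i\<in>I. a (\<sigma> i)))"
proof
  let ?s = "inv_into I \<sigma>"
  have s: "?s (\<sigma> i) = i" if "i \<in> I" for i
    using that assms by simp
  show "topological_vector_space V" by (rule tvs)
  show "g (\<lambda>i\<in>I. (\<lambda>k\<in>\<sigma> ` I. h x (?s k)) (\<sigma> i)) = x" if "x \<in> carrier V" for x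
  proof -
    have "(\<lambda>i\<in>I. (\<lambda>k\<in>\<sigma> ` I. h x (?s k)) (\<sigma> i)) = h x"
      using h_ext[OF that] by (auto simp: s extensional_def)
    then show ?thesis using that gh by simp
  qed
  show "(\<lambda>k\<in>\<sigma> ` I. h (g (\<lambda>i\<in>I. a (\<sigma> i))) (?s k)) = a" if "a \<in> extensional (\<sigma> ` I)" for a
    using that by (intro extensionalityI[of _ "\<sigma> ` I"]) (auto simp: hg s)
  have "continuous_map (product_topology (\<lambda>_. euclidean) (\<sigma> ` I)) (product_topology (\<lambda>_. euclidean) I)
      (\<lambda>a. \<lambda>i\<in>I. a (\<sigma> i))"
    by (auto simp: continuous_map_componentwise intro!: continuous_map_product_projection)
  from cont_comp[OF this g_cont]
  show "continuous_map (product_topology (\<lambda>_. euclidean) (\<sigma> ` I)) (topol V) (\<lambda>a. g (\<lambda>i\<in>I. a (\<sigma> i)))" .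
qed (auto simp: g_closed h_add h_smult inv_into_into h_cont)

end

lemma weakly_complete_coordinates:
  fixes X :: "('k::real_normed_field, 'x, 'o) top_module_scheme"
  assumes "weakly_complete X"
  obtains J :: "'x set" and h g where "coordinates X J h g"
proof -
  obtain h and J :: "'x set" and g where
    "h \<in> carrier X \<rightarrow> J \<rightarrow>\<^sub>E (UNIV :: 'k set)" "g \<in> (J \<rightarrow>\<^sub>E UNIV) \<rightarrow> carrier X"
    "\<And>x. x \<in> carrier X \<Longrightarrow> g (h x) = x" "\<And>a. a \<in> J \<rightarrow>\<^sub>E UNIV \<Longrightarrow> h (g a) = a"
    "\<And>x y j. x \<in> carrier X \<Longrightarrow> y \<in> carrier X \<Longrightarrow> j \<in> J \<Longrightarrow> h (x \<oplus>\<^bsub>X\<^esub> y) j = h x j + h y j"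
    "\<And>c x j. x \<in> carrier X \<Longrightarrow> j \<in> J \<Longrightarrow> h (c \<odot>\<^bsub>X\<^esub> x) j = c * h x j"
    "continuous_map (topol X) (product_topology (\<lambda>_. euclidean) J) h"
    "continuous_map (product_topology (\<lambda>_. euclidean) J) (topol X) g"
    by (rule weakly_complete_iso[OF assms]) (rule that, assumption+)
  then have "coordinates X J h g"
    using assms unfolding coordinates_def
    by (auto simp: weakly_complete_def PiE_def Pi_iff continuous_map_componentwise)
  then show ?thesis by (rule that)
qed

section \<open>Finite expansions of bilinear forms, locally uniform in a parameter\<close>

locale coordinates_pair =
  V: coordinates V I h g + W: coordinates W J h' g'
  for V :: "('k::real_normed_field, 'v, 'm) top_module_scheme" and I :: "'i set" and h g
    and W :: "('k, 'w, 'n) top_module_scheme" and J :: "'j set" and h' g'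
begin

text \<open>On a neighbourhood where \<open>norm \<phi> < 1\<close>, the form vanishes as soon as one argument lies in
  a subspace of finite codimension contained in that neighbourhood; this bounds the number of
  coordinates involved, uniformly for \<open>y\<close> near \<open>y0\<close>.\<close>

lemma local_expansion:
  fixes \<phi> :: "'v \<Rightarrow> 'w \<Rightarrow> 'y \<Rightarrow> 'k"
  assumes cont: "continuous_map (prod_topology (prod_topology (topol V) (topol W)) Y) euclidean
      (\<lambda>p. \<phi> (fst (fst p)) (snd (fst p)) (snd p))"
    and bil: "\<And>y. y \<in> topspace Y \<Longrightarrow> cbilin V W ground (\<lambda>v w. \<phi> v w y)"
    and y0: "y0 \<in> topspace Y"
  obtains N F G where "openin Y N" "y0 \<in> N" "finite F" "F \<subseteq> I" "finite G" "G \<subseteq> J"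
    "\<And>v w y. v \<in> carrier V \<Longrightarrow> w \<in> carrier W \<Longrightarrow> y \<in> N \<Longrightarrow>
      \<phi> v w y = (\<Sum>i\<in>F. \<Sum>j\<in>G. h v i * h' w j * \<phi> (V.e i) (W.e j) y)"
proof -
  let ?P = "prod_topology (prod_topology (topol V) (topol W)) Y"
  have zV: "\<zero>\<^bsub>V\<^esub> \<in> carrier V" and zW: "\<zero>\<^bsub>W\<^esub> \<in> carrier W"
    by (intro tvs_zero_closed V.tvs W.tvs)+
  note cl = tvs_closed[OF V.tvs] tvs_closed[OF W.tvs]
  note b = cbilinD[OF bil, simplified]
  have "\<phi> \<zero>\<^bsub>V\<^esub> \<zero>\<^bsub>W\<^esub> y0 = 0"
    using b(4)[OF y0 zV zW, of 0] tvs_laws(8)[OF V.tvs, of 0] by simp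
  define Q where "Q = {p \<in> topspace ?P. \<phi> (fst (fst p)) (snd (fst p)) (snd p) \<in> ball 0 1}"
  have "openin ?P Q"
    unfolding Q_def using cont by (rule openin_continuous_map_preimage) simp
  moreover have "((\<zero>\<^bsub>V\<^esub>, \<zero>\<^bsub>W\<^esub>), y0) \<in> Q"
    using \<open>\<phi> \<zero>\<^bsub>V\<^esub> \<zero>\<^bsub>W\<^esub> y0 = 0\<close> zV zW y0 by (simp add: Q_def cl)
  ultimately obtain A N where A: "openin (prod_topology (topol V) (topol W)) A" "(\<zero>\<^bsub>V\<^esub>, \<zero>\<^bsub>W\<^esub>) \<in> A"
    and N: "openin Y N" "y0 \<in> N" and AN: "A \<times> N \<subseteq> Q"
    unfolding openin_prod_topology_alt[of "prod_topology (topol V) (topol W)"] by blast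
  from A obtain N1 N2 where N1: "openin (topol V) N1" "\<zero>\<^bsub>V\<^esub> \<in> N1"
    and N2: "openin (topol W) N2" "\<zero>\<^bsub>W\<^esub> \<in> N2" and N12: "N1 \<times> N2 \<subseteq> A"
    unfolding openin_prod_topology_alt by blast
  have small: "norm (\<phi> v w y) < 1" if "v \<in> N1" "w \<in> N2" "y \<in> N" for v w y
  proof -
    have "((v, w), y) \<in> Q" using that N12 AN by blast
    then show ?thesis by (simp add: Q_def)
  qed
  have NY: "y \<in> topspace Y" if "y \<in> N" for y
    using N(1) that openin_subset by blast
  \<comment> \<open>A zero neighbourhood absorbs every vector: \<open>c\<close> times
    \<open>x\<close> tends to zero with \<open>c\<close>, so some nonzero multiple of
    \<open>x\<close> lies in \<open>M\<close>.\<close>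
  have absorb: "\<exists>c. c \<noteq> 0 \<and> c \<odot>\<^bsub>X\<^esub> x \<in> M"
    if X: "topological_vector_space X" and "openin (topol X) M" "\<zero>\<^bsub>X\<^esub> \<in> M" "x \<in> carrier X"
    for X :: "('k, 'x, 'o) top_module_scheme" and M x
  proof -
    have "continuous_map euclidean (topol X) (\<lambda>c. c \<odot>\<^bsub>X\<^esub> x)"
      using that by (intro tvs_cont(2)[OF X]) (auto simp: tvs_closed)
    then have "openin euclidean {c \<in> topspace euclidean. c \<odot>\<^bsub>X\<^esub> x \<in> M}"
      using that by (intro openin_continuous_map_preimage)
    then have "open {c. c \<odot>\<^bsub>X\<^esub> x \<in> M}" by simp
    moreover have "0 \<in> {c. c \<odot>\<^bsub>X\<^esub> x \<in> M}"
      using that by (simp add: tvs_laws(2))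
    ultimately obtain r where r: "r > 0" "ball 0 r \<subseteq> {c. c \<odot>\<^bsub>X\<^esub> x \<in> M}"
      unfolding open_contains_ball by blast
    have "of_real (r / 2) \<in> ball (0 :: 'k) r" "of_real (r / 2) \<noteq> (0 :: 'k)"
      using r(1) by (auto simp del: of_real_divide)
    then show ?thesis using r(2) by blast
  qed
  \<comment> \<open>Turns the bound into an exact identity: a scalar all of whose multiples lie in
    the open unit ball is zero.\<close>
  have unbounded: "z = 0" if "\<And>r. norm (r * z) < 1" for z :: 'k
  proof (rule ccontr)
    assume "z \<noteq> 0"
    then have "norm (inverse z * z) = 1" by simp
    then show False using that[of "inverse z"] by simp
  qed
  obtain F where F: "finite F" "F \<subseteq> I" "\<And>v. v \<in> carrier V \<Longrightarrow> \<forall>i\<in>F. h v i = 0 \<Longrightarrow> v \<in> N1"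
    using V.zero_nbhd[OF N1] by blast
  obtain G where G: "finite G" "G \<subseteq> J" "\<And>w. w \<in> carrier W \<Longrightarrow> \<forall>j\<in>G. h' w j = 0 \<Longrightarrow> w \<in> N2"
    using W.zero_nbhd[OF N2] by blast
  \<comment> \<open>All multiples of \<open>v\<close> keep the coordinates in \<open>F\<close> at
    zero and so stay in \<open>N1\<close>, while a single nonzero multiple of \<open>w\<close> has
    to lie in \<open>N2\<close>. As \<open>F\<close> is chosen before \<open>w\<close> and
    \<open>y\<close>, it is the same for all of them.\<close>
  have V0: "\<phi> v w y = 0" if v: "v \<in> carrier V" "\<forall>i\<in>F. h v i = 0" and w: "w \<in> carrier W" and y: "y \<in> N" for v w y
  proof -
    obtain c where c: "c \<noteq> 0" "c \<odot>\<^bsub>W\<^esub> w \<in> N2"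
      using absorb[OF W.tvs N2 w] by blast
    have "norm (r * (c * \<phi> v w y)) < 1" for r
    proof -
      have "r \<odot>\<^bsub>V\<^esub> v \<in> N1"
        using v F by (auto simp: cl V.h_smult subset_iff)
      then show ?thesis
        using small[of "r \<odot>\<^bsub>V\<^esub> v" "c \<odot>\<^bsub>W\<^esub> w" y] c v w y NY by (simp add: b cl mult.left_commute)
    qed
    then have "c * \<phi> v w y = 0" by (rule unbounded)
    then show ?thesis using c by simp
  qed
  have W0: "\<phi> v w y = 0" if w: "w \<in> carrier W" "\<forall>j\<in>G. h' w j = 0" and v: "v \<in> carrier V" and y: "y \<in> N" for v w y
  proof -
    obtain c where c: "c \<noteq> 0" "c \<odot>\<^bsub>V\<^esub> v \<in> N1"
      using absorb[OF V.tvs N1 v] by blast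
    have "norm (r * (c * \<phi> v w y)) < 1" for r
    proof -
      have "r \<odot>\<^bsub>W\<^esub> w \<in> N2"
        using w G by (auto simp: cl W.h_smult subset_iff)
      then show ?thesis
        using small[of "c \<odot>\<^bsub>V\<^esub> v" "r \<odot>\<^bsub>W\<^esub> w" y] c v w y NY by (simp add: b cl mult.left_commute)
    qed
    then have "c * \<phi> v w y = 0" by (rule unbounded)
    then show ?thesis using c by simp
  qed
  show ?thesis
  proof (rule that[OF N F(1,2) G(1,2)])
    fix v w y assume v: "v \<in> carrier V" and w: "w \<in> carrier W" and y: "y \<in> N"
    have "\<phi> v w y = (\<Sum>i\<in>F. h v i * \<phi> (V.e i) w y)"
      using F(1,2) v w y by (intro V.functional_expand) (auto simp: b NY V0)
    also have "\<dots> = (\<Sum>i\<in>F. h v i * (\<Sum>j\<in>G. h' w j * \<phi> (V.e i) (W.e j) y))"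
      using G(1,2) w y
      by (intro sum.cong refl arg_cong2[where f = "(*)"] W.functional_expand)
        (auto simp: b NY W0 V.e_closed)
    finally show "\<phi> v w y = (\<Sum>i\<in>F. \<Sum>j\<in>G. h v i * h' w j * \<phi> (V.e i) (W.e j) y)"
      by (simp add: sum_distrib_left mult.assoc)
  qed
qed

end

section \<open>Tensor products\<close>

context coordinates_pair
begin

lemmas tvs_pair = V.tvs W.tvs

text \<open>The product of two coordinate functionals. These forms turn out to be a basis of the
  space of continuous bilinear forms, and so yield the coordinates of the tensor product.\<close>

definition prod_form :: "'i \<times> 'j \<Rightarrow> 'v \<times> 'w \<Rightarrow> 'k" where
  "prod_form q = (\<lambda>p\<in>carrier V \<times> carrier W. h (fst p) (fst q) * h' (snd p) (snd q))"

definition basis_value :: "('v \<times> 'w \<Rightarrow> 'k) \<Rightarrow> 'i \<times> 'j \<Rightarrow> 'k" where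
  "basis_value b q = b (V.e (fst q), W.e (snd q))"

definition supp :: "('v \<times> 'w \<Rightarrow> 'k) \<Rightarrow> ('i \<times> 'j) set" where
  "supp b = {q \<in> I \<times> J. basis_value b q \<noteq> 0}"

lemma prod_form_closed: "q \<in> I \<times> J \<Longrightarrow> prod_form q \<in> bilin_forms V W"
proof -
  assume q: "q \<in> I \<times> J"
  note cl = tvs_closed[OF V.tvs] tvs_closed[OF W.tvs]
  have "cbilin V W ground (\<lambda>v w. h v (fst q) * h' w (snd q))"
    using q by (intro cbilinI tvs_pair)
      (auto simp: V.h_add W.h_add V.h_smult W.h_smult algebra_simps
        intro!: continuous_map_times cont_comp[OF _ V.h_cont] cont_comp[OF _ W.h_cont] cont_intros)
  from cbilin_cont_bilinear[OF tvs_pair this] show ?thesis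
    by (simp add: prod_form_def)
qed

lemma basis_value_prod_form:
  "q \<in> I \<times> J \<Longrightarrow> q' \<in> I \<times> J \<Longrightarrow> basis_value (prod_form q) q' = (if q' = q then 1 else 0)"
  by (auto simp: basis_value_def prod_form_def V.e_closed W.e_closed V.h_e W.h_e split: if_splits)

text \<open>Combines \<open>local_expansion\<close> with the linearity of \<open>t\<close>. The
  finite set \<open>Q\<close> serves all \<open>y\<close> in \<open>N\<close> and all
  \<open>t\<close> at once, which is what continuity in the pair of \<open>t\<close> and
  \<open>y\<close> rests on.\<close>

lemma tensor_local_expansion:
  fixes \<phi> :: "'v \<Rightarrow> 'w \<Rightarrow> 'y \<Rightarrow> 'k"
  assumes cont: "continuous_map (prod_topology (prod_topology (topol V) (topol W)) Y) euclidean
      (\<lambda>p. \<phi> (fst (fst p)) (snd (fst p)) (snd p))"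
    and bil: "\<And>y. y \<in> topspace Y \<Longrightarrow> cbilin V W ground (\<lambda>v w. \<phi> v w y)"
    and y0: "y0 \<in> topspace Y"
  obtains N Q where "openin Y N" "y0 \<in> N" "finite Q" "Q \<subseteq> I \<times> J"
    "\<And>y p. y \<in> N \<Longrightarrow> p \<in> carrier V \<times> carrier W \<Longrightarrow>
      \<phi> (fst p) (snd p) y = (\<Sum>q\<in>Q. \<phi> (V.e (fst q)) (W.e (snd q)) y * prod_form q p)"
    "\<And>t y. t \<in> carrier (tensor V W) \<Longrightarrow> y \<in> N \<Longrightarrow>
      t (\<lambda>p\<in>carrier V \<times> carrier W. \<phi> (fst p) (snd p) y) =
        (\<Sum>q\<in>Q. \<phi> (V.e (fst q)) (W.e (snd q)) y * t (prod_form q))"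
proof -
  obtain N F G where N: "openin Y N" "y0 \<in> N" and FG: "finite F" "F \<subseteq> I" "finite G" "G \<subseteq> J"
    and exp: "\<And>v w y. v \<in> carrier V \<Longrightarrow> w \<in> carrier W \<Longrightarrow> y \<in> N \<Longrightarrow>
      \<phi> v w y = (\<Sum>i\<in>F. \<Sum>j\<in>G. h v i * h' w j * \<phi> (V.e i) (W.e j) y)"
    using local_expansion[OF assms] by blast
  have e1: "\<phi> (fst p) (snd p) y = (\<Sum>q\<in>F \<times> G. \<phi> (V.e (fst q)) (W.e (snd q)) y * prod_form q p)"
    if "y \<in> N" "p \<in> carrier V \<times> carrier W" for y p
    using that exp[of "fst p" "snd p" y]
    by (auto simp: sum.cartesian_product prod_form_def case_prod_beta mult.commute intro!: sum.cong)
  show ?thesis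
  proof (rule that[OF N, of "F \<times> G"])
    show "finite (F \<times> G)" "F \<times> G \<subseteq> I \<times> J" using FG by auto
    show "t (\<lambda>p\<in>carrier V \<times> carrier W. \<phi> (fst p) (snd p) y) =
        (\<Sum>q\<in>F \<times> G. \<phi> (V.e (fst q)) (W.e (snd q)) y * t (prod_form q))"
      if t: "t \<in> carrier (tensor V W)" and y: "y \<in> N" for t y
    proof -
      have "(\<lambda>p\<in>carrier V \<times> carrier W. \<phi> (fst p) (snd p) y) =
          (\<lambda>p\<in>carrier V \<times> carrier W. \<Sum>q\<in>F \<times> G. \<phi> (V.e (fst q)) (W.e (snd q)) y * prod_form q p)"
        by (rule restrict_ext) (rule e1[OF y])
      moreover have "prod_form ` (F \<times> G) \<subseteq> bilin_forms V W"
        using FG by (auto intro!: prod_form_closed)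
      ultimately show ?thesis
        using tensor_sum[OF tvs_pair, of "F \<times> G" prod_form "\<lambda>q. \<phi> (V.e (fst q)) (W.e (snd q)) y"] t FG
        by simp
    qed
  qed (rule e1)
qed

text \<open>A one-point parameter space turns \<open>tensor_local_expansion\<close> into a statement
  about a single form. Evaluating the expansion at pairs of basis vectors shows that
  \<open>Q\<close> contains \<open>supp b\<close>; the other terms of the sum have coefficient
  zero.\<close>

lemma form_expand:
  assumes b: "b \<in> bilin_forms V W"
  shows "finite (supp b)"
    and "t \<in> carrier (tensor V W) \<Longrightarrow> t b = (\<Sum>q\<in>supp b. basis_value b q * t (prod_form q))"
proof -
  let ?Y = "discrete_topology {()}" and ?D = "carrier V \<times> carrier W"
  have cb: "cbilin V W ground (\<lambda>v w. b (v, w))"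
    by (rule cont_bilinear_cbilin[OF tvs_pair b])
  have "continuous_map (prod_topology (prod_topology (topol V) (topol W)) ?Y) euclidean
      (\<lambda>p. b (fst (fst p), snd (fst p)))"
    using cbilin_cont[OF cb, of "prod_topology (prod_topology (topol V) (topol W)) ?Y"
        "\<lambda>p. fst (fst p)" "\<lambda>p. snd (fst p)"]
    by (auto intro: cont_intros)
  note ex = tensor_local_expansion[where \<phi> = "\<lambda>v w _. b (v, w)" and ?y0.0 = "()", OF this cb]
  obtain N Q where N: "() \<in> N" and Q: "finite Q" "Q \<subseteq> I \<times> J"
    and ex': "\<And>y p. y \<in> N \<Longrightarrow> p \<in> ?D \<Longrightarrow>
      b (fst p, snd p) = (\<Sum>q\<in>Q. b (V.e (fst q), W.e (snd q)) * prod_form q p)"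
    and tex': "\<And>t y. t \<in> carrier (tensor V W) \<Longrightarrow> y \<in> N \<Longrightarrow>
      t (\<lambda>p\<in>?D. b (fst p, snd p)) = (\<Sum>q\<in>Q. b (V.e (fst q), W.e (snd q)) * t (prod_form q))"
    by (rule ex) (simp, rule that)
  have ex: "b p = (\<Sum>q\<in>Q. basis_value b q * prod_form q p)" if "p \<in> ?D" for p
    using ex'[OF N that] by (simp add: basis_value_def)
  have tex: "t (\<lambda>p\<in>?D. b p) = (\<Sum>q\<in>Q. basis_value b q * t (prod_form q))"
    if "t \<in> carrier (tensor V W)" for t
    using tex'[OF that N] by (simp add: basis_value_def)
  have sub: "supp b \<subseteq> Q"
  proof
    fix q assume q: "q \<in> supp b"
    have "basis_value b q = (\<Sum>q'\<in>Q. basis_value b q' * basis_value (prod_form q') q)"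
      unfolding basis_value_def[of b q] basis_value_def[of "prod_form _" q]
      by (rule ex) (simp add: V.e_closed W.e_closed)
    also have "\<dots> = (\<Sum>q'\<in>Q. if q' = q then basis_value b q else 0)"
    proof (rule sum.cong)
      fix q' assume "q' \<in> Q"
      then have "basis_value (prod_form q') q = (if q = q' then 1 else 0)"
        using q Q(2) by (intro basis_value_prod_form) (auto simp: supp_def)
      then show "basis_value b q' * basis_value (prod_form q') q = (if q' = q then basis_value b q else 0)"
        by simp
    qed simp
    finally show "q \<in> Q"
      using q Q by (auto simp: supp_def split: if_splits)
  qed
  then show "finite (supp b)"
    using Q finite_subset by blast
  have "b = (\<lambda>p\<in>?D. b p)"
    using b by (auto simp: bilin_forms_iff extensional_def)
  moreover have "(\<Sum>q\<in>Q. basis_value b q * t (prod_form q)) = (\<Sum>q\<in>supp b. basis_value b q * t (prod_form q))"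
    using sub Q by (intro sum.mono_neutral_right) (auto simp: supp_def)
  ultimately show "t b = (\<Sum>q\<in>supp b. basis_value b q * t (prod_form q))"
    if "t \<in> carrier (tensor V W)"
    using tex[OF that] by simp
qed

lemma supp_sum:
  assumes "finite Q" "supp b \<subseteq> Q" "Q \<subseteq> I \<times> J"
  shows "(\<Sum>q\<in>supp b. a q * basis_value b q) = (\<Sum>q\<in>Q. a q * basis_value b q)"
  using assms by (intro sum.mono_neutral_left) (auto simp: supp_def)

text \<open>This is the isomorphism of the tensor product of K^I and K^J with K^(I x J). A tensor is
  an arbitrary linear functional on the forms, and the \<open>prod_form q\<close> are a basis of the
  forms, so the values on them can be prescribed freely.\<close>

lemma tensor_coordinates:
  "coordinates (tensor V W) (I \<times> J) (\<lambda>t. \<lambda>q\<in>I \<times> J. t (prod_form q))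
     (\<lambda>a. \<lambda>b\<in>bilin_forms V W. \<Sum>q\<in>supp b. a q * basis_value b q)" (is "coordinates ?T ?IJ ?h ?g")
proof
  let ?B = "bilin_forms V W" and ?D = "carrier V \<times> carrier W"
  show "topological_vector_space ?T"
    by (rule tensor_tvs[OF tvs_pair])
  show "?h t \<in> extensional ?IJ" for t
    by simp
  show gc: "?g a \<in> carrier ?T" for a
    unfolding carrier_tensor
  proof (intro conjI ballI allI)
    show "?g a \<in> extensional ?B" by simp
    fix b b' assume b: "b \<in> ?B" and b': "b' \<in> ?B"
    \<comment> \<open>The three supports may differ, so the sums are compared over the common finite
      set \<open>?Q\<close>; the additional terms vanish.\<close>
    let ?s = "\<lambda>p\<in>?D. b p + b' p" let ?Q = "supp b \<union> supp b'"
    have bv: "basis_value ?s q = basis_value b q + basis_value b' q" for q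
      by (simp add: basis_value_def V.e_closed W.e_closed)
    have Q: "finite ?Q" "?Q \<subseteq> ?IJ" "supp ?s \<subseteq> ?Q"
      by (auto simp: form_expand b b') (auto simp: supp_def bv)
    have s: "?s \<in> ?B" by (rule bilin_forms_closed(1)[OF tvs_pair b b'])
    show "?g a ?s = ?g a b + ?g a b'"
    proof -
      have "(\<Sum>q\<in>?Q. a q * basis_value ?s q) =
          (\<Sum>q\<in>?Q. a q * basis_value b q) + (\<Sum>q\<in>?Q. a q * basis_value b' q)"
        unfolding bv by (simp add: distrib_left sum.distrib)
      then show ?thesis
        using supp_sum[OF Q(1) _ Q(2), of _ a] Q(3) b b' s by (simp del: restrict_apply add: restrict_apply')
    qed
  next
    fix c b assume b: "b \<in> ?B"
    let ?s = "\<lambda>p\<in>?D. c * b p"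
    have bv: "basis_value ?s q = c * basis_value b q" for q
      by (simp add: basis_value_def V.e_closed W.e_closed)
    have Q: "finite (supp b)" "supp b \<subseteq> ?IJ" "supp ?s \<subseteq> supp b"
      by (auto simp: form_expand b) (auto simp: supp_def bv)
    have s: "?s \<in> ?B" by (rule bilin_forms_closed(2)[OF tvs_pair b])
    show "?g a ?s = c * ?g a b"
    proof -
      have "(\<Sum>q\<in>supp b. a q * basis_value ?s q) = c * (\<Sum>q\<in>supp b. a q * basis_value b q)"
        unfolding bv by (simp add: sum_distrib_left mult.left_commute)
      then show ?thesis
        using supp_sum[OF Q(1) Q(3) Q(2), of a] b s by (simp del: restrict_apply add: restrict_apply')
    qed
  qed
  show "?g (?h t) = t" if t: "t \<in> carrier ?T" for t
  proof (rule extensionalityI[of _ ?B])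
    fix b assume b: "b \<in> ?B"
    have "(\<Sum>q\<in>supp b. ?h t q * basis_value b q) = (\<Sum>q\<in>supp b. basis_value b q * t (prod_form q))"
      by (intro sum.cong) (auto simp: supp_def)
    then show "?g (?h t) b = t b"
      using form_expand(2)[OF b t] b by simp
  qed (use t in \<open>auto simp: carrier_tensor\<close>)
  show "?h (?g a) = a" if a: "a \<in> extensional ?IJ" for a
  proof (rule extensionalityI[of _ ?IJ])
    fix q assume q: "q \<in> ?IJ"
    have "supp (prod_form q) = {q}"
      using q by (auto simp: supp_def basis_value_prod_form split: if_splits)
    then show "?h (?g a) q = a q"
      using q by (simp add: prod_form_closed basis_value_prod_form)
  qed (use a in auto)
  show "?h (s \<oplus>\<^bsub>?T\<^esub> t) q = ?h s q + ?h t q" if "q \<in> ?IJ" for s t q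
    using that by (simp add: tensor_simps prod_form_closed)
  show "?h (c \<odot>\<^bsub>?T\<^esub> t) q = c * ?h t q" if "q \<in> ?IJ" for c t q
    using that by (simp add: tensor_simps prod_form_closed)
  show "continuous_map (topol ?T) euclidean (\<lambda>t. ?h t q)" if "q \<in> ?IJ" for q
    using that continuous_tensor_coord[OF prod_form_closed[OF that]] by simp
  show "continuous_map (product_topology (\<lambda>_. euclidean) ?IJ) (topol ?T) ?g"
    unfolding continuous_into_tensor
  proof (intro conjI ballI)
    show "?g ` topspace (product_topology (\<lambda>_. euclidean) ?IJ) \<subseteq> carrier ?T"
      using gc by blast
    fix b assume b: "b \<in> ?B"
    have "continuous_map (product_topology (\<lambda>_. euclidean) ?IJ) euclidean
        (\<lambda>a. \<Sum>q\<in>supp b. basis_value b q * a q)"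
      using form_expand(1)[OF b]
      by (intro continuous_map_sum continuous_map_cmult continuous_map_product_projection)
        (auto simp: supp_def)
    then show "continuous_map (product_topology (\<lambda>_. euclidean) ?IJ) euclidean (\<lambda>a. ?g a b)"
      using b by (simp add: mult.commute)
  qed
qed

end

lemma tensor_coordinates_ex:
  assumes "coordinates V I h g" "coordinates W J h' g'"
  shows "\<exists>h g. coordinates (tensor V W) (I \<times> J) h g"
proof -
  interpret coordinates_pair V I h g W J h' g'
    using assms by (simp add: coordinates_pair_def)
  show ?thesis using tensor_coordinates by blast
qed

section \<open>The universal property for continuous linear and bilinear maps\<close>

lemma weakly_complete_tvs: "weakly_complete V \<Longrightarrow> topological_vector_space V"
  by (simp add: weakly_complete_def)

lemma weakly_complete_ground: "weakly_complete (ground :: ('k::real_normed_field, 'k) top_module)"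
  by (rule wc_algebra_ground[unfolded wc_algebra_def, THEN conjunct1])

lemmas ground_tvs = weakly_complete_tvs[OF weakly_complete_ground]

lemma clin_add:
  assumes X: "topological_vector_space X" and f: "clin V X f" and g: "clin V X g"
  shows "clin V X (\<lambda>v. f v \<oplus>\<^bsub>X\<^esub> g v)"
proof -
  interpret X: abelian_group X
    by (rule tvs_laws(1)[OF X])
  show ?thesis
    by (intro clinI tvs_cont(1)[OF X] clinD(4)[OF f] clinD(4)[OF g])
      (simp_all add: clinD[OF f] clinD[OF g] X.a_ac tvs_laws(7)[OF X])
qed

lemma clin_smult:
  assumes X: "topological_vector_space X" and f: "clin V X f"
  shows "clin V X (\<lambda>v. c \<odot>\<^bsub>X\<^esub> f v)"
  by (intro clinI tvs_cont(2)[OF X] clinD(4)[OF f])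
    (simp_all add: clinD[OF f] tvs_laws[OF X] tvs_closed[OF X] mult.commute)

lemma cbilin_pure_tensor:
  assumes V: "topological_vector_space V" and W: "topological_vector_space W"
  shows "cbilin V W (tensor V W) (pure_tensor V W)"
proof (rule cbilinI[OF V W])
  show "continuous_map (prod_topology (topol V) (topol W)) (topol (tensor V W))
      (\<lambda>p. pure_tensor V W (fst p) (snd p))"
    unfolding continuous_into_tensor
    by (auto simp: tvs_closed[OF V] tvs_closed[OF W] intro!: pure_tensor_closed[OF V W])
      (simp add: pure_tensor_def bilin_forms_iff)
qed (use pure_tensor_closed[OF V W] in \<open>auto simp: tensor_simps pure_tensor_def bilin_forms_iff\<close>)

lemma clin_eval: "b \<in> bilin_forms V W \<Longrightarrow> clin (tensor V W) ground (\<lambda>t. t b)"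
  by (rule clinI) (auto simp: tensor_simps(2,3) continuous_tensor_coord)

lemma
  assumes V: "topological_vector_space V" and W: "topological_vector_space W"
    and X: "weakly_complete X" and b: "cbilin V W X b"
  shows tensor_lift_clin: "clin (tensor V W) X (tensor_lift V W X (\<lambda>(v, w). b v w))"
    and tensor_lift_pure: "v \<in> carrier V \<Longrightarrow> w \<in> carrier W \<Longrightarrow>
      tensor_lift V W X (\<lambda>(v, w). b v w) (pure_tensor V W v w) = b v w"
proof -
  have "\<exists>!f. f \<in> cont_linear (tensor V W) X \<and>
      (\<forall>v\<in>carrier V. \<forall>w\<in>carrier W. f (pure_tensor V W v w) = (\<lambda>(v, w). b v w) (v, w))"
    using tensor_universal[OF V W X cbilin_cont_bilinear[OF V W b]] by simp
  from theI'[OF this, folded tensor_lift_def]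
  show "clin (tensor V W) X (tensor_lift V W X (\<lambda>(v, w). b v w))"
    "v \<in> carrier V \<Longrightarrow> w \<in> carrier W \<Longrightarrow>
      tensor_lift V W X (\<lambda>(v, w). b v w) (pure_tensor V W v w) = b v w"
    by (simp_all add: cont_linear_iff)
qed

text \<open>The uniqueness part of \<open>tensor_universal\<close>, for the bilinear map that
  \<open>f\<close> induces on pairs; restriction to the carrier makes both maps extensional.
  Identities between maps on tensors are reduced to pure tensors by it.\<close>

lemma tensor_eq:
  assumes V: "topological_vector_space V" and W: "topological_vector_space W"
    and X: "weakly_complete X" and f: "clin (tensor V W) X f" and g: "clin (tensor V W) X g"
    and eq: "\<And>v w. v \<in> carrier V \<Longrightarrow> w \<in> carrier W \<Longrightarrow> f (pure_tensor V W v w) = g (pure_tensor V W v w)"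
    and t: "t \<in> carrier (tensor V W)"
  shows "f t = g t"
proof -
  let ?T = "tensor V W"
  note T = tensor_tvs[OF V W]
  have "cbilin V W X (\<lambda>v w. f (pure_tensor V W v w))"
    by (rule cbilin_clin[OF V W cbilin_pure_tensor[OF V W] f])
  from tensor_universal[OF V W X cbilin_cont_bilinear[OF V W this]]
  have "\<exists>!F. F \<in> cont_linear ?T X \<and>
      (\<forall>v\<in>carrier V. \<forall>w\<in>carrier W. F (pure_tensor V W v w) = f (pure_tensor V W v w))"
    by simp
  moreover have "restrict f (carrier ?T) \<in> cont_linear ?T X" "restrict g (carrier ?T) \<in> cont_linear ?T X"
    using clin_restrict[OF T f] clin_restrict[OF T g] .
  moreover have "\<forall>v\<in>carrier V. \<forall>w\<in>carrier W.
      restrict f (carrier ?T) (pure_tensor V W v w) = f (pure_tensor V W v w)"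
    "\<forall>v\<in>carrier V. \<forall>w\<in>carrier W.
      restrict g (carrier ?T) (pure_tensor V W v w) = f (pure_tensor V W v w)"
    using eq pure_tensor_closed[OF V W] by simp_all
  ultimately have "restrict f (carrier ?T) = restrict g (carrier ?T)"
    by blast
  then show ?thesis
    using t by (metis restrict_apply')
qed

section \<open>Joint continuity of lifts that depend on a parameter\<close>

lemma continuous_map_locally:
  assumes "\<And>x. x \<in> topspace X \<Longrightarrow> \<exists>N. openin X N \<and> x \<in> N \<and> continuous_map (subtopology X N) Y f"
  shows "continuous_map X Y f"
  unfolding continuous_map
proof (intro conjI allI impI)
  show "f ` topspace X \<subseteq> topspace Y"
  proof (intro image_subsetI)
    fix x assume x: "x \<in> topspace X"
    then obtain N where N: "openin X N" "x \<in> N" "continuous_map (subtopology X N) Y f"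
      using assms by blast
    then show "f x \<in> topspace Y"
      using continuous_map_image_subset_topspace[OF N(3)] x by auto
  qed
  fix U assume U: "openin Y U"
  show "openin X {x \<in> topspace X. f x \<in> U}"
  proof (subst openin_subopen, intro ballI)
    fix x assume x: "x \<in> {x \<in> topspace X. f x \<in> U}"
    then obtain N where N: "openin X N" "x \<in> N" "continuous_map (subtopology X N) Y f"
      using assms by blast
    have "openin (subtopology X N) {z \<in> topspace (subtopology X N). f z \<in> U}"
      using N(3) U by (rule openin_continuous_map_preimage)
    then have "openin X {z \<in> topspace (subtopology X N). f z \<in> U}"
      using N(1) by (simp add: openin_open_subtopology)
    moreover have "{z \<in> topspace (subtopology X N). f z \<in> U} \<subseteq> {x \<in> topspace X. f x \<in> U}"
      by auto
    ultimately show "\<exists>T. openin X T \<and> x \<in> T \<and> T \<subseteq> {x \<in> topspace X. f x \<in> U}"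
      using x N(2) by (intro exI[of _ "{z \<in> topspace (subtopology X N). f z \<in> U}"]) auto
  qed
qed

text \<open>The topology of pointwise convergence gives continuity of the evaluation at a fixed
  form; here the form moves with the parameter. Near a given parameter the evaluation is a sum over
  a fixed finite \<open>Q\<close>, each term being a continuous function of the parameter times the
  evaluation at the fixed form \<open>prod_form q\<close>.\<close>

lemma (in coordinates_pair) eval_continuous:
  fixes \<phi> :: "'v \<Rightarrow> 'w \<Rightarrow> 'y \<Rightarrow> 'k"
  assumes cont: "continuous_map (prod_topology (prod_topology (topol V) (topol W)) Y) euclidean
      (\<lambda>p. \<phi> (fst (fst p)) (snd (fst p)) (snd p))"
    and bil: "\<And>y. y \<in> topspace Y \<Longrightarrow> cbilin V W ground (\<lambda>v w. \<phi> v w y)"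
  shows "continuous_map (prod_topology (topol (tensor V W)) Y) euclidean
      (\<lambda>z. fst z (\<lambda>p\<in>carrier V \<times> carrier W. \<phi> (fst p) (snd p) (snd z)))"
proof (rule continuous_map_locally)
  let ?T = "topol (tensor V W)" and ?D = "carrier V \<times> carrier W"
  fix x assume x: "x \<in> topspace (prod_topology ?T Y)"
  then have y: "snd x \<in> topspace Y" by auto
  obtain N Q where N: "openin Y N" "snd x \<in> N" and Q: "finite Q" "Q \<subseteq> I \<times> J"
    and ex: "\<And>t y. t \<in> carrier (tensor V W) \<Longrightarrow> y \<in> N \<Longrightarrow>
      t (\<lambda>p\<in>?D. \<phi> (fst p) (snd p) y) =
        (\<Sum>q\<in>Q. \<phi> (V.e (fst q)) (W.e (snd q)) y * t (prod_form q))"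
    by (rule tensor_local_expansion[where \<phi> = \<phi>, OF cont bil y]) (assumption, rule that)
  have "continuous_map (prod_topology ?T Y) euclidean
      (\<lambda>z. \<phi> (V.e (fst q)) (W.e (snd q)) (snd z))" for q
  proof -
    have "continuous_map (prod_topology ?T Y) (prod_topology (prod_topology (topol V) (topol W)) Y)
        (\<lambda>z. ((V.e (fst q), W.e (snd q)), snd z))"
      by (intro continuous_map_pairedI cont_intros)
        (auto simp: tvs_closed[OF V.tvs] tvs_closed[OF W.tvs] V.e_closed W.e_closed)
    from cont_comp[OF this cont] show ?thesis by simp
  qed
  then have "continuous_map (prod_topology ?T Y) euclidean
      (\<lambda>z. \<Sum>q\<in>Q. \<phi> (V.e (fst q)) (W.e (snd q)) (snd z) * fst z (prod_form q))"
    using Q by (intro continuous_map_sum continuous_map_times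
        cont_comp[OF continuous_map_fst continuous_tensor_coord] prod_form_closed) auto
  then have "continuous_map (subtopology (prod_topology ?T Y) (topspace ?T \<times> N)) euclidean
      (\<lambda>z. \<Sum>q\<in>Q. \<phi> (V.e (fst q)) (W.e (snd q)) (snd z) * fst z (prod_form q))"
    by (rule continuous_map_from_subtopology)
  then have "continuous_map (subtopology (prod_topology ?T Y) (topspace ?T \<times> N)) euclidean
      (\<lambda>z. fst z (\<lambda>p\<in>?D. \<phi> (fst p) (snd p) (snd z)))"
    by (rule continuous_map_eq) (auto simp: ex topspace_tensor)
  then show "\<exists>M. openin (prod_topology ?T Y) M \<and> x \<in> M \<and>
      continuous_map (subtopology (prod_topology ?T Y) M) euclidean
        (\<lambda>z. fst z (\<lambda>p\<in>?D. \<phi> (fst p) (snd p) (snd z)))"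
    using N x by (intro exI[of _ "topspace ?T \<times> N"]) (auto simp: openin_prod_Times_iff)
qed

text \<open>Continuity is tested on the coordinates of \<open>X\<close>. Coordinate \<open>i\<close>
  of the lift of \<open>\<phi>\<close> is the evaluation of the tensor at the form given by
  coordinate \<open>i\<close> of \<open>\<phi>\<close>, so \<open>eval_continuous\<close>
  applies.\<close>

lemma tensor_lift_continuous:
  fixes V :: "('k::real_normed_field, 'v, 'm) top_module_scheme"
    and W :: "('k, 'w, 'n) top_module_scheme"
    and X :: "('k, 'x, 'o) top_module_scheme"
    and \<phi> :: "'v \<Rightarrow> 'w \<Rightarrow> 'y \<Rightarrow> 'x"
  assumes V: "weakly_complete V" and W: "weakly_complete W" and X: "weakly_complete X"
    and cont: "continuous_map (prod_topology (prod_topology (topol V) (topol W)) Y) (topol X)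
      (\<lambda>p. \<phi> (fst (fst p)) (snd (fst p)) (snd p))"
    and bil: "\<And>y. y \<in> topspace Y \<Longrightarrow> cbilin V W X (\<lambda>v w. \<phi> v w y)"
  shows "continuous_map (prod_topology (topol (tensor V W)) Y) (topol X)
      (\<lambda>z. tensor_lift V W X (\<lambda>(v, w). \<phi> v w (snd z)) (fst z))"
proof -
  obtain I :: "'v set" and h g where "coordinates V I h g"
    using weakly_complete_coordinates[OF V] .
  moreover obtain J :: "'w set" and h' g' where "coordinates W J h' g'"
    using weakly_complete_coordinates[OF W] .
  ultimately interpret coordinates_pair V I h g W J h' g'
    by (simp add: coordinates_pair_def)
  obtain K :: "'x set" and k k' where "coordinates X K k k'"
    using weakly_complete_coordinates[OF X] .
  then interpret X: coordinates X K k k' .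
  let ?T = "tensor V W" and ?D = "carrier V \<times> carrier W"
  note cl = tensor_lift_clin[OF tvs_pair X bil]
  have coord: "clin X ground (\<lambda>x. k x i)" if "i \<in> K" for i
    using that by (intro clinI) (auto simp: X.h_add X.h_smult X.h_cont)
  show ?thesis
  proof (rule X.continuous_into)
    show "tensor_lift V W X (\<lambda>(v, w). \<phi> v w (snd z)) (fst z) \<in> carrier X"
      if "z \<in> topspace (prod_topology (topol ?T) Y)" for z
      using that by (auto simp: topspace_tensor intro: clinD(1)[OF cl])
    fix i assume i: "i \<in> K"
    let ?\<beta> = "\<lambda>v w y. k (\<phi> v w y) i"
    have \<beta>: "cbilin V W ground (\<lambda>v w. ?\<beta> v w y)" if "y \<in> topspace Y" for y
      by (rule cbilin_clin[OF tvs_pair bil[OF that] coord[OF i]])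
    have form: "(\<lambda>p\<in>?D. ?\<beta> (fst p) (snd p) y) \<in> bilin_forms V W" if "y \<in> topspace Y" for y
      by (rule cbilin_cont_bilinear[OF tvs_pair \<beta>[OF that]])
    have "continuous_map (prod_topology (topol ?T) Y) euclidean
        (\<lambda>z. fst z (\<lambda>p\<in>?D. ?\<beta> (fst p) (snd p) (snd z)))"
      using cont_comp[OF cont X.h_cont[OF i]] \<beta> by (rule eval_continuous)
    then show "continuous_map (prod_topology (topol ?T) Y) euclidean
        (\<lambda>z. k (tensor_lift V W X (\<lambda>(v, w). \<phi> v w (snd z)) (fst z)) i)"
    proof (rule continuous_map_eq)
      fix z assume "z \<in> topspace (prod_topology (topol ?T) Y)"
      then have z: "fst z \<in> carrier ?T" "snd z \<in> topspace Y"
        by (auto simp: topspace_tensor)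
      show "fst z (\<lambda>p\<in>?D. ?\<beta> (fst p) (snd p) (snd z)) =
          k (tensor_lift V W X (\<lambda>(v, w). \<phi> v w (snd z)) (fst z)) i"
        by (rule tensor_eq[OF tvs_pair weakly_complete_ground clin_eval[OF form[OF z(2)]]
              clin_comp[OF cl[OF z(2)] coord[OF i]] _ z(1)])
          (simp add: tensor_lift_pure[OF tvs_pair X bil[OF z(2)]], simp add: pure_tensor_def form[OF z(2)])
    qed
  qed
qed

text \<open>Lifting a trilinear map in its first two arguments gives a bilinear one. Repeated use
  yields the product of tensors, the associator and the maps \<open>sandwich\<close>, all within the
  bilinear setting.\<close>

lemma cbilin_tensor_lift:
  fixes V :: "('k::real_normed_field, 'v, 'm) top_module_scheme"
    and W :: "('k, 'w, 'n) top_module_scheme"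
    and X :: "('k, 'x, 'o) top_module_scheme"
    and Y :: "('k, 'y, 'p) top_module_scheme"
  assumes V: "weakly_complete V" and W: "weakly_complete W" and X: "weakly_complete X"
    and Y: "topological_vector_space Y"
    and cont: "continuous_map (prod_topology (prod_topology (topol V) (topol W)) (topol Y)) (topol X)
      (\<lambda>p. \<phi> (fst (fst p)) (snd (fst p)) (snd p))"
    and bil: "\<And>y. y \<in> carrier Y \<Longrightarrow> cbilin V W X (\<lambda>v w. \<phi> v w y)"
    and lin: "\<And>v w. v \<in> carrier V \<Longrightarrow> w \<in> carrier W \<Longrightarrow> clin Y X (\<phi> v w)"
  shows "cbilin (tensor V W) Y X (\<lambda>t y. tensor_lift V W X (\<lambda>(v, w). \<phi> v w y) t)"
proof -
  note tv = weakly_complete_tvs[OF V] weakly_complete_tvs[OF W]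
  note Xt = weakly_complete_tvs[OF X]
  note cl = tensor_lift_clin[OF tv X bil] and pure = tensor_lift_pure[OF tv X bil]
  note Yc = tvs_closed[OF Y]
  show ?thesis
  proof (rule cbilinI[OF tensor_tvs[OF tv] Y])
    show "continuous_map (prod_topology (topol (tensor V W)) (topol Y)) (topol X)
        (\<lambda>p. tensor_lift V W X (\<lambda>(v, w). \<phi> v w (snd p)) (fst p))"
      using bil by (intro tensor_lift_continuous[OF V W X cont]) (simp add: Yc)
    show "tensor_lift V W X (\<lambda>(v, w). \<phi> v w (y \<oplus>\<^bsub>Y\<^esub> y')) t =
        tensor_lift V W X (\<lambda>(v, w). \<phi> v w y) t \<oplus>\<^bsub>X\<^esub> tensor_lift V W X (\<lambda>(v, w). \<phi> v w y') t"
      if "t \<in> carrier (tensor V W)" "y \<in> carrier Y" "y' \<in> carrier Y" for t y y'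
      using that by - (rule tensor_eq[OF tv X cl clin_add[OF Xt cl cl] _ that(1)],
        simp_all add: Yc pure clinD(2)[OF lin])
    show "tensor_lift V W X (\<lambda>(v, w). \<phi> v w (c \<odot>\<^bsub>Y\<^esub> y)) t =
        c \<odot>\<^bsub>X\<^esub> tensor_lift V W X (\<lambda>(v, w). \<phi> v w y) t"
      if "t \<in> carrier (tensor V W)" "y \<in> carrier Y" for t c y
      using that by - (rule tensor_eq[OF tv X cl clin_smult[OF Xt cl] _ that(1)],
        simp_all add: Yc pure clinD(3)[OF lin])
  qed (simp_all add: clinD[OF cl])
qed

section \<open>Algebras\<close>

text \<open>Leaves out weak completeness, which \<open>weakly_complete\<close> expresses by an index
  set in the type of the algebra. Test algebras are later given as a \<open>top_algebra\<close> with
  \<open>coordinates\<close> over any convenient index type.\<close>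

definition top_algebra :: "('k::real_normed_field, 'a, 'm) top_module_scheme \<Rightarrow> bool" where
  "top_algebra A \<longleftrightarrow> topological_vector_space A \<and> Ring.ring A \<and> cbilin A A A (monoid.mult A)"

definition ahom ::
    "('k::real_normed_field, 'a, 'm) top_module_scheme \<Rightarrow> ('k, 'b, 'n) top_module_scheme \<Rightarrow>
     ('a \<Rightarrow> 'b) \<Rightarrow> bool" where
  "ahom A B f \<longleftrightarrow> clin A B f \<and> f \<one>\<^bsub>A\<^esub> = \<one>\<^bsub>B\<^esub> \<and>
     (\<forall>x\<in>carrier A. \<forall>y\<in>carrier A. f (x \<otimes>\<^bsub>A\<^esub> y) = f x \<otimes>\<^bsub>B\<^esub> f y)"

lemma alg_hom_iff: "f \<in> alg_hom A B \<longleftrightarrow> ahom A B f \<and> f \<in> extensional (carrier A)"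
  by (auto simp: alg_hom_def ahom_def cont_linear_iff)

lemma wc_algebra_iff: "wc_algebra A \<longleftrightarrow> weakly_complete A \<and> top_algebra A"
proof
  assume A: "wc_algebra A"
  then have tvs: "topological_vector_space A" and R: "Ring.ring A"
    by (auto simp: wc_algebra_def weakly_complete_def)
  interpret R: Ring.ring A by (rule R)
  have "cbilin A A A (monoid.mult A)"
    using A by (intro cbilinI tvs) (auto simp: wc_algebra_def R.l_distr R.r_distr case_prod_unfold)
  then show "weakly_complete A \<and> top_algebra A"
    using A tvs R by (simp add: wc_algebra_def top_algebra_def)
next
  assume A: "weakly_complete A \<and> top_algebra A"
  then have M: "cbilin A A A (monoid.mult A)"
    by (simp add: top_algebra_def)
  show "wc_algebra A"
    using A cbilinD(4,5,6)[OF M] by (simp add: wc_algebra_def top_algebra_def case_prod_unfold)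
qed

lemma wc_algebraD:
  assumes "wc_algebra A"
  shows "weakly_complete A" "top_algebra A" "topological_vector_space A" "Ring.ring A"
    "cbilin A A A (monoid.mult A)" "\<one>\<^bsub>A\<^esub> \<in> carrier A"
    "\<And>x. x \<in> carrier A \<Longrightarrow> \<one>\<^bsub>A\<^esub> \<otimes>\<^bsub>A\<^esub> x = x"
    "\<And>x. x \<in> carrier A \<Longrightarrow> x \<otimes>\<^bsub>A\<^esub> \<one>\<^bsub>A\<^esub> = x"
    "\<And>x y z. x \<in> carrier A \<Longrightarrow> y \<in> carrier A \<Longrightarrow> z \<in> carrier A \<Longrightarrow>
      x \<otimes>\<^bsub>A\<^esub> y \<otimes>\<^bsub>A\<^esub> z = x \<otimes>\<^bsub>A\<^esub> (y \<otimes>\<^bsub>A\<^esub> z)"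
    "\<And>x y. x \<in> carrier A \<Longrightarrow> y \<in> carrier A \<Longrightarrow> x \<otimes>\<^bsub>A\<^esub> y \<in> carrier A"
proof -
  show "weakly_complete A" "top_algebra A" "topological_vector_space A" "Ring.ring A"
    "cbilin A A A (monoid.mult A)"
    using assms by (auto simp: wc_algebra_iff top_algebra_def)
  then interpret Ring.ring A by simp
  show "\<one>\<^bsub>A\<^esub> \<in> carrier A" "\<And>x. x \<in> carrier A \<Longrightarrow> \<one>\<^bsub>A\<^esub> \<otimes>\<^bsub>A\<^esub> x = x"
    "\<And>x. x \<in> carrier A \<Longrightarrow> x \<otimes>\<^bsub>A\<^esub> \<one>\<^bsub>A\<^esub> = x"
    "\<And>x y z. x \<in> carrier A \<Longrightarrow> y \<in> carrier A \<Longrightarrow> z \<in> carrier A \<Longrightarrow>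
      x \<otimes>\<^bsub>A\<^esub> y \<otimes>\<^bsub>A\<^esub> z = x \<otimes>\<^bsub>A\<^esub> (y \<otimes>\<^bsub>A\<^esub> z)"
    "\<And>x y. x \<in> carrier A \<Longrightarrow> y \<in> carrier A \<Longrightarrow> x \<otimes>\<^bsub>A\<^esub> y \<in> carrier A"
    by (auto simp: m_assoc)
qed

lemma ahomD:
  assumes "ahom A B f"
  shows "clin A B f" "\<And>x. x \<in> carrier A \<Longrightarrow> f x \<in> carrier B" "f \<one>\<^bsub>A\<^esub> = \<one>\<^bsub>B\<^esub>"
    "\<And>x y. x \<in> carrier A \<Longrightarrow> y \<in> carrier A \<Longrightarrow> f (x \<otimes>\<^bsub>A\<^esub> y) = f x \<otimes>\<^bsub>B\<^esub> f y"
  using assms by (auto simp: ahom_def clin_def)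

lemma ahom_comp: "ahom A B f \<Longrightarrow> ahom B C g \<Longrightarrow> ahom A C (\<lambda>x. g (f x))"
  using clin_comp[of A B f C g] by (auto simp: ahom_def clin_def Pi_iff)

lemma ahom_restrict_id: "wc_algebra A \<Longrightarrow> ahom A A (\<lambda>x\<in>carrier A. x)"
  using clin_cong[OF _ clin_id[of A], of "\<lambda>x\<in>carrier A. x"] wc_algebraD[of A]
  by (simp add: ahom_def)

subsection \<open>Tensor products of algebras\<close>

lemma tensor_algebra_simps [simp]:
  "carrier (tensor_algebra A B) = carrier (tensor A B)"
  "zero (tensor_algebra A B) = zero (tensor A B)"
  "add (tensor_algebra A B) = add (tensor A B)"
  "smult (tensor_algebra A B) = smult (tensor A B)"
  "topol (tensor_algebra A B) = topol (tensor A B)"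
  "one (tensor_algebra A B) = pure_tensor A B \<one>\<^bsub>A\<^esub> \<one>\<^bsub>B\<^esub>"
  by (simp_all add: tensor_algebra_def)

lemma tensor_algebra_space [simp]:
  "topological_vector_space (tensor_algebra A B) \<longleftrightarrow> topological_vector_space (tensor A B)"
  "clin (tensor_algebra A B) X f \<longleftrightarrow> clin (tensor A B) X f"
  "clin Z (tensor_algebra A B) g \<longleftrightarrow> clin Z (tensor A B) g"
  by (simp_all add: clin_def topological_vector_space_def Module.module_def module_axioms_def
    abelian_group_def abelian_monoid_def abelian_group_axioms_def)

lemma tensor_algebra_weakly_complete [simp]:
  "weakly_complete (tensor_algebra A B) \<longleftrightarrow> weakly_complete (tensor A B)"
  by (simp add: weakly_complete_def cont_linear_iff)

lemma tensor_algebra_cbilin [simp]: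
  "cbilin (tensor_algebra A B) W X b \<longleftrightarrow> cbilin (tensor A B) W X b"
  "cbilin V (tensor_algebra A B) X b \<longleftrightarrow> cbilin V (tensor A B) X b"
  "cbilin V W (tensor_algebra A B) b \<longleftrightarrow> cbilin V W (tensor A B) b"
  by (simp_all add: cbilin_def)

lemma tensor_algebra_forms:
  "bilin_forms (tensor_algebra A B) C = bilin_forms (tensor A B) C"
  "bilin_forms C (tensor_algebra A B) = bilin_forms C (tensor A B)"
  by (simp_all add: cont_bilinear_def)

text \<open>\<open>tensor\<close> reads only the vector space structure of its factors. In iterated
  tensor products this lets the algebra statements, phrased with \<open>tensor_algebra\<close>, meet
  the laws in \<open>wc_hopf_algebra\<close>, phrased with \<open>tensor\<close>.\<close>

lemma tensor_tensor_algebra [simp]: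
  "tensor (tensor_algebra A B) C = tensor (tensor A B) C"
  "tensor C (tensor_algebra A B) = tensor C (tensor A B)"
  "pure_tensor (tensor_algebra A B) C = pure_tensor (tensor A B) C"
  "pure_tensor C (tensor_algebra A B) = pure_tensor C (tensor A B)"
  by (simp_all add: tensor_def pure_tensor_def tensor_algebra_forms fun_eq_iff)

locale wc_algebra_pair =
  fixes A :: "('k::real_normed_field, 'a, 'm) top_module_scheme"
    and B :: "('k, 'b, 'n) top_module_scheme"
  assumes A: "wc_algebra A" and B: "wc_algebra B"
begin

lemmas tvA = wc_algebraD(3)[OF A] and tvB = wc_algebraD(3)[OF B]
lemmas tvT = tensor_tvs[OF tvA tvB]
lemmas wcT = weakly_complete_tensor[OF tvA tvB]
lemmas cl = tvs_closed[OF tvA] tvs_closed[OF tvB] wc_algebraD(10)[OF A] wc_algebraD(10)[OF B]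
  wc_algebraD(6)[OF A] wc_algebraD(6)[OF B]
lemmas mA = wc_algebraD(5)[OF A] and mB = wc_algebraD(5)[OF B]
lemmas pure = cbilin_pure_tensor[OF tvA tvB]
lemmas pure_closed = pure_tensor_closed[OF tvA tvB]
lemmas teq = tensor_eq[OF tvA tvB]

text \<open>Left multiplication by the pure tensor of \<open>a\<close> and \<open>b\<close>, the
  inner one of the two lifts in \<open>tensor_algebra\<close>. It has to be bilinear in
  \<open>a\<close> and \<open>b\<close> before the outer lift makes sense.\<close>

definition lmult :: "'a \<Rightarrow> 'b \<Rightarrow> (('a \<times> 'b \<Rightarrow> 'k) \<Rightarrow> 'k) \<Rightarrow> (('a \<times> 'b \<Rightarrow> 'k) \<Rightarrow> 'k)" where
  "lmult a b t = tensor_lift A B (tensor A B)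
     (\<lambda>(a', b'). pure_tensor A B (a \<otimes>\<^bsub>A\<^esub> a') (b \<otimes>\<^bsub>B\<^esub> b')) t"

lemma pure_mult_cbilin: "a \<in> carrier A \<Longrightarrow> b \<in> carrier B \<Longrightarrow>
    cbilin A B (tensor A B) (\<lambda>a' b'. pure_tensor A B (a \<otimes>\<^bsub>A\<^esub> a') (b \<otimes>\<^bsub>B\<^esub> b'))"
  by (rule cbilin_comp[OF tvA tvB pure cbilin_right[OF mA clin_id] cbilin_right[OF mB clin_id]])

lemma lmult_clin: "a \<in> carrier A \<Longrightarrow> b \<in> carrier B \<Longrightarrow> clin (tensor A B) (tensor A B) (lmult a b)"
  unfolding lmult_def[abs_def] by (rule tensor_lift_clin[OF tvA tvB wcT pure_mult_cbilin])

lemma lmult_pure: "a \<in> carrier A \<Longrightarrow> b \<in> carrier B \<Longrightarrow> a' \<in> carrier A \<Longrightarrow> b' \<in> carrier B \<Longrightarrow>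
    lmult a b (pure_tensor A B a' b') = pure_tensor A B (a \<otimes>\<^bsub>A\<^esub> a') (b \<otimes>\<^bsub>B\<^esub> b')"
  unfolding lmult_def by (rule tensor_lift_pure[OF tvA tvB wcT pure_mult_cbilin])

text \<open>The pair of \<open>a\<close> and \<open>b\<close> is the parameter of the lift here.
  Continuity in all three arguments together is what the outer lift asks for, where \<open>t\<close>
  becomes the parameter.\<close>

lemma lmult_cont:
  "continuous_map (prod_topology (topol (tensor A B)) (prod_topology (topol A) (topol B)))
     (topol (tensor A B)) (\<lambda>z. lmult (fst (snd z)) (snd (snd z)) (fst z))"
  unfolding lmult_def
  by (rule tensor_lift_continuous[OF wc_algebraD(1)[OF A] wc_algebraD(1)[OF B] wcT, where
      \<phi> = "\<lambda>a' b' y. pure_tensor A B (fst y \<otimes>\<^bsub>A\<^esub> a') (snd y \<otimes>\<^bsub>B\<^esub> b')"])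
    ((intro cbilin_cont[OF pure] cbilin_cont[OF mA] cbilin_cont[OF mB] cont_intros),
      (rule cont_id | simp add: cl pure_mult_cbilin mem_Times_iff)+)

lemma lmult_cbilin_left: "b \<in> carrier B \<Longrightarrow> cbilin (tensor A B) A (tensor A B) (\<lambda>t a. lmult a b t)"
  unfolding lmult_def
  by (rule cbilin_tensor_lift[OF wc_algebraD(1)[OF A] wc_algebraD(1)[OF B] wcT tvA, where
      \<phi> = "\<lambda>a' b' a. pure_tensor A B (a \<otimes>\<^bsub>A\<^esub> a') (b \<otimes>\<^bsub>B\<^esub> b')"])
    ((intro cbilin_cont[OF pure] cbilin_cont[OF mA] cbilin_cont[OF mB] cont_intros
        continuous_map_const[THEN iffD2] disjI2),
      (rule cont_id | simp add: cl pure_mult_cbilin cbilin_left[OF pure cbilin_left[OF mA clin_id]])+)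

lemma lmult_cbilin_right: "a \<in> carrier A \<Longrightarrow> cbilin (tensor A B) B (tensor A B) (\<lambda>t b. lmult a b t)"
  unfolding lmult_def
  by (rule cbilin_tensor_lift[OF wc_algebraD(1)[OF A] wc_algebraD(1)[OF B] wcT tvB, where
      \<phi> = "\<lambda>a' b' b. pure_tensor A B (a \<otimes>\<^bsub>A\<^esub> a') (b \<otimes>\<^bsub>B\<^esub> b')"])
    ((intro cbilin_cont[OF pure] cbilin_cont[OF mA] cbilin_cont[OF mB] cont_intros
        continuous_map_const[THEN iffD2] disjI2),
      (rule cont_id | simp add: cl pure_mult_cbilin cbilin_right[OF pure cbilin_left[OF mB clin_id]])+)

lemma lmult_cbilin:
  assumes t: "t \<in> carrier (tensor A B)"
  shows "cbilin A B (tensor A B) (\<lambda>a b. lmult a b t)"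
proof (rule cbilinI[OF tvA tvB])
  have "continuous_map (prod_topology (topol A) (topol B))
      (prod_topology (topol (tensor A B)) (prod_topology (topol A) (topol B))) (\<lambda>p. (t, p))"
    using t by (intro continuous_map_pairedI cont_id) (auto simp: topspace_tensor)
  from cont_comp[OF this lmult_cont]
  show "continuous_map (prod_topology (topol A) (topol B)) (topol (tensor A B))
      (\<lambda>p. lmult (fst p) (snd p) t)"
    by simp
qed (simp_all add: clinD(1)[OF lmult_clin] t cbilinD(3,5)[OF lmult_cbilin_left]
    cbilinD(3,5)[OF lmult_cbilin_right])

lemma tensor_mult:
  "s \<otimes>\<^bsub>tensor_algebra A B\<^esub> t = tensor_lift A B (tensor A B) (\<lambda>(a, b). lmult a b t) s"
  by (simp add: tensor_algebra_def lmult_def)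

lemma tensor_mult_cbilin:
  "cbilin (tensor A B) (tensor A B) (tensor A B) (monoid.mult (tensor_algebra A B))"
proof -
  have "continuous_map (prod_topology (prod_topology (topol A) (topol B)) (topol (tensor A B)))
      (prod_topology (topol (tensor A B)) (prod_topology (topol A) (topol B))) (\<lambda>p. (snd p, fst p))"
    by (intro continuous_map_pairedI cont_intros)
  note cont = cont_comp[OF this lmult_cont, simplified]
  show ?thesis
    unfolding tensor_mult[abs_def]
    by (rule cbilin_tensor_lift[OF wc_algebraD(1)[OF A] wc_algebraD(1)[OF B] wcT tvT, where
        \<phi> = lmult, OF cont lmult_cbilin lmult_clin])
qed

lemmas tmult = tensor_mult_cbilin

lemma tensor_mult_pure:
  "a \<in> carrier A \<Longrightarrow> b \<in> carrier B \<Longrightarrow> a' \<in> carrier A \<Longrightarrow> b' \<in> carrier B \<Longrightarrow>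
    pure_tensor A B a b \<otimes>\<^bsub>tensor_algebra A B\<^esub> pure_tensor A B a' b' =
    pure_tensor A B (a \<otimes>\<^bsub>A\<^esub> a') (b \<otimes>\<^bsub>B\<^esub> b')"
  unfolding tensor_mult
  by (simp add: tensor_lift_pure[OF tvA tvB wcT lmult_cbilin] pure_closed lmult_pure)

lemma tensor_mult_one:
  assumes t: "t \<in> carrier (tensor A B)"
  shows "pure_tensor A B \<one>\<^bsub>A\<^esub> \<one>\<^bsub>B\<^esub> \<otimes>\<^bsub>tensor_algebra A B\<^esub> t = t"
    and "t \<otimes>\<^bsub>tensor_algebra A B\<^esub> pure_tensor A B \<one>\<^bsub>A\<^esub> \<one>\<^bsub>B\<^esub> = t"
proof -
  have one: "pure_tensor A B \<one>\<^bsub>A\<^esub> \<one>\<^bsub>B\<^esub> \<in> carrier (tensor A B)"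
    by (simp add: pure_closed cl)
  show "pure_tensor A B \<one>\<^bsub>A\<^esub> \<one>\<^bsub>B\<^esub> \<otimes>\<^bsub>tensor_algebra A B\<^esub> t = t"
    by (rule teq[OF wcT cbilin_right[OF tmult clin_id one] clin_id _ t])
      (simp add: tensor_mult_pure cl wc_algebraD(7)[OF A] wc_algebraD(7)[OF B])
  show "t \<otimes>\<^bsub>tensor_algebra A B\<^esub> pure_tensor A B \<one>\<^bsub>A\<^esub> \<one>\<^bsub>B\<^esub> = t"
    by (rule teq[OF wcT cbilin_left[OF tmult clin_id one] clin_id _ t])
      (simp add: tensor_mult_pure cl wc_algebraD(8)[OF A] wc_algebraD(8)[OF B])
qed

text \<open>Both sides are continuous and linear in each factor, so the factors are reduced to pure
  tensors one at a time: in 1 only the last factor is general, in 2 the last two.\<close>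

lemma tensor_mult_assoc:
  assumes s: "s \<in> carrier (tensor A B)" and t: "t \<in> carrier (tensor A B)" and u: "u \<in> carrier (tensor A B)"
  shows "s \<otimes>\<^bsub>tensor_algebra A B\<^esub> t \<otimes>\<^bsub>tensor_algebra A B\<^esub> u =
    s \<otimes>\<^bsub>tensor_algebra A B\<^esub> (t \<otimes>\<^bsub>tensor_algebra A B\<^esub> u)"
proof -
  let ?m = "monoid.mult (tensor_algebra A B)" and ?p = "pure_tensor A B"
  note mc = cbilinD(1)[OF tmult]
  have 1: "?m (?m (?p a b) (?p a' b')) u = ?m (?p a b) (?m (?p a' b') u)"
    if "a \<in> carrier A" "b \<in> carrier B" "a' \<in> carrier A" "b' \<in> carrier B" for a b a' b'
    by (rule teq[OF wcT cbilin_right[OF tmult clin_id mc[OF pure_closed pure_closed]]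
          cbilin_right[OF tmult cbilin_right[OF tmult clin_id pure_closed] pure_closed] _ u])
      (simp_all add: that tensor_mult_pure cl wc_algebraD(9)[OF A] wc_algebraD(9)[OF B])
  have 2: "?m (?m (?p a b) t) u = ?m (?p a b) (?m t u)"
    if "a \<in> carrier A" "b \<in> carrier B" for a b
    by (rule teq[OF wcT cbilin_left[OF tmult cbilin_right[OF tmult clin_id pure_closed] u]
          cbilin_right[OF tmult cbilin_left[OF tmult clin_id u] pure_closed] _ t])
      (simp_all add: that 1)
  show ?thesis
    by (rule teq[OF wcT cbilin_left[OF tmult cbilin_left[OF tmult clin_id t] u]
          cbilin_left[OF tmult clin_id mc[OF t u]] _ s])
      (simp_all add: 2)
qed

lemma wc_algebra_tensor: "wc_algebra (tensor_algebra A B)"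
  unfolding wc_algebra_iff top_algebra_def
proof (intro conjI)
  show "Ring.ring (tensor_algebra A B)"
  proof (rule ringI)
    show "abelian_group (tensor_algebra A B)"
      by (rule tvs_laws(1)) (simp add: tvT)
    show "monoid (tensor_algebra A B)"
      by (rule monoidI) (simp_all add: cbilinD(1)[OF tmult] pure_closed cl tensor_mult_one tensor_mult_assoc)
  qed (simp_all add: cbilinD[OF tmult])
qed (simp_all add: wcT tvT tmult)

text \<open>The image of a product and the product of the images are both continuous and linear in
  each tensor, so pure tensors decide. The hypothesis \<open>mult\<close> has the product of two
  pure tensors already evaluated.\<close>

lemma tensor_ahom:
  assumes C: "wc_algebra C" and f: "clin (tensor A B) C f"
    and one: "f (pure_tensor A B \<one>\<^bsub>A\<^esub> \<one>\<^bsub>B\<^esub>) = \<one>\<^bsub>C\<^esub>"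
    and mult: "\<And>a b a' b'. a \<in> carrier A \<Longrightarrow> b \<in> carrier B \<Longrightarrow> a' \<in> carrier A \<Longrightarrow> b' \<in> carrier B \<Longrightarrow>
      f (pure_tensor A B (a \<otimes>\<^bsub>A\<^esub> a') (b \<otimes>\<^bsub>B\<^esub> b')) =
      f (pure_tensor A B a b) \<otimes>\<^bsub>C\<^esub> f (pure_tensor A B a' b')"
  shows "ahom (tensor_algebra A B) C f"
proof -
  let ?m = "monoid.mult (tensor_algebra A B)" and ?p = "pure_tensor A B"
  note mC = wc_algebraD(5)[OF C] and fc = clinD(1)[OF f]
  have 1: "f (?m (?p a b) t) = f (?p a b) \<otimes>\<^bsub>C\<^esub> f t"
    if "a \<in> carrier A" "b \<in> carrier B" "t \<in> carrier (tensor A B)" for a b t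
    by (rule teq[OF wc_algebraD(1)[OF C] clin_comp[OF cbilin_right[OF tmult clin_id pure_closed] f]
          cbilin_right[OF mC f fc[OF pure_closed]] _ that(3)])
      (simp_all add: that tensor_mult_pure mult)
  have "f (?m s t) = f s \<otimes>\<^bsub>C\<^esub> f t"
    if "s \<in> carrier (tensor A B)" "t \<in> carrier (tensor A B)" for s t
    by (rule teq[OF wc_algebraD(1)[OF C] clin_comp[OF cbilin_left[OF tmult clin_id that(2)] f]
          cbilin_left[OF mC f fc[OF that(2)]] _ that(1)])
      (simp_all add: that 1)
  then show ?thesis
    using f one by (simp add: ahom_def)
qed

end

subsection \<open>Induced maps\<close>

context
  fixes V :: "('k::real_normed_field, 'v, 'm) top_module_scheme"
    and W :: "('k, 'w, 'n) top_module_scheme"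
    and V' :: "('k, 'v', 'm') top_module_scheme"
    and W' :: "('k, 'w', 'n') top_module_scheme"
  assumes tv: "topological_vector_space V" "topological_vector_space W"
    "topological_vector_space V'" "topological_vector_space W'"
begin

lemma
  assumes f: "clin V V' f" and g: "clin W W' g"
  shows tensor_map_clin: "clin (tensor V W) (tensor V' W') (tensor_map V W V' W' f g)"
    and tensor_map_pure: "v \<in> carrier V \<Longrightarrow> w \<in> carrier W \<Longrightarrow>
      tensor_map V W V' W' f g (pure_tensor V W v w) = pure_tensor V' W' (f v) (g w)"
proof -
  have "cbilin V W (tensor V' W') (\<lambda>v w. pure_tensor V' W' (f v) (g w))"
    by (rule cbilin_comp[OF tv(1,2) cbilin_pure_tensor[OF tv(3,4)] f g])
  note l = tensor_lift_clin[OF tv(1,2) weakly_complete_tensor[OF tv(3,4)] this]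
    tensor_lift_pure[OF tv(1,2) weakly_complete_tensor[OF tv(3,4)] this]
  show "clin (tensor V W) (tensor V' W') (tensor_map V W V' W' f g)"
    unfolding tensor_map_def by (rule l(1))
  show "v \<in> carrier V \<Longrightarrow> w \<in> carrier W \<Longrightarrow>
      tensor_map V W V' W' f g (pure_tensor V W v w) = pure_tensor V' W' (f v) (g w)"
    unfolding tensor_map_def by (rule l(2))
qed

end

lemma tensor_map_ahom:
  assumes A: "wc_algebra A" and B: "wc_algebra B" and A': "wc_algebra A'" and B': "wc_algebra B'"
    and f: "ahom A A' f" and g: "ahom B B' g"
  shows "ahom (tensor_algebra A B) (tensor_algebra A' B') (tensor_map A B A' B' f g)"
proof -
  interpret D: wc_algebra_pair A B by unfold_locales fact+
  interpret E: wc_algebra_pair A' B' by unfold_locales fact+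
  note tv = wc_algebraD(3)[OF A] wc_algebraD(3)[OF B] wc_algebraD(3)[OF A'] wc_algebraD(3)[OF B']
  note p = tensor_map_pure[OF tv ahomD(1)[OF f] ahomD(1)[OF g]]
  show ?thesis
    using tensor_map_clin[OF tv ahomD(1)[OF f] ahomD(1)[OF g]]
    by (intro D.tensor_ahom E.wc_algebra_tensor)
      (simp_all add: p D.cl ahomD[OF f] ahomD[OF g] E.tensor_mult_pure)
qed

context
  fixes U :: "('k::real_normed_field, 'u, 'l) top_module_scheme"
    and V :: "('k, 'v, 'm) top_module_scheme"
    and W :: "('k, 'w, 'n) top_module_scheme"
  assumes wc: "weakly_complete U" "weakly_complete V" "weakly_complete W"
begin

text \<open>\<open>\<psi>\<close> is the inner lift in \<open>tensor_assoc\<close>, with the last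
  factor as parameter; its bilinearity gives meaning to the outer lift.\<close>

lemma tensor_assoc_cbilin:
  defines "\<psi> \<equiv> \<lambda>t w. tensor_lift U V (tensor U (tensor V W))
    (\<lambda>(u, v). pure_tensor U (tensor V W) u (pure_tensor V W v w)) t"
  shows "cbilin (tensor U V) W (tensor U (tensor V W)) \<psi>"
    and "u \<in> carrier U \<Longrightarrow> v \<in> carrier V \<Longrightarrow> w \<in> carrier W \<Longrightarrow>
      \<psi> (pure_tensor U V u v) w = pure_tensor U (tensor V W) u (pure_tensor V W v w)"
proof -
  note tU = weakly_complete_tvs[OF wc(1)] and tV = weakly_complete_tvs[OF wc(2)]
    and tW = weakly_complete_tvs[OF wc(3)]
  note pi = cbilin_pure_tensor[OF tV tW]
  note po = cbilin_pure_tensor[OF tU tensor_tvs[OF tV tW]]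
  note wX = weakly_complete_tensor[OF tU tensor_tvs[OF tV tW]]
  have b: "cbilin U V (tensor U (tensor V W))
      (\<lambda>u v. pure_tensor U (tensor V W) u (pure_tensor V W v w))" if "w \<in> carrier W" for w
    by (rule cbilin_comp[OF tU tV po clin_id cbilin_left[OF pi clin_id that]])
  show "cbilin (tensor U V) W (tensor U (tensor V W)) \<psi>"
    unfolding \<psi>_def
    by (rule cbilin_tensor_lift[OF wc(1,2) wX tW, where
        \<phi> = "\<lambda>u v w. pure_tensor U (tensor V W) u (pure_tensor V W v w)"])
      ((intro cbilin_cont[OF po] cbilin_cont[OF pi] cont_intros),
        (rule cont_id | simp add: b cbilin_right[OF po cbilin_right[OF pi clin_id]])+)
  show "\<psi> (pure_tensor U V u v) w = pure_tensor U (tensor V W) u (pure_tensor V W v w)"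
    if "u \<in> carrier U" "v \<in> carrier V" "w \<in> carrier W"
    unfolding \<psi>_def using that by (intro tensor_lift_pure[OF tU tV wX b])
qed

lemma
  shows tensor_assoc_clin: "clin (tensor (tensor U V) W) (tensor U (tensor V W)) (tensor_assoc U V W)"
    and tensor_assoc_pure_cbilin: "cbilin (tensor U V) W (tensor U (tensor V W))
      (\<lambda>t w. tensor_assoc U V W (pure_tensor (tensor U V) W t w))"
    and tensor_assoc_pure: "u \<in> carrier U \<Longrightarrow> v \<in> carrier V \<Longrightarrow> w \<in> carrier W \<Longrightarrow>
      tensor_assoc U V W (pure_tensor (tensor U V) W (pure_tensor U V u v) w) =
      pure_tensor U (tensor V W) u (pure_tensor V W v w)"
proof -
  note tU = weakly_complete_tvs[OF wc(1)] and tV = weakly_complete_tvs[OF wc(2)]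
    and tW = weakly_complete_tvs[OF wc(3)]
  note tUV = tensor_tvs[OF tU tV]
  note wX = weakly_complete_tensor[OF tU tensor_tvs[OF tV tW]]
  note l = tensor_lift_clin[OF tUV tW wX tensor_assoc_cbilin(1)]
    tensor_lift_pure[OF tUV tW wX tensor_assoc_cbilin(1)]
  show c: "clin (tensor (tensor U V) W) (tensor U (tensor V W)) (tensor_assoc U V W)"
    unfolding tensor_assoc_def by (rule l(1))
  show "cbilin (tensor U V) W (tensor U (tensor V W))
      (\<lambda>t w. tensor_assoc U V W (pure_tensor (tensor U V) W t w))"
    by (rule cbilin_clin[OF tUV tW cbilin_pure_tensor[OF tUV tW] c])
  show "tensor_assoc U V W (pure_tensor (tensor U V) W (pure_tensor U V u v) w) =
      pure_tensor U (tensor V W) u (pure_tensor V W v w)"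
    if "u \<in> carrier U" "v \<in> carrier V" "w \<in> carrier W"
    unfolding tensor_assoc_def using that
    by (simp add: l(2) tensor_assoc_cbilin(2) pure_tensor_closed[OF tU tV])
qed

end

lemma tensor_assoc_ahom:
  assumes A: "wc_algebra A" and B: "wc_algebra B" and C: "wc_algebra C"
  shows "ahom (tensor_algebra (tensor_algebra A B) C) (tensor_algebra A (tensor_algebra B C))
    (tensor_assoc A B C)"
proof -
  interpret AB: wc_algebra_pair A B by unfold_locales fact+
  interpret BC: wc_algebra_pair B C by unfold_locales fact+
  interpret L: wc_algebra_pair "tensor_algebra A B" C
    by unfold_locales (rule AB.wc_algebra_tensor C)+
  interpret R: wc_algebra_pair A "tensor_algebra B C"
    by unfold_locales (rule BC.wc_algebra_tensor A)+
  note wc = wc_algebraD(1)[OF A] wc_algebraD(1)[OF B] wc_algebraD(1)[OF C]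
  let ?a = "tensor_assoc A B C" and ?p = "pure_tensor (tensor A B) C"
  let ?m = "monoid.mult (tensor_algebra A B)" and ?X = "tensor_algebra A (tensor_algebra B C)"
  note ap = tensor_assoc_pure[OF wc]
  note al = cbilin_left[OF tensor_assoc_pure_cbilin[OF wc]]
  note X = R.wcT[simplified]
  note mX = R.tmult[simplified]
  note alc = clinD(1)[OF al[OF clin_id]]
  \<comment> \<open>A pure tensor of the outer product has an arbitrary tensor as its first factor.
    These are reduced to pure ones in two rounds, first the right-hand tensor of the product, then
    the left-hand one.\<close>
  have 1: "?a (?p (?m (pure_tensor A B a b) t) (c \<otimes>\<^bsub>C\<^esub> c')) =
      ?a (?p (pure_tensor A B a b) c) \<otimes>\<^bsub>?X\<^esub> ?a (?p t c')"
    if "a \<in> carrier A" "b \<in> carrier B" "c \<in> carrier C" "c' \<in> carrier C" "t \<in> carrier (tensor A B)"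
    for a b c c' t
    by (rule AB.teq[OF X al[OF cbilin_right[OF AB.tmult clin_id AB.pure_closed]]
          cbilin_right[OF mX al[OF clin_id] alc] _ that(5)])
      (simp_all add: that AB.pure_closed AB.tensor_mult_pure ap AB.cl BC.cl BC.pure_closed
        R.tensor_mult_pure[simplified] BC.tensor_mult_pure)
  have 2: "?a (?p (?m s t) (c \<otimes>\<^bsub>C\<^esub> c')) = ?a (?p s c) \<otimes>\<^bsub>?X\<^esub> ?a (?p t c')"
    if "s \<in> carrier (tensor A B)" "c \<in> carrier C" "c' \<in> carrier C" "t \<in> carrier (tensor A B)"
    for s c c' t
    by (rule AB.teq[OF X al[OF cbilin_left[OF AB.tmult clin_id that(4)]]
          cbilin_left[OF mX al[OF clin_id] alc] _ that(1)])
      (simp_all add: that 1 BC.cl)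
  show ?thesis
    using tensor_assoc_clin[OF wc] 2
    by (intro L.tensor_ahom R.wc_algebra_tensor) (simp_all add: ap AB.cl BC.cl)
qed

lemma cbilin_smult:
  assumes V: "topological_vector_space V"
  shows "cbilin ground V V (smult V)" and "cbilin V ground V (\<lambda>y c. c \<odot>\<^bsub>V\<^esub> y)"
proof -
  note c = tvs_cont(2)[OF V continuous_map_snd continuous_map_fst]
    tvs_cont(2)[OF V continuous_map_fst continuous_map_snd]
  show "cbilin ground V V (smult V)"
    using c(1) by (intro cbilinI[OF ground_tvs V]) (simp_all add: tvs_closed[OF V] tvs_laws[OF V] mult.commute)
  show "cbilin V ground V (\<lambda>y c. c \<odot>\<^bsub>V\<^esub> y)"
    using c(2) by (intro cbilinI[OF V ground_tvs]) (simp_all add: tvs_closed[OF V] tvs_laws[OF V] mult.commute)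
qed

lemma smult_mult:
  assumes "wc_algebra A" "x \<in> carrier A" "y \<in> carrier A"
  shows "(c \<odot>\<^bsub>A\<^esub> x) \<otimes>\<^bsub>A\<^esub> (d \<odot>\<^bsub>A\<^esub> y) = (c * d) \<odot>\<^bsub>A\<^esub> (x \<otimes>\<^bsub>A\<^esub> y)"
  using assms wc_algebraD[OF assms(1)]
  by (simp add: cbilinD(4,5)[OF wc_algebraD(5)[OF assms(1)]] tvs_closed tvs_laws mult.commute)

lemma tensor_ground_ahom:
  assumes A: "wc_algebra A"
  shows "ahom (tensor_algebra ground A) A (tensor_lift ground A A (\<lambda>(c, y). c \<odot>\<^bsub>A\<^esub> y))"
    and "ahom (tensor_algebra A ground) A (tensor_lift A ground A (\<lambda>(y, c). c \<odot>\<^bsub>A\<^esub> y))"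
proof -
  interpret L: wc_algebra_pair ground A
    by unfold_locales (rule wc_algebra_ground A)+
  interpret R: wc_algebra_pair A ground
    by unfold_locales (rule wc_algebra_ground A)+
  note wA = wc_algebraD(1)[OF A]
  note l = tensor_lift_clin[OF ground_tvs L.tvB wA cbilin_smult(1)[OF L.tvB]]
    tensor_lift_pure[OF ground_tvs L.tvB wA cbilin_smult(1)[OF L.tvB]]
  note r = tensor_lift_clin[OF L.tvB ground_tvs wA cbilin_smult(2)[OF L.tvB]]
    tensor_lift_pure[OF L.tvB ground_tvs wA cbilin_smult(2)[OF L.tvB]]
  show "ahom (tensor_algebra ground A) A (tensor_lift ground A A (\<lambda>(c, y). c \<odot>\<^bsub>A\<^esub> y))"
    using l(1) by (intro L.tensor_ahom A) (simp_all add: l(2) L.cl smult_mult[OF A] tvs_laws[OF L.tvB])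
  show "ahom (tensor_algebra A ground) A (tensor_lift A ground A (\<lambda>(y, c). c \<odot>\<^bsub>A\<^esub> y))"
    using r(1) by (intro R.tensor_ahom A) (simp_all add: r(2) L.cl smult_mult[OF A] tvs_laws[OF L.tvB])
qed

section \<open>The universal property for test algebras on other types\<close>

lemma coordinates_weakly_complete:
  fixes V :: "('k::real_normed_field, 'v, 'm) top_module_scheme" and I :: "'v set"
  assumes "coordinates V I h g"
  shows "weakly_complete V"
proof -
  interpret coordinates V I h g by fact
  let ?h = "\<lambda>x\<in>carrier V. h x"
  have "?h \<in> cont_linear V (power_space I)"
    unfolding cont_linear_def
  proof (intro CollectI conjI ballI allI)
    show "?h \<in> carrier V \<rightarrow>\<^sub>E carrier (power_space I)"
      by (auto simp: power_space_def PiE_def h_ext)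
    show "?h (x \<oplus>\<^bsub>V\<^esub> y) = ?h x \<oplus>\<^bsub>power_space I\<^esub> ?h y" if "x \<in> carrier V" "y \<in> carrier V" for x y
      using that by (auto simp: power_space_def tvs_closed[OF tvs] h_add h_ext intro!: extensionalityI[of _ I])
    show "?h (c \<odot>\<^bsub>V\<^esub> x) = c \<odot>\<^bsub>power_space I\<^esub> ?h x" if "x \<in> carrier V" for c x
      using that by (auto simp: power_space_def tvs_closed[OF tvs] h_smult h_ext intro!: extensionalityI[of _ I])
    show "continuous_map (topol V) (topol (power_space I)) ?h"
      using continuous_map_eq[OF h_cont_all, of ?h] by (simp add: power_space_def tvs_closed[OF tvs])
  qed
  from weakly_completeI[OF tvs this g_cont] show ?thesis
    by (simp add: gh hg g_closed PiE_def)
qed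

lemma clin_minus:
  assumes "topological_vector_space V" "topological_vector_space W" "clin V W f"
    "x \<in> carrier V" "y \<in> carrier V"
  shows "f (x \<ominus>\<^bsub>V\<^esub> y) = f x \<ominus>\<^bsub>W\<^esub> f y"
proof -
  have "f (x \<oplus>\<^bsub>V\<^esub> (-1) \<odot>\<^bsub>V\<^esub> y) = f x \<oplus>\<^bsub>W\<^esub> (-1) \<odot>\<^bsub>W\<^esub> f y"
    using assms by (simp add: clinD tvs_closed)
  then show ?thesis
    using assms by (simp add: a_minus_def tvs_laws(4) clinD)
qed

lemma lie_of_simps [simp]:
  "carrier (lie_of A) = carrier A" "add (lie_of A) = add A" "smult (lie_of A) = smult A"
  "topol (lie_of A) = topol A" "bracket (lie_of A) x y = x \<otimes>\<^bsub>A\<^esub> y \<ominus>\<^bsub>A\<^esub> y \<otimes>\<^bsub>A\<^esub> x"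
  by (simp_all add: lie_of_def)

lemma lie_hom_lie_of:
  "f \<in> lie_hom L (lie_of A) \<longleftrightarrow> clin L A f \<and> f \<in> extensional (carrier L) \<and>
     (\<forall>x\<in>carrier L. \<forall>y\<in>carrier L. f (bracket L x y) = f x \<otimes>\<^bsub>A\<^esub> f y \<ominus>\<^bsub>A\<^esub> f y \<otimes>\<^bsub>A\<^esub> f x)"
  by (auto simp: lie_hom_def cont_linear_iff clin_def)

context coordinates
begin

text \<open>The structure of \<open>V\<close> moved to the coordinate vectors. If the indices are
  lists over \<open>'u\<close>, this is a record of exactly the type of the test algebras in
  \<open>enveloping_algebra\<close>.\<close>

definition transport :: "('k, 'i \<Rightarrow> 'k) top_module" where
  "transport = \<lparr>carrier = extensional I, monoid.mult = (\<lambda>a b. h (g a \<otimes>\<^bsub>V\<^esub> g b)), one = h \<one>\<^bsub>V\<^esub>,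
     zero = h \<zero>\<^bsub>V\<^esub>, add = (\<lambda>a b. h (g a \<oplus>\<^bsub>V\<^esub> g b)), smult = (\<lambda>c a. h (c \<odot>\<^bsub>V\<^esub> g a)),
     topol = product_topology (\<lambda>_. euclidean) I\<rparr>"

lemma transport_tvs: "topological_vector_space transport"
  unfolding topological_vector_space_def
proof (intro conjI)
  interpret V: abelian_group V by (rule tvs_laws(1)[OF tvs])
  note s = transport_def h_ext g_closed gh hg tvs_closed[OF tvs]
  show "Module.module (ground :: ('k, 'k) top_module) transport"
  proof (rule Module.moduleI[OF cring_ground])
    show "abelian_group transport"
    proof (rule abelian_groupI)
      fix x assume x: "x \<in> carrier transport"
      show "\<exists>y\<in>carrier transport. y \<oplus>\<^bsub>transport\<^esub> x = \<zero>\<^bsub>transport\<^esub>"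
        using x by (intro bexI[of _ "h (\<ominus>\<^bsub>V\<^esub> g x)"]) (simp_all add: s V.l_neg)
    qed (simp_all add: s V.a_ac)
  qed (simp_all add: s tvs_laws[OF tvs])
  show "topspace (topol transport) = carrier transport"
    by (simp add: transport_def PiE_def)
  have g: "continuous_map T (topol V) (\<lambda>z. g (f z))"
    if "continuous_map T (product_topology (\<lambda>_. euclidean) I) f" for T and f :: "'z \<Rightarrow> 'i \<Rightarrow> 'k"
    using that g_cont by (rule cont_comp)
  show "continuous_map (prod_topology (topol transport) (topol transport)) (topol transport)
      (\<lambda>(x, y). x \<oplus>\<^bsub>transport\<^esub> y)"
    unfolding case_prod_unfold transport_def
    by (simp, intro cont_comp[OF _ h_cont_all] tvs_cont(1)[OF tvs] g cont_intros)
  show "continuous_map (prod_topology euclidean (topol transport)) (topol transport)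
      (\<lambda>(c, x). c \<odot>\<^bsub>transport\<^esub> x)"
    unfolding case_prod_unfold transport_def
    by (simp, intro cont_comp[OF _ h_cont_all] tvs_cont(2)[OF tvs] g cont_intros)
qed

lemma transport_weakly_complete: "weakly_complete transport"
proof -
  interpret T: coordinates transport I "\<lambda>x. x" "\<lambda>x. x"
    by unfold_locales
      (auto simp: transport_tvs, auto simp: transport_def h_add h_smult g_closed hg
        intro: continuous_map_product_projection cont_id)
  \<comment> \<open>\<open>weakly_complete\<close> wants indices of the type of vectors, so every
    index is relabelled by its indicator function.\<close>
  have "inj_on (\<lambda>i k. if k = i then 1 else 0 :: 'k) I"
    by (rule inj_onI) (metis zero_neq_one)
  from T.reindex[OF this] show ?thesis
    by (rule coordinates_weakly_complete)
qed

lemma transport_algebra: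
  assumes A: "top_algebra V"
  shows "wc_algebra transport" "ahom V transport h" "ahom transport V g"
proof -
  interpret V: Ring.ring V using A by (simp add: top_algebra_def)
  have M: "cbilin V V V (monoid.mult V)" using A by (simp add: top_algebra_def)
  note s = transport_def h_ext g_closed gh hg tvs_closed[OF tvs]
  show h: "ahom V transport h"
    unfolding ahom_def by (auto intro!: clinI simp: s h_cont_all)
  show g: "ahom transport V g"
    unfolding ahom_def by (auto intro!: clinI simp: s g_cont)
  note hc = ahomD(1)[OF h] and gc = ahomD(1)[OF g]
  have "cbilin transport transport transport (\<lambda>a b. h (g a \<otimes>\<^bsub>V\<^esub> g b))"
    by (rule cbilin_clin[OF transport_tvs transport_tvs cbilin_comp[OF transport_tvs transport_tvs M gc gc] hc])
  then have "cbilin transport transport transport (monoid.mult transport)"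
    by (simp add: transport_def)
  moreover have "Ring.ring transport"
  proof (rule ringI)
    show "abelian_group transport" by (rule tvs_laws(1)[OF transport_tvs])
    show "monoid transport" by (rule monoidI) (simp_all add: s V.m_assoc)
  qed (simp_all add: s V.l_distr V.r_distr)
  ultimately show "wc_algebra transport"
    by (simp add: wc_algebra_iff top_algebra_def transport_tvs transport_weakly_complete)
qed

end

locale enveloping =
  fixes L :: "('k::real_normed_field, 'l, 'm) top_lie_scheme"
    and U :: "('k, 'u, 'n) top_module_scheme"
    and lam :: "'l \<Rightarrow> 'u"
  assumes L: "wc_lie L" and env: "enveloping_algebra L U lam"
begin

lemma U: "wc_algebra U"
  using env by (simp add: enveloping_algebra_def)

lemma lam: "clin L U lam"
  and lam_bracket: "x \<in> carrier L \<Longrightarrow> y \<in> carrier L \<Longrightarrow>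
    lam (bracket L x y) = lam x \<otimes>\<^bsub>U\<^esub> lam y \<ominus>\<^bsub>U\<^esub> lam y \<otimes>\<^bsub>U\<^esub> lam x"
  using env by (auto simp: enveloping_algebra_def lie_hom_lie_of)

lemma tvL: "topological_vector_space L"
  and bracket_closed: "x \<in> carrier L \<Longrightarrow> y \<in> carrier L \<Longrightarrow> bracket L x y \<in> carrier L"
  using L by (simp_all add: wc_lie_def weakly_complete_def)

lemma lam_closed: "x \<in> carrier L \<Longrightarrow> lam x \<in> carrier U"
  by (rule clinD(1)[OF lam])

text \<open>\<open>transport\<close> has the type of the test algebras and is isomorphic to
  \<open>A\<close> by \<open>h\<close> and \<open>g\<close>. Composing with these two carries
  existence and uniqueness over to \<open>A\<close>, whose elements may have any type.\<close>

lemma universal_list: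
  fixes A :: "('k, 'a, 'p) top_module_scheme" and J :: "'u list set"
  assumes A: "top_algebra A" and co: "coordinates A J h g" and f: "clin L A f"
    and br: "\<And>x y. x \<in> carrier L \<Longrightarrow> y \<in> carrier L \<Longrightarrow>
      f (bracket L x y) = f x \<otimes>\<^bsub>A\<^esub> f y \<ominus>\<^bsub>A\<^esub> f y \<otimes>\<^bsub>A\<^esub> f x"
  shows "\<exists>!F. F \<in> alg_hom U A \<and> (\<forall>x\<in>carrier L. F (lam x) = f x)"
proof -
  interpret coordinates A J h g by (rule co)
  note tr = transport_algebra[OF A]
  note tU = wc_algebraD(3)[OF U]
  have M: "cbilin A A A (monoid.mult A)" using A by (simp add: top_algebra_def)
  let ?f = "\<lambda>x\<in>carrier L. h (f x)"
  have "?f \<in> lie_hom L (lie_of transport)"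
    unfolding lie_hom_lie_of
  proof (intro conjI ballI)
    show "clin L transport ?f"
      by (rule clin_cong[OF tvL clin_comp[OF f ahomD(1)[OF tr(2)]]]) simp
    fix x y assume xy: "x \<in> carrier L" "y \<in> carrier L"
    note fc = clinD(1)[OF f]
    have "h (f x \<otimes>\<^bsub>A\<^esub> f y \<ominus>\<^bsub>A\<^esub> f y \<otimes>\<^bsub>A\<^esub> f x) =
        h (f x \<otimes>\<^bsub>A\<^esub> f y) \<ominus>\<^bsub>transport\<^esub> h (f y \<otimes>\<^bsub>A\<^esub> f x)"
      using xy by (intro clin_minus[OF tvs transport_tvs ahomD(1)[OF tr(2)]] cbilinD(1)[OF M] fc)
    then show "?f (bracket L x y) = ?f x \<otimes>\<^bsub>transport\<^esub> ?f y \<ominus>\<^bsub>transport\<^esub> ?f y \<otimes>\<^bsub>transport\<^esub> ?f x"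
      using xy by (simp add: br bracket_closed ahomD(4)[OF tr(2)] fc)
  qed simp
  with env tr(1) have ex1: "\<exists>!F. F \<in> alg_hom U transport \<and> (\<forall>x\<in>carrier L. F (lam x) = ?f x)"
    unfolding enveloping_algebra_def by blast
  show ?thesis
  proof (rule ex_ex1I)
    from ex1 obtain F where F: "ahom U transport F" "\<And>x. x \<in> carrier L \<Longrightarrow> F (lam x) = h (f x)"
      by (auto simp: alg_hom_iff)
    have "(\<lambda>x\<in>carrier U. g (F x)) \<in> alg_hom U A"
      using ahom_comp[OF F(1) tr(3)] clin_cong[OF tU, of A "\<lambda>x. g (F x)" "\<lambda>x\<in>carrier U. g (F x)"]
        wc_algebraD(6,10)[OF U]
      by (simp add: alg_hom_iff ahom_def)
    moreover have "(\<lambda>x\<in>carrier U. g (F x)) (lam x) = f x" if "x \<in> carrier L" for x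
      using that by (simp add: lam_closed F(2) gh clinD(1)[OF f])
    ultimately show "\<exists>F. F \<in> alg_hom U A \<and> (\<forall>x\<in>carrier L. F (lam x) = f x)"
      by blast
    fix F G
    assume FG: "F \<in> alg_hom U A \<and> (\<forall>x\<in>carrier L. F (lam x) = f x)"
      "G \<in> alg_hom U A \<and> (\<forall>x\<in>carrier L. G (lam x) = f x)"
    have "(\<lambda>x\<in>carrier U. h (H x)) \<in> alg_hom U transport \<and>
        (\<forall>x\<in>carrier L. (\<lambda>x\<in>carrier U. h (H x)) (lam x) = ?f x)"
      if H: "H \<in> alg_hom U A \<and> (\<forall>x\<in>carrier L. H (lam x) = f x)" for H
      using H ahom_comp[of U A H transport h, OF _ tr(2)] wc_algebraD(6,10)[OF U]
        clin_cong[OF tU, of transport "\<lambda>x. h (H x)" "\<lambda>x\<in>carrier U. h (H x)"]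
      by (simp add: alg_hom_iff ahom_def lam_closed)
    from this[OF FG(1)] this[OF FG(2)] ex1
    have eq: "(\<lambda>x\<in>carrier U. h (F x)) = (\<lambda>x\<in>carrier U. h (G x))" by blast
    show "F = G"
    proof (rule extensionalityI[of _ "carrier U"])
      fix x assume x: "x \<in> carrier U"
      have "h (F x) = h (G x)" using fun_cong[OF eq, of x] x by simp
      moreover have "F x \<in> carrier A" "G x \<in> carrier A"
        using FG x by (auto simp: alg_hom_iff ahom_def clin_def)
      ultimately show "F x = G x" by (metis gh)
    qed (use FG in \<open>auto simp: alg_hom_iff\<close>)
  qed
qed

context
  fixes A :: "('k, 'a, 'p) top_module_scheme" and I :: "'i set" and h g and \<sigma> :: "'i \<Rightarrow> 'u list"
  assumes A: "top_algebra A" and co: "coordinates A I h g" and inj: "inj_on \<sigma> I"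
begin

text \<open>The injection \<open>\<sigma>\<close> codes indices as words. In the applications they
  have length 0 for the ground field, 1 for \<open>U\<close> and its opposite, 2 and 3 for the
  tensor powers, and lengths 1 and 2 side by side for square-zero extensions.\<close>

lemma universal:
  assumes "clin L A f"
    and "\<And>x y. x \<in> carrier L \<Longrightarrow> y \<in> carrier L \<Longrightarrow>
      f (bracket L x y) = f x \<otimes>\<^bsub>A\<^esub> f y \<ominus>\<^bsub>A\<^esub> f y \<otimes>\<^bsub>A\<^esub> f x"
  shows "\<exists>!F. F \<in> alg_hom U A \<and> (\<forall>x\<in>carrier L. F (lam x) = f x)"
  by (rule universal_list[OF A coordinates.reindex[OF co inj] assms])

text \<open>Multiplicativity makes \<open>F\<close> after \<open>lam\<close> compatible with
  brackets, and \<open>F\<close> and \<open>G\<close> both extend this map, so uniqueness applies.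
  In this way \<open>U\<close> is handled like an algebra generated by the image of
  \<open>lam\<close>.\<close>

lemma ahom_eq:
  assumes F: "ahom U A F" and G: "ahom U A G"
    and eq: "\<And>x. x \<in> carrier L \<Longrightarrow> F (lam x) = G (lam x)" and x: "x \<in> carrier U"
  shows "F x = G x"
proof -
  note tU = wc_algebraD(3)[OF U] and mc = wc_algebraD(10)[OF U]
  have tA: "topological_vector_space A" using A by (simp add: top_algebra_def)
  have "\<exists>!F'. F' \<in> alg_hom U A \<and> (\<forall>x\<in>carrier L. F' (lam x) = F (lam x))"
    by (rule universal[OF clin_comp[OF lam ahomD(1)[OF F]]])
      (simp add: lam_bracket clin_minus[OF tU tA ahomD(1)[OF F]] mc lam_closed ahomD(4)[OF F])
  moreover have "restrict H (carrier U) \<in> alg_hom U A" if H: "ahom U A H" for H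
    using H clin_cong[OF tU ahomD(1)[OF H], of "restrict H (carrier U)"] wc_algebraD(6,10)[OF U]
    by (simp add: alg_hom_iff ahom_def)
  then have "restrict F (carrier U) \<in> alg_hom U A" "restrict G (carrier U) \<in> alg_hom U A"
    using F G by blast+
  moreover have "\<forall>x\<in>carrier L. restrict F (carrier U) (lam x) = F (lam x)"
    "\<forall>x\<in>carrier L. restrict G (carrier U) (lam x) = F (lam x)"
    using eq lam_closed by simp_all
  ultimately have "restrict F (carrier U) = restrict G (carrier U)"
    by blast
  then show ?thesis
    using x by (metis restrict_apply')
qed

end

end

section \<open>Square-zero extensions\<close>

locale bimodule =
  fixes A :: "('k::real_normed_field, 'a, 'm) top_module_scheme"
    and M :: "('k, 'b, 'n) top_module_scheme"
    and l :: "'a \<Rightarrow> 'b \<Rightarrow> 'b" and r :: "'b \<Rightarrow> 'a \<Rightarrow> 'b"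
  assumes A: "top_algebra A" and M: "topological_vector_space M"
    and l: "cbilin A M M l" and r: "cbilin M A M r"
    and l_one: "\<And>m. m \<in> carrier M \<Longrightarrow> l \<one>\<^bsub>A\<^esub> m = m"
    and r_one: "\<And>m. m \<in> carrier M \<Longrightarrow> r m \<one>\<^bsub>A\<^esub> = m"
    and l_mult: "\<And>x y m. x \<in> carrier A \<Longrightarrow> y \<in> carrier A \<Longrightarrow> m \<in> carrier M \<Longrightarrow>
      l (x \<otimes>\<^bsub>A\<^esub> y) m = l x (l y m)"
    and r_mult: "\<And>x y m. x \<in> carrier A \<Longrightarrow> y \<in> carrier A \<Longrightarrow> m \<in> carrier M \<Longrightarrow>
      r m (x \<otimes>\<^bsub>A\<^esub> y) = r (r m x) y"
    and l_r: "\<And>x y m. x \<in> carrier A \<Longrightarrow> y \<in> carrier A \<Longrightarrow> m \<in> carrier M \<Longrightarrow>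
      l x (r m y) = r (l x m) y"
begin

definition extension :: "('k, 'a \<times> 'b) top_module" where
  "extension = \<lparr>carrier = carrier A \<times> carrier M,
     monoid.mult = (\<lambda>p q. (fst p \<otimes>\<^bsub>A\<^esub> fst q, l (fst p) (snd q) \<oplus>\<^bsub>M\<^esub> r (snd p) (fst q))),
     one = (\<one>\<^bsub>A\<^esub>, \<zero>\<^bsub>M\<^esub>), zero = (\<zero>\<^bsub>A\<^esub>, \<zero>\<^bsub>M\<^esub>),
     add = (\<lambda>p q. (fst p \<oplus>\<^bsub>A\<^esub> fst q, snd p \<oplus>\<^bsub>M\<^esub> snd q)),
     smult = (\<lambda>c p. (c \<odot>\<^bsub>A\<^esub> fst p, c \<odot>\<^bsub>M\<^esub> snd p)),
     topol = prod_topology (topol A) (topol M)\<rparr>"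

lemma tvA: "topological_vector_space A" and ringA: "Ring.ring A"
  and multA: "cbilin A A A (monoid.mult A)"
  using A by (simp_all add: top_algebra_def)

lemma l_zero: "x \<in> carrier A \<Longrightarrow> l x \<zero>\<^bsub>M\<^esub> = \<zero>\<^bsub>M\<^esub>"
  by (rule clin_zero[OF cbilin_right[OF l clin_id] M M])

lemma r_zero: "x \<in> carrier A \<Longrightarrow> r \<zero>\<^bsub>M\<^esub> x = \<zero>\<^bsub>M\<^esub>"
  by (rule clin_zero[OF cbilin_left[OF r clin_id] M M])

lemma extension_tvs: "topological_vector_space extension"
  unfolding topological_vector_space_def
proof (intro conjI)
  interpret A: abelian_group A by (rule tvs_laws(1)[OF tvA])
  interpret M: abelian_group M by (rule tvs_laws(1)[OF M])
  note s = extension_def tvs_closed[OF tvA] tvs_closed[OF M]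
  show "Module.module (ground :: ('k, 'k) top_module) extension"
  proof (rule Module.moduleI[OF cring_ground])
    show "abelian_group extension"
    proof (rule abelian_groupI)
      fix x assume x: "x \<in> carrier extension"
      show "\<exists>y\<in>carrier extension. y \<oplus>\<^bsub>extension\<^esub> x = \<zero>\<^bsub>extension\<^esub>"
        using x by (intro bexI[of _ "(\<ominus>\<^bsub>A\<^esub> fst x, \<ominus>\<^bsub>M\<^esub> snd x)"]) (auto simp: s A.l_neg M.l_neg)
    qed (auto simp: s A.a_ac M.a_ac)
  qed (auto simp: s tvs_laws[OF tvA] tvs_laws[OF M])
  show "topspace (topol extension) = carrier extension"
    by (simp add: s)
  show "continuous_map (prod_topology (topol extension) (topol extension)) (topol extension)
      (\<lambda>(x, y). x \<oplus>\<^bsub>extension\<^esub> y)"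
    unfolding case_prod_unfold extension_def
    by (simp, intro continuous_map_pairedI tvs_cont(1)[OF tvA] tvs_cont(1)[OF M] cont_intros)
      (rule cont_id)+
  show "continuous_map (prod_topology euclidean (topol extension)) (topol extension)
      (\<lambda>(c, x). c \<odot>\<^bsub>extension\<^esub> x)"
    unfolding case_prod_unfold extension_def
    by (simp, intro continuous_map_pairedI tvs_cont(2)[OF tvA] tvs_cont(2)[OF M] cont_intros)
      (rule cont_id)+
qed

lemma extension_algebra: "top_algebra extension"
  unfolding top_algebra_def
proof (intro conjI extension_tvs)
  interpret A: Ring.ring A by (rule ringA)
  interpret M: abelian_group M by (rule tvs_laws(1)[OF M])
  note s = extension_def tvs_closed[OF tvA] tvs_closed[OF M]
    cbilinD(1-5)[OF l] cbilinD(1-5)[OF r] cbilinD(4,5)[OF multA]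
  show "cbilin extension extension extension (monoid.mult extension)"
  proof (rule cbilinI[OF extension_tvs extension_tvs])
    show "continuous_map (prod_topology (topol extension) (topol extension)) (topol extension)
        (\<lambda>p. fst p \<otimes>\<^bsub>extension\<^esub> snd p)"
      unfolding extension_def
      by (simp, intro continuous_map_pairedI tvs_cont(1)[OF M] cbilin_cont[OF l] cbilin_cont[OF r]
          cbilin_cont[OF multA] cont_intros) (rule cont_id)+
  qed (auto simp: s A.l_distr A.r_distr M.a_ac tvs_laws[OF M])
  show "Ring.ring extension"
  proof (rule ringI)
    show "abelian_group extension" by (rule tvs_laws(1)[OF extension_tvs])
    show "monoid extension"
      by (rule monoidI) (auto simp: s A.m_assoc l_one r_one l_zero r_zero l_mult r_mult l_r M.a_ac)
  qed (auto simp: s A.l_distr A.r_distr M.a_ac)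
qed

lemma extension_coordinates:
  assumes "coordinates A I h g" "coordinates M J h' g'"
  shows "coordinates extension (I <+> J) (\<lambda>p. case_sum (h (fst p)) (h' (snd p)))
    (\<lambda>a. (g (\<lambda>i\<in>I. a (Inl i)), g' (\<lambda>j\<in>J. a (Inr j))))"
proof -
  interpret A: coordinates A I h g by fact
  interpret M: coordinates M J h' g' by fact
  have rs: "restrict a K = a" if "a \<in> extensional K" for a :: "'z \<Rightarrow> 'k" and K
    using that by (auto simp: extensional_def)
  show ?thesis
  proof
    show "topological_vector_space extension" by (rule extension_tvs)
    show "case_sum (h (fst x)) (h' (snd x)) \<in> extensional (I <+> J)" if "x \<in> carrier extension" for x
      using that A.h_ext[of "fst x"] M.h_ext[of "snd x"]
      by (auto simp: extension_def extensional_def split: sum.splits)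
    show "(g (\<lambda>i\<in>I. a (Inl i)), g' (\<lambda>j\<in>J. a (Inr j))) \<in> carrier extension" for a :: "_ \<Rightarrow> 'k"
      by (simp add: extension_def A.g_closed M.g_closed)
    show "(g (\<lambda>i\<in>I. case_sum (h (fst x)) (h' (snd x)) (Inl i)),
        g' (\<lambda>j\<in>J. case_sum (h (fst x)) (h' (snd x)) (Inr j))) = x" if "x \<in> carrier extension" for x
      using that by (auto simp: extension_def rs A.h_ext M.h_ext A.gh M.gh)
    show "case_sum (h (fst (g (\<lambda>i\<in>I. a (Inl i)), g' (\<lambda>j\<in>J. a (Inr j)))))
        (h' (snd (g (\<lambda>i\<in>I. a (Inl i)), g' (\<lambda>j\<in>J. a (Inr j))))) = a" if "a \<in> extensional (I <+> J)" for a
      using that by (auto simp: fun_eq_iff A.hg M.hg extensional_def split: sum.splits)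
    show "continuous_map (topol extension) euclidean (\<lambda>x. case_sum (h (fst x)) (h' (snd x)) i)"
      if "i \<in> I <+> J" for i
      using that by (auto simp: extension_def intro: cont_comp[OF continuous_map_fst A.h_cont]
          cont_comp[OF continuous_map_snd M.h_cont])
    have "continuous_map (product_topology (\<lambda>_. euclidean) (I <+> J)) (product_topology (\<lambda>_. euclidean) I)
        (\<lambda>a. \<lambda>i\<in>I. a (Inl i))"
      "continuous_map (product_topology (\<lambda>_. euclidean) (I <+> J)) (product_topology (\<lambda>_. euclidean) J)
        (\<lambda>a. \<lambda>j\<in>J. a (Inr j))"
      by (auto simp: continuous_map_componentwise intro!: continuous_map_product_projection)
    from cont_comp[OF this(1) A.g_cont] cont_comp[OF this(2) M.g_cont]
    show "continuous_map (product_topology (\<lambda>_. euclidean) (I <+> J)) (topol extension)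
        (\<lambda>a. (g (\<lambda>i\<in>I. a (Inl i)), g' (\<lambda>j\<in>J. a (Inr j))))"
      by (auto simp: extension_def intro: continuous_map_pairedI)
  qed (auto simp: extension_def A.h_add M.h_add A.h_smult M.h_smult)
qed

lemma derivation_ahom:
  assumes D: "clin A M D"
    and mult: "\<And>x y. x \<in> carrier A \<Longrightarrow> y \<in> carrier A \<Longrightarrow> D (x \<otimes>\<^bsub>A\<^esub> y) = l x (D y) \<oplus>\<^bsub>M\<^esub> r (D x) y"
  shows "ahom A extension (\<lambda>x. (x, D x))"
proof -
  interpret A: Ring.ring A by (rule ringA)
  interpret M: abelian_group M by (rule tvs_laws(1)[OF M])
  note Dc = clinD(1)[OF D]
  \<comment> \<open>The Leibniz rule at the pair of units. It forces \<open>D\<close> to kill the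
    unit, so that the unit goes to the unit of the extension.\<close>
  have "D \<one>\<^bsub>A\<^esub> \<oplus>\<^bsub>M\<^esub> D \<one>\<^bsub>A\<^esub> = D \<one>\<^bsub>A\<^esub>"
    using mult[of "\<one>\<^bsub>A\<^esub>" "\<one>\<^bsub>A\<^esub>"] by (simp add: Dc l_one r_one)
  then have "D \<one>\<^bsub>A\<^esub> = \<zero>\<^bsub>M\<^esub>"
    by (metis A.one_closed Dc M.add.l_cancel_one')
  then show ?thesis
    using continuous_map_pairedI[OF cont_id clinD(4)[OF D]]
    by (auto simp: ahom_def extension_def mult clinD[OF D] intro!: clinI)
qed

end

lemma (in enveloping) derivation_eq_zero:
  fixes M :: "('k, 'b, 'p) top_module_scheme" and J :: "'u set"
  assumes bim: "bimodule U M l r" and co: "coordinates M J h g" and D: "clin U M D"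
    and mult: "\<And>x y. x \<in> carrier U \<Longrightarrow> y \<in> carrier U \<Longrightarrow> D (x \<otimes>\<^bsub>U\<^esub> y) = l x (D y) \<oplus>\<^bsub>M\<^esub> r (D x) y"
    and lam0: "\<And>x. x \<in> carrier L \<Longrightarrow> D (lam x) = \<zero>\<^bsub>M\<^esub>" and x: "x \<in> carrier U"
  shows "D x = \<zero>\<^bsub>M\<^esub>"
proof -
  interpret B: bimodule U M l r by (rule bim)
  interpret M: abelian_group M by (rule tvs_laws(1)[OF B.M])
  obtain I :: "'u set" and k k' where I: "coordinates U I k k'"
    using weakly_complete_coordinates[OF wc_algebraD(1)[OF U]] .
  \<comment> \<open>One-letter words index \<open>U\<close> and two-letter words index
    \<open>M\<close>, so the two halves of the extension stay apart even when \<open>I\<close> and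
    \<open>J\<close> overlap.\<close>
  have inj: "inj_on (case_sum (\<lambda>i. [i]) (\<lambda>j. [j, j])) (I <+> J)"
    by (auto simp: inj_on_def)
  have "clin U M (\<lambda>x. \<zero>\<^bsub>M\<^esub>)"
    by (rule clinI) (simp_all add: tvs_laws[OF B.M] tvs_closed[OF B.M])
  then have Z: "ahom U B.extension (\<lambda>x. (x, \<zero>\<^bsub>M\<^esub>))"
    by (rule B.derivation_ahom) (simp add: B.l_zero B.r_zero)
  have "(x, D x) = (x, \<zero>\<^bsub>M\<^esub>)"
    by (rule ahom_eq[OF B.extension_algebra B.extension_coordinates[OF I co] inj
          B.derivation_ahom[OF D mult] Z _ x]) (simp_all add: lam0)
  then show ?thesis by simp
qed

section \<open>The Hopf algebra structure\<close>

context enveloping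
begin

section \<open>Comultiplication and counit from the universal property\<close>

sublocale T: wc_algebra_pair U U
  by unfold_locales (rule U)+

abbreviation "comult \<equiv> env_comult L U lam"
abbreviation "counit \<equiv> env_coidentity L U lam"
abbreviation "UU \<equiv> tensor_algebra U U"
abbreviation "pt \<equiv> pure_tensor U U"

lemmas U_simps = wc_algebraD(6-10)[OF U] tvs_closed[OF T.tvA] lam_closed

lemma primitive_clin:
  "clin L (tensor U U) (\<lambda>x. pt (lam x) \<one>\<^bsub>U\<^esub> \<oplus>\<^bsub>tensor U U\<^esub> pt \<one>\<^bsub>U\<^esub> (lam x))"
  by (intro clin_add T.tvT cbilin_left[OF T.pure lam] cbilin_right[OF T.pure lam] U_simps)

text \<open>Elements x tensor 1 and 1 tensor y commute, so the mixed terms of the commutator cancel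
  and the part with [x,y] in a single factor remains.\<close>

lemma primitive_bracket:
  assumes x: "x \<in> carrier L" and y: "y \<in> carrier L"
  defines "d \<equiv> \<lambda>x. pt (lam x) \<one>\<^bsub>U\<^esub> \<oplus>\<^bsub>UU\<^esub> pt \<one>\<^bsub>U\<^esub> (lam x)"
  shows "d (bracket L x y) = d x \<otimes>\<^bsub>UU\<^esub> d y \<ominus>\<^bsub>UU\<^esub> d y \<otimes>\<^bsub>UU\<^esub> d x"
proof -
  interpret U: Ring.ring U by (rule wc_algebraD(4)[OF U])
  interpret R: Ring.ring UU by (rule wc_algebraD(4)[OF T.wc_algebra_tensor])
  let ?x = "lam x" and ?y = "lam y"
  have xy: "?x \<in> carrier U" "?y \<in> carrier U" using x y by (simp_all add: lam_closed)
  have pc: "pt a b \<in> carrier UU" if "a \<in> carrier U" "b \<in> carrier U" for a b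
    using T.pure_closed[OF that] by simp
  \<comment> \<open>The commutator is rewritten as a sum without subtraction, so that the two
    products can be compared by associativity and commutativity of addition alone.\<close>
  have c: "lam (bracket L x y) \<oplus>\<^bsub>U\<^esub> ?y \<otimes>\<^bsub>U\<^esub> ?x = ?x \<otimes>\<^bsub>U\<^esub> ?y"
    using xy by (simp add: lam_bracket x y a_minus_def U.a_assoc U.l_neg)
  have b: "lam (bracket L x y) \<in> carrier U"
    using x y by (simp add: lam_closed bracket_closed)
  have 1: "pt (?x \<otimes>\<^bsub>U\<^esub> ?y) \<one>\<^bsub>U\<^esub> = pt (lam (bracket L x y)) \<one>\<^bsub>U\<^esub> \<oplus>\<^bsub>UU\<^esub> pt (?y \<otimes>\<^bsub>U\<^esub> ?x) \<one>\<^bsub>U\<^esub>"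
    using cbilinD(2)[OF T.pure b, of "?y \<otimes>\<^bsub>U\<^esub> ?x" "\<one>\<^bsub>U\<^esub>"] xy by (simp add: c)
  have 2: "pt \<one>\<^bsub>U\<^esub> (?x \<otimes>\<^bsub>U\<^esub> ?y) = pt \<one>\<^bsub>U\<^esub> (lam (bracket L x y)) \<oplus>\<^bsub>UU\<^esub> pt \<one>\<^bsub>U\<^esub> (?y \<otimes>\<^bsub>U\<^esub> ?x)"
    using cbilinD(3)[OF T.pure _ b, of "\<one>\<^bsub>U\<^esub>" "?y \<otimes>\<^bsub>U\<^esub> ?x"] xy by (simp add: c)
  have mult: "d u \<otimes>\<^bsub>UU\<^esub> d v = pt (lam u \<otimes>\<^bsub>U\<^esub> lam v) \<one>\<^bsub>U\<^esub> \<oplus>\<^bsub>UU\<^esub> pt (lam v) (lam u) \<oplus>\<^bsub>UU\<^esub>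
      (pt (lam u) (lam v) \<oplus>\<^bsub>UU\<^esub> pt \<one>\<^bsub>U\<^esub> (lam u \<otimes>\<^bsub>U\<^esub> lam v))" if "u \<in> carrier L" "v \<in> carrier L" for u v
  proof -
    have uv: "lam u \<in> carrier U" "lam v \<in> carrier U" using that by (simp_all add: lam_closed)
    show ?thesis
      unfolding d_def using uv pc
      by (simp only: R.l_distr R.r_distr R.a_closed U.one_closed T.tensor_mult_pure U.l_one U.r_one)
  qed
  have "d x \<otimes>\<^bsub>UU\<^esub> d y = d (bracket L x y) \<oplus>\<^bsub>UU\<^esub> d y \<otimes>\<^bsub>UU\<^esub> d x"
    unfolding mult[OF x y] mult[OF y x] unfolding 1 2 d_def
    using xy b pc by (simp only: R.a_ac R.a_closed U.m_closed U.one_closed)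
  moreover have "d u \<in> carrier UU" if "u \<in> carrier L" for u
    unfolding d_def using that pc by (simp only: R.a_closed U.one_closed lam_closed)
  ultimately show ?thesis
    using x y bracket_closed by (simp only: a_minus_def R.m_closed R.a_inv_closed R.a_assoc R.r_neg R.r_zero)
qed

lemma coordinates_U: obtains I :: "'u set" and h g where "coordinates U I h g"
  using weakly_complete_coordinates[OF wc_algebraD(1)[OF U]] .

lemma tensor_algebra_coordinates [simp]:
  "coordinates (tensor_algebra A B) I h g \<longleftrightarrow> coordinates (tensor A B) I h g"
  by (simp add: coordinates_def)

lemma comult_ex1: "\<exists>!F. F \<in> alg_hom U UU \<and>
    (\<forall>x\<in>carrier L. F (lam x) = pt (lam x) \<one>\<^bsub>U\<^esub> \<oplus>\<^bsub>tensor U U\<^esub> pt \<one>\<^bsub>U\<^esub> (lam x))"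
proof -
  obtain I :: "'u set" and h g where I: "coordinates U I h g" by (rule coordinates_U)
  obtain h' g' where co: "coordinates UU (I \<times> I) h' g'"
    using tensor_coordinates_ex[OF I I] by auto
  have inj: "inj_on (\<lambda>q. [fst q, snd q]) (I \<times> I)" by (auto simp: inj_on_def)
  show ?thesis
    using primitive_clin primitive_bracket
    by (intro universal[OF wc_algebraD(2)[OF T.wc_algebra_tensor] co inj]) simp_all
qed

lemma comult_alg_hom: "comult \<in> alg_hom U UU"
  and comult: "ahom U UU comult"
  and comult_lam: "x \<in> carrier L \<Longrightarrow>
    comult (lam x) = pt (lam x) \<one>\<^bsub>U\<^esub> \<oplus>\<^bsub>tensor U U\<^esub> pt \<one>\<^bsub>U\<^esub> (lam x)"
  using theI'[OF comult_ex1, folded env_comult_def] by (simp_all add: alg_hom_iff)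

lemma ground_coordinates: "coordinates ground {()} (\<lambda>x. \<lambda>i\<in>{()}. x) (\<lambda>a. a ())"
  using continuous_map_product_projection[of "()" "{()}" "\<lambda>_. euclidean"]
  by unfold_locales (auto simp: ground_tvs fun_eq_iff cont_id)

lemma counit_ex1: "\<exists>!F. F \<in> alg_hom U ground \<and> (\<forall>x\<in>carrier L. F (lam x) = 0)"
proof (rule universal[OF wc_algebraD(2)[OF wc_algebra_ground] ground_coordinates, of "\<lambda>_. []"])
  interpret K: Ring.ring "ground :: ('k, 'k) top_module"
    by (rule wc_algebraD(4)[OF wc_algebra_ground])
  show "clin L ground (\<lambda>x. 0)"
    by (rule clinI) auto
  show "0 = 0 \<otimes>\<^bsub>ground\<^esub> 0 \<ominus>\<^bsub>ground\<^esub> (0 \<otimes>\<^bsub>ground\<^esub> (0 :: 'k))"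
    using K.r_neg[of 0] by (simp add: a_minus_def)
qed simp

lemma counit_alg_hom: "counit \<in> alg_hom U ground"
  and counit: "ahom U ground counit"
  and counit_lam: "x \<in> carrier L \<Longrightarrow> counit (lam x) = 0"
proof -
  \<comment> \<open>Passing through the zero Lie algebra and then the zero unit of the ground field
    prescribes the value zero on all of \<open>lam\<close>.\<close>
  have "counit = (THE f. f \<in> alg_hom U ground \<and> (\<forall>x\<in>carrier L. f (lam x) = 0))"
    by (simp add: env_coidentity_def env_map_def zero_lie_def)
  with theI'[OF counit_ex1]
  show "counit \<in> alg_hom U ground" "ahom U ground counit"
    "x \<in> carrier L \<Longrightarrow> counit (lam x) = 0"
    by (simp_all add: alg_hom_iff)
qed

section \<open>Coassociativity and the counit laws\<close>

abbreviation "idU \<equiv> \<lambda>x\<in>carrier U. x"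

lemma idU: "ahom U U idU"
  by (rule ahom_restrict_id[OF U])

text \<open>For x in the image of \<open>lam\<close> both sides give x tensor 1 tensor 1 + 1 tensor
  x tensor 1 + 1 tensor 1 tensor x, bracketed to the right.\<close>

lemma coassoc:
  assumes x: "x \<in> carrier U"
  shows "tensor_assoc U U U (tensor_map U U (tensor U U) U comult idU (comult x)) =
    tensor_map U U U (tensor U U) idU comult (comult x)"
proof -
  obtain I :: "'u set" and h g where I: "coordinates U I h g" by (rule coordinates_U)
  obtain h' g' where "coordinates (tensor U U) (I \<times> I) h' g'"
    using tensor_coordinates_ex[OF I I] by auto
  from tensor_coordinates_ex[OF I this]
  obtain h'' g'' where co: "coordinates (tensor_algebra U UU) (I \<times> (I \<times> I)) h'' g''"
    by auto
  have inj: "inj_on (\<lambda>q. [fst q, fst (snd q), snd (snd q)]) (I \<times> (I \<times> I))"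
    by (auto simp: inj_on_def)
  interpret R: wc_algebra_pair U UU
    by unfold_locales (rule U T.wc_algebra_tensor)+
  interpret L: wc_algebra_pair UU U
    by unfold_locales (rule U T.wc_algebra_tensor)+
  \<comment> \<open>\<open>tensor_map_ahom\<close> speaks of induced maps over \<open>UU\<close>,
    the Hopf laws of those over \<open>tensor U U\<close>; the underlying spaces agree.\<close>
  have tm: "tensor_map U U UU U f g = tensor_map U U (tensor U U) U f g"
    "tensor_map U U U UU g f = tensor_map U U U (tensor U U) g f" for f g
    by (simp_all add: tensor_map_def)
  note tv = T.tvA T.tvA T.tvT T.tvA
  note tv' = T.tvA T.tvA T.tvA T.tvT
  have cc: "clin U (tensor U U) comult" using ahomD(1)[OF comult] by simp
  note c1 = tensor_map_pure[OF tv cc ahomD(1)[OF idU]] tensor_map_clin[OF tv cc ahomD(1)[OF idU]]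
  note c2 = tensor_map_pure[OF tv' ahomD(1)[OF idU] cc] tensor_map_clin[OF tv' ahomD(1)[OF idU] cc]
  note wc = wc_algebraD(1)[OF U] wc_algebraD(1)[OF U] wc_algebraD(1)[OF U]
  note as = tensor_assoc_pure[OF wc] tensor_assoc_clin[OF wc]
  have one: "comult \<one>\<^bsub>U\<^esub> = pt \<one>\<^bsub>U\<^esub> \<one>\<^bsub>U\<^esub>" using ahomD(3)[OF comult] by simp
  interpret X: abelian_group "tensor U (tensor U U)"
    by (rule tvs_laws(1)[OF R.tvT[simplified]])
  show ?thesis
  proof (rule ahom_eq[OF wc_algebraD(2)[OF R.wc_algebra_tensor] co inj _ _ _ x])
    show "ahom U (tensor_algebra U UU)
        (\<lambda>x. tensor_assoc U U U (tensor_map U U (tensor U U) U comult idU (comult x)))"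
      using ahom_comp[OF ahom_comp[OF comult tensor_map_ahom[OF U U T.wc_algebra_tensor U comult idU]]
          tensor_assoc_ahom[OF U U U]]
      by (simp add: tm)
    show "ahom U (tensor_algebra U UU) (\<lambda>x. tensor_map U U U (tensor U U) idU comult (comult x))"
      using ahom_comp[OF comult tensor_map_ahom[OF U U U T.wc_algebra_tensor idU comult]]
      by (simp add: tm)
    fix y assume y: "y \<in> carrier L"
    note z = lam_closed[OF y]
    let ?p = "pure_tensor U (tensor U U)"
    note pc = T.pure_closed R.pure_closed[simplified] L.pure_closed[simplified]
    have "tensor_assoc U U U (tensor_map U U (tensor U U) U comult idU (comult (lam y))) =
        ?p (lam y) (pt \<one>\<^bsub>U\<^esub> \<one>\<^bsub>U\<^esub>) \<oplus>\<^bsub>tensor U (tensor U U)\<^esub>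
        ?p \<one>\<^bsub>U\<^esub> (pt (lam y) \<one>\<^bsub>U\<^esub>) \<oplus>\<^bsub>tensor U (tensor U U)\<^esub> ?p \<one>\<^bsub>U\<^esub> (pt \<one>\<^bsub>U\<^esub> (lam y))"
      using z y
      by (simp add: comult_lam clinD[OF c1(2)] c1(1) clinD[OF as(2)] one U_simps pc
          cbilinD(2)[OF tensor_assoc_pure_cbilin[OF wc]] as(1) tvs_closed[OF T.tvT] tvs_closed[OF L.tvT[simplified]])
    also have "\<dots> = tensor_map U U U (tensor U U) idU comult (comult (lam y))"
      using z y
      by (simp add: comult_lam clinD[OF c2(2)] c2(1) one U_simps pc
          cbilinD(3)[OF cbilin_pure_tensor[OF T.tvA T.tvT]] tvs_closed[OF T.tvT] X.a_assoc)
    finally show "tensor_assoc U U U (tensor_map U U (tensor U U) U comult idU (comult (lam y))) =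
        tensor_map U U U (tensor U U) idU comult (comult (lam y))" .
  qed
qed

text \<open>One summand of \<open>comult (lam y)\<close> contributes a multiple of the unit by
  \<open>counit (lam y)\<close>, which is zero; the other contributes \<open>lam y\<close> itself,
  because the counit of the unit is 1.\<close>

lemma counit_left_right:
  assumes x: "x \<in> carrier U"
  shows "tensor_lift ground U U (\<lambda>(c, y). c \<odot>\<^bsub>U\<^esub> y) (tensor_map U U ground U counit idU (comult x)) = x"
    and "tensor_lift U ground U (\<lambda>(y, c). c \<odot>\<^bsub>U\<^esub> y) (tensor_map U U U ground idU counit (comult x)) = x"
proof -
  obtain I :: "'u set" and h g where I: "coordinates U I h g" by (rule coordinates_U)
  have inj: "inj_on (\<lambda>i. [i]) I" by (simp add: inj_on_def)
  interpret U: abelian_group U by (rule tvs_laws(1)[OF T.tvA])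
  note K = wc_algebra_ground wc_algebraD(1)[OF U]
  note c1 = tensor_map_pure[OF T.tvA T.tvA ground_tvs T.tvA ahomD(1)[OF counit] ahomD(1)[OF idU]]
    tensor_map_clin[OF T.tvA T.tvA ground_tvs T.tvA ahomD(1)[OF counit] ahomD(1)[OF idU]]
  note c2 = tensor_map_pure[OF T.tvA T.tvA T.tvA ground_tvs ahomD(1)[OF idU] ahomD(1)[OF counit]]
    tensor_map_clin[OF T.tvA T.tvA T.tvA ground_tvs ahomD(1)[OF idU] ahomD(1)[OF counit]]
  note l1 = ahomD(1)[OF tensor_ground_ahom(1)[OF U], simplified]
    tensor_lift_pure[OF ground_tvs T.tvA K(2) cbilin_smult(1)[OF T.tvA]]
  note l2 = ahomD(1)[OF tensor_ground_ahom(2)[OF U], simplified]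
    tensor_lift_pure[OF T.tvA ground_tvs K(2) cbilin_smult(2)[OF T.tvA]]
  have eps: "counit \<one>\<^bsub>U\<^esub> = 1" using ahomD(3)[OF counit] by simp
  note pc = T.pure_closed pure_tensor_closed[OF ground_tvs T.tvA] pure_tensor_closed[OF T.tvA ground_tvs]
  show "tensor_lift ground U U (\<lambda>(c, y). c \<odot>\<^bsub>U\<^esub> y) (tensor_map U U ground U counit idU (comult x)) = x"
  proof (rule ahom_eq[OF wc_algebraD(2)[OF U] I inj _ _ _ x])
    show "ahom U U (\<lambda>x. tensor_lift ground U U (\<lambda>(c, y). c \<odot>\<^bsub>U\<^esub> y)
        (tensor_map U U ground U counit idU (comult x)))"
      by (rule ahom_comp[OF ahom_comp[OF comult tensor_map_ahom[OF U U K(1) U counit idU]]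
            tensor_ground_ahom(1)[OF U]])
    show "ahom U U (\<lambda>x. x)" by (simp add: ahom_def clin_id)
    show "tensor_lift ground U U (\<lambda>(c, y). c \<odot>\<^bsub>U\<^esub> y)
        (tensor_map U U ground U counit idU (comult (lam y))) = lam y" if y: "y \<in> carrier L" for y
      using y lam_closed[OF y]
      by (simp add: comult_lam clinD[OF c1(2)] c1(1) clinD[OF l1(1)] l1(2) eps counit_lam U_simps pc
          tvs_laws[OF T.tvA])
  qed
  show "tensor_lift U ground U (\<lambda>(y, c). c \<odot>\<^bsub>U\<^esub> y) (tensor_map U U U ground idU counit (comult x)) = x"
  proof (rule ahom_eq[OF wc_algebraD(2)[OF U] I inj _ _ _ x])
    show "ahom U U (\<lambda>x. tensor_lift U ground U (\<lambda>(y, c). c \<odot>\<^bsub>U\<^esub> y)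
        (tensor_map U U U ground idU counit (comult x)))"
      by (rule ahom_comp[OF ahom_comp[OF comult tensor_map_ahom[OF U U U K(1) idU counit]]
            tensor_ground_ahom(2)[OF U]])
    show "ahom U U (\<lambda>x. x)" by (simp add: ahom_def clin_id)
    show "tensor_lift U ground U (\<lambda>(y, c). c \<odot>\<^bsub>U\<^esub> y)
        (tensor_map U U U ground idU counit (comult (lam y))) = lam y" if y: "y \<in> carrier L" for y
      using y lam_closed[OF y]
      by (simp add: comult_lam clinD[OF c2(2)] c2(1) clinD[OF l2(1)] l2(2) eps counit_lam U_simps pc
          tvs_laws[OF T.tvA])
  qed
qed

section \<open>The antipode\<close>

definition opposite :: "('k, 'u, 'n) top_module_scheme" where
  "opposite = U\<lparr>monoid.mult := (\<lambda>x y. y \<otimes>\<^bsub>U\<^esub> x)\<rparr>"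

lemma opposite_simps [simp]:
  "carrier opposite = carrier U" "zero opposite = zero U" "add opposite = add U"
  "smult opposite = smult U" "topol opposite = topol U" "one opposite = one U"
  "x \<otimes>\<^bsub>opposite\<^esub> y = y \<otimes>\<^bsub>U\<^esub> x"
  by (simp_all add: opposite_def)

lemma opposite_space [simp]:
  "topological_vector_space opposite" "clin Z opposite f \<longleftrightarrow> clin Z U f"
  using T.tvA
  by (simp_all add: clin_def topological_vector_space_def Module.module_def module_axioms_def
    abelian_group_def abelian_monoid_def abelian_group_axioms_def)

lemma opposite_algebra: "top_algebra opposite"
  unfolding top_algebra_def
proof (intro conjI)
  interpret U: Ring.ring U by (rule wc_algebraD(4)[OF U])
  show "Ring.ring opposite"
  proof (rule ringI)
    show "abelian_group opposite" by (rule tvs_laws(1)) simp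
    show "monoid opposite" by (rule monoidI) (simp_all add: U.m_assoc)
  qed (simp_all add: U.l_distr U.r_distr)
  show "cbilin opposite opposite opposite (monoid.mult opposite)"
  proof (rule cbilinI)
    show "continuous_map (prod_topology (topol opposite) (topol opposite)) (topol opposite)
        (\<lambda>p. fst p \<otimes>\<^bsub>opposite\<^esub> snd p)"
      using cbilin_cont[OF T.mA continuous_map_snd continuous_map_fst] by simp
  qed (simp_all add: U.l_distr U.r_distr cbilinD(4,5)[OF T.mA])
qed simp

text \<open>In the opposite algebra the commutator of -x and -y is y x - x y, the negative of their
  bracket in \<open>U\<close>; hence the negative of \<open>lam\<close> respects brackets as a map
  into \<open>opposite\<close>.\<close>

lemma antipode_ex:
  obtains S where "S \<in> cont_linear U U" "S \<one>\<^bsub>U\<^esub> = \<one>\<^bsub>U\<^esub>"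
    "\<And>x y. x \<in> carrier U \<Longrightarrow> y \<in> carrier U \<Longrightarrow> S (x \<otimes>\<^bsub>U\<^esub> y) = S y \<otimes>\<^bsub>U\<^esub> S x"
    "\<And>x. x \<in> carrier L \<Longrightarrow> S (lam x) = (-1) \<odot>\<^bsub>U\<^esub> lam x"
proof -
  interpret U: Ring.ring U by (rule wc_algebraD(4)[OF U])
  obtain I :: "'u set" and h g where I: "coordinates U I h g" by (rule coordinates_U)
  then have I': "coordinates opposite I h g"
    by (simp add: coordinates_def)
  have inj: "inj_on (\<lambda>i. [i]) I" by (simp add: inj_on_def)
  have "\<exists>!S. S \<in> alg_hom U opposite \<and> (\<forall>x\<in>carrier L. S (lam x) = (-1) \<odot>\<^bsub>U\<^esub> lam x)"
  proof (rule universal[OF opposite_algebra I' inj])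
    show "clin L opposite (\<lambda>x. (-1) \<odot>\<^bsub>U\<^esub> lam x)"
      using clin_smult[OF T.tvA lam] by simp
    fix x y assume x: "x \<in> carrier L" and y: "y \<in> carrier L"
    \<comment> \<open>Subtraction is defined from the whole record, so that of
      \<open>opposite\<close> has to be matched with that of \<open>U\<close>; both amount to adding
      the multiple by -1.\<close>
    have m: "a \<ominus>\<^bsub>opposite\<^esub> b = a \<ominus>\<^bsub>U\<^esub> b" if "a \<in> carrier U" "b \<in> carrier U" for a b
      using that tvs_laws(4)[OF opposite_space(1), of b] tvs_laws(4)[OF T.tvA, of b]
      by (simp add: a_minus_def)
    have "(-1) \<odot>\<^bsub>U\<^esub> lam (bracket L x y) = lam y \<otimes>\<^bsub>U\<^esub> lam x \<ominus>\<^bsub>U\<^esub> lam x \<otimes>\<^bsub>U\<^esub> lam y"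
      using x y lam_closed
      by (simp add: lam_bracket tvs_laws(4)[OF T.tvA] a_minus_def U.minus_add U.a_comm)
    then show "(-1) \<odot>\<^bsub>U\<^esub> lam (bracket L x y) =
        ((-1) \<odot>\<^bsub>U\<^esub> lam x) \<otimes>\<^bsub>opposite\<^esub> ((-1) \<odot>\<^bsub>U\<^esub> lam y) \<ominus>\<^bsub>opposite\<^esub>
        ((-1) \<odot>\<^bsub>U\<^esub> lam y) \<otimes>\<^bsub>opposite\<^esub> ((-1) \<odot>\<^bsub>U\<^esub> lam x)"
      using x y lam_closed by (simp add: m smult_mult[OF U] tvs_laws(3)[OF T.tvA] tvs_closed[OF T.tvA])
  qed
  then obtain S where "S \<in> alg_hom U opposite" "\<forall>x\<in>carrier L. S (lam x) = (-1) \<odot>\<^bsub>U\<^esub> lam x"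
    by blast
  then show ?thesis
    by (intro that[of S]) (simp_all add: alg_hom_iff ahom_def cont_linear_iff)
qed

end

section \<open>The antipode laws as vanishing of derivations\<close>

lemma cbilin_swap:
  assumes V: "topological_vector_space V" and W: "topological_vector_space W" and b: "cbilin V W X b"
  shows "cbilin W V X (\<lambda>w v. b v w)"
  by (intro cbilinI[OF W V] cbilin_cont[OF b continuous_map_snd continuous_map_fst])
    (simp_all add: cbilinD[OF b])

context enveloping
begin

text \<open>The first alternative for \<open>K\<close> makes \<open>U\<close> a left \<open>U\<close>-module via \<open>x \<cdot> m = K (\<Delta> x) m\<close>, the
  second one a right module; the counit provides the action on the other side.\<close>

lemma convolution_one:
  assumes K: "cbilin (tensor U U) U U K"
    and one: "\<And>m. m \<in> carrier U \<Longrightarrow> K (pt \<one>\<^bsub>U\<^esub> \<one>\<^bsub>U\<^esub>) m = m"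
    and lam0: "\<And>x. x \<in> carrier L \<Longrightarrow> K (comult (lam x)) \<one>\<^bsub>U\<^esub> = \<zero>\<^bsub>U\<^esub>"
    and mult: "(\<forall>s\<in>carrier (tensor U U). \<forall>t\<in>carrier (tensor U U). \<forall>m\<in>carrier U.
        K (s \<otimes>\<^bsub>UU\<^esub> t) m = K s (K t m)) \<or>
      (\<forall>s\<in>carrier (tensor U U). \<forall>t\<in>carrier (tensor U U). \<forall>m\<in>carrier U.
        K (s \<otimes>\<^bsub>UU\<^esub> t) m = K t (K s m))"
    and x: "x \<in> carrier U"
  shows "K (comult x) \<one>\<^bsub>U\<^esub> = counit x \<odot>\<^bsub>U\<^esub> \<one>\<^bsub>U\<^esub>"
proof -
  interpret U: Ring.ring U by (rule wc_algebraD(4)[OF U])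
  obtain I :: "'u set" and h g where I: "coordinates U I h g" by (rule coordinates_U)
  note laws = tvs_laws[OF T.tvA] and tU = T.tvA
  define a where "a = (\<lambda>x m. K (comult x) m)"
  define c where "c = (\<lambda>x m. counit x \<odot>\<^bsub>U\<^esub> m)"
  have cc: "clin U (tensor U U) comult" using ahomD(1)[OF comult] by simp
  have a: "cbilin U U U a"
    unfolding a_def by (rule cbilin_comp[OF tU tU K cc clin_id])
  have c: "cbilin U U U c"
    unfolding c_def by (rule cbilin_comp[OF tU tU cbilin_smult(1)[OF tU] ahomD(1)[OF counit] clin_id])
  have a1: "a \<one>\<^bsub>U\<^esub> m = m" and c1: "c \<one>\<^bsub>U\<^esub> m = m" if "m \<in> carrier U" for m
    using that ahomD(3)[OF comult] ahomD(3)[OF counit] by (simp_all add: a_def c_def one laws)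
  \<comment> \<open>The ground field is commutative, so the action through the counit serves both as
    a left and as a right action.\<close>
  have cm: "c (x \<otimes>\<^bsub>U\<^esub> y) m = c x (c y m)" "c (x \<otimes>\<^bsub>U\<^esub> y) m = c y (c x m)"
    if "x \<in> carrier U" "y \<in> carrier U" "m \<in> carrier U" for x y m
    using that ahomD(4)[OF counit] by (simp_all add: c_def laws mult.commute)
  have ac: "a x (c y m) = c y (a x m)" if "x \<in> carrier U" "y \<in> carrier U" "m \<in> carrier U" for x y m
    using that cbilinD(5)[OF a] by (simp add: c_def)
  define D where "D = (\<lambda>x. a x \<one>\<^bsub>U\<^esub> \<oplus>\<^bsub>U\<^esub> (-1) \<odot>\<^bsub>U\<^esub> c x \<one>\<^bsub>U\<^esub>)"
  have D: "clin U U D"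
    unfolding D_def by (intro clin_add clin_smult tU cbilin_left[OF a clin_id] cbilin_left[OF c clin_id]) simp_all
  \<comment> \<open>\<open>P\<close>, \<open>Q\<close> and \<open>R\<close> stand for the unit acted
    on by two factors: both through \<open>a\<close>, one through \<open>a\<close> and one through
    \<open>c\<close>, and both through \<open>c\<close>. Inserting \<open>Q\<close> splits
    \<open>D\<close> of the product into its two Leibniz terms.\<close>
  have cancel: "(P \<oplus>\<^bsub>U\<^esub> (-1) \<odot>\<^bsub>U\<^esub> Q) \<oplus>\<^bsub>U\<^esub> (Q \<oplus>\<^bsub>U\<^esub> (-1) \<odot>\<^bsub>U\<^esub> R) = P \<oplus>\<^bsub>U\<^esub> (-1) \<odot>\<^bsub>U\<^esub> R"
    if "P \<in> carrier U" "Q \<in> carrier U" "R \<in> carrier U" for P Q R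
    using that by (simp add: laws(4) U.a_assoc U.r_neg1)
  have D0: "D (lam x) = \<zero>\<^bsub>U\<^esub>" if "x \<in> carrier L" for x
    using that by (simp add: D_def a_def c_def lam0 counit_lam laws)
  have "D x = \<zero>\<^bsub>U\<^esub>"
    using mult
  proof
    assume m: "\<forall>s\<in>carrier (tensor U U). \<forall>t\<in>carrier (tensor U U). \<forall>m\<in>carrier U.
        K (s \<otimes>\<^bsub>UU\<^esub> t) m = K s (K t m)"
    have am: "a (x \<otimes>\<^bsub>U\<^esub> y) m = a x (a y m)"
      if "x \<in> carrier U" "y \<in> carrier U" "m \<in> carrier U" for x y m
      using that m ahomD(4)[OF comult] clinD(1)[OF cc] by (simp add: a_def)
    have bim: "bimodule U U a (\<lambda>m y. c y m)"
      by unfold_locales (simp_all add: wc_algebraD(2)[OF U] tU a cbilin_swap[OF tU tU c] a1 c1 am cm(2) ac)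
    show ?thesis
    proof (rule derivation_eq_zero[OF bim I D _ D0 x])
      fix x y assume xy: "x \<in> carrier U" "y \<in> carrier U"
      show "D (x \<otimes>\<^bsub>U\<^esub> y) = a x (D y) \<oplus>\<^bsub>U\<^esub> c y (D x)"
        using xy cancel[of "a x (a y \<one>\<^bsub>U\<^esub>)" "c y (a x \<one>\<^bsub>U\<^esub>)" "c y (c x \<one>\<^bsub>U\<^esub>)"]
        by (simp add: D_def am cm(2) ac cbilinD[OF a] cbilinD[OF c] tvs_closed[OF tU])
    qed
  next
    assume m: "\<forall>s\<in>carrier (tensor U U). \<forall>t\<in>carrier (tensor U U). \<forall>m\<in>carrier U.
        K (s \<otimes>\<^bsub>UU\<^esub> t) m = K t (K s m)"
    have am: "a (x \<otimes>\<^bsub>U\<^esub> y) m = a y (a x m)"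
      if "x \<in> carrier U" "y \<in> carrier U" "m \<in> carrier U" for x y m
      using that m ahomD(4)[OF comult] clinD(1)[OF cc] by (simp add: a_def)
    have bim: "bimodule U U c (\<lambda>m y. a y m)"
      by unfold_locales (simp_all add: wc_algebraD(2)[OF U] tU c cbilin_swap[OF tU tU a] a1 c1 am cm(1) ac)
    show ?thesis
    proof (rule derivation_eq_zero[OF bim I D _ D0 x])
      fix x y assume xy: "x \<in> carrier U" "y \<in> carrier U"
      have "D (x \<otimes>\<^bsub>U\<^esub> y) = a y (D x) \<oplus>\<^bsub>U\<^esub> c x (D y)"
        using xy cancel[of "a y (a x \<one>\<^bsub>U\<^esub>)" "c x (a y \<one>\<^bsub>U\<^esub>)" "c x (c y \<one>\<^bsub>U\<^esub>)"]
        by (simp add: D_def am cm(1) ac cbilinD[OF a] cbilinD[OF c] tvs_closed[OF tU])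
      then show "D (x \<otimes>\<^bsub>U\<^esub> y) = c x (D y) \<oplus>\<^bsub>U\<^esub> a y (D x)"
        using xy by (simp add: U.a_comm clinD(1)[OF D] cbilinD(1)[OF a] cbilinD(1)[OF c])
    qed
  qed
  then have "a x \<one>\<^bsub>U\<^esub> \<oplus>\<^bsub>U\<^esub> \<ominus>\<^bsub>U\<^esub> c x \<one>\<^bsub>U\<^esub> = \<zero>\<^bsub>U\<^esub>"
    using x by (simp add: D_def laws(4) cbilinD(1)[OF c])
  then have "a x \<one>\<^bsub>U\<^esub> = c x \<one>\<^bsub>U\<^esub>"
    using x U.minus_equality[of "a x \<one>\<^bsub>U\<^esub>" "\<ominus>\<^bsub>U\<^esub> c x \<one>\<^bsub>U\<^esub>"] by (simp add: cbilinD(1)[OF a] cbilinD(1)[OF c])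
  then show ?thesis by (simp add: a_def c_def)
qed

text \<open>With the unit for \<open>m\<close> and \<open>comult x\<close> for \<open>t\<close>,
  this is the convolution of \<open>f\<close> and \<open>g\<close> at \<open>x\<close>. The free
  middle slot allows sandwiches to be nested, which provides the actions for
  \<open>convolution_one\<close>.\<close>

definition sandwich where
  "sandwich f g t m = tensor_lift U U U (\<lambda>(a, b). f a \<otimes>\<^bsub>U\<^esub> m \<otimes>\<^bsub>U\<^esub> g b) t"

context
  fixes f g
  assumes f: "clin U U f" and g: "clin U U g"
begin

lemma sandwich_cbilin: "cbilin (tensor U U) U U (sandwich f g)"
  and sandwich_pure: "a \<in> carrier U \<Longrightarrow> b \<in> carrier U \<Longrightarrow> m \<in> carrier U \<Longrightarrow>
    sandwich f g (pt a b) m = f a \<otimes>\<^bsub>U\<^esub> m \<otimes>\<^bsub>U\<^esub> g b"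
proof -
  note wU = wc_algebraD(1)[OF U]
  have b: "cbilin U U U (\<lambda>a b. f a \<otimes>\<^bsub>U\<^esub> m \<otimes>\<^bsub>U\<^esub> g b)" if "m \<in> carrier U" for m
    by (rule cbilin_comp[OF T.tvA T.tvA T.mA cbilin_left[OF T.mA f that] g])
  show "cbilin (tensor U U) U U (sandwich f g)"
    unfolding sandwich_def[abs_def]
  proof (rule cbilin_tensor_lift[OF wU wU wU T.tvA, where \<phi> = "\<lambda>a b m. f a \<otimes>\<^bsub>U\<^esub> m \<otimes>\<^bsub>U\<^esub> g b"])
    show "continuous_map (prod_topology (prod_topology (topol U) (topol U)) (topol U)) (topol U)
        (\<lambda>p. f (fst (fst p)) \<otimes>\<^bsub>U\<^esub> snd p \<otimes>\<^bsub>U\<^esub> g (snd (fst p)))"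
      by (intro cbilin_cont[OF T.mA] clin_cont[OF f] clin_cont[OF g] cont_intros) (rule cont_id)+
    show "clin U U (\<lambda>m. f v \<otimes>\<^bsub>U\<^esub> m \<otimes>\<^bsub>U\<^esub> g w)" if "v \<in> carrier U" "w \<in> carrier U" for v w
      using that clinD(1)[OF f] clinD(1)[OF g]
      by (intro cbilin_left[OF T.mA cbilin_right[OF T.mA clin_id]])
  qed (rule b)
  show "a \<in> carrier U \<Longrightarrow> b \<in> carrier U \<Longrightarrow> m \<in> carrier U \<Longrightarrow>
      sandwich f g (pt a b) m = f a \<otimes>\<^bsub>U\<^esub> m \<otimes>\<^bsub>U\<^esub> g b"
    unfolding sandwich_def by (rule tensor_lift_pure[OF T.tvA T.tvA wU b])
qed

lemma mult_tensor_map: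
  assumes t: "t \<in> carrier (tensor U U)"
  shows "tensor_lift U U U (\<lambda>(x, y). x \<otimes>\<^bsub>U\<^esub> y) (tensor_map U U U U f g t) = sandwich f g t \<one>\<^bsub>U\<^esub>"
proof -
  note wU = wc_algebraD(1)[OF U] and tU = T.tvA
  note m = tensor_map_clin[OF tU tU tU tU f g] tensor_map_pure[OF tU tU tU tU f g]
  note l = tensor_lift_clin[OF tU tU wU T.mA] tensor_lift_pure[OF tU tU wU T.mA]
  show ?thesis
    by (rule T.teq[OF wU clin_comp[OF m(1) l(1)] cbilin_left[OF sandwich_cbilin clin_id U_simps(1)] _ t])
      (simp add: m(2) l(2) clinD(1)[OF f] clinD(1)[OF g] sandwich_pure U_simps)
qed

text \<open>Meant for an \<open>F\<close> that nests two sandwiches around \<open>m\<close>. Both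
  sides are continuous and linear in \<open>s\<close> and in \<open>t\<close>, so agreement on pure
  tensors suffices.\<close>

lemma sandwich_extend:
  assumes F: "cbilin (tensor U U) (tensor U U) U F"
    and pure: "\<And>a b a' b'. a \<in> carrier U \<Longrightarrow> b \<in> carrier U \<Longrightarrow> a' \<in> carrier U \<Longrightarrow> b' \<in> carrier U \<Longrightarrow>
      f (a \<otimes>\<^bsub>U\<^esub> a') \<otimes>\<^bsub>U\<^esub> m \<otimes>\<^bsub>U\<^esub> g (b \<otimes>\<^bsub>U\<^esub> b') = F (pt a b) (pt a' b')"
    and s: "s \<in> carrier (tensor U U)" and t: "t \<in> carrier (tensor U U)" and m: "m \<in> carrier U"
  shows "sandwich f g (s \<otimes>\<^bsub>UU\<^esub> t) m = F s t"
proof -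
  note wU = wc_algebraD(1)[OF U]
  note sl = cbilin_left[OF sandwich_cbilin _ m]
  have 1: "sandwich f g (pt a b \<otimes>\<^bsub>UU\<^esub> t) m = F (pt a b) t" if "a \<in> carrier U" "b \<in> carrier U" for a b
    by (rule T.teq[OF wU sl[OF cbilin_right[OF T.tmult clin_id T.pure_closed]]
          cbilin_right[OF F clin_id T.pure_closed] _ t])
      (simp_all add: that m T.tensor_mult_pure sandwich_pure U_simps pure)
  show ?thesis
    by (rule T.teq[OF wU sl[OF cbilin_left[OF T.tmult clin_id t]] cbilin_left[OF F clin_id t] _ s])
      (simp add: 1)
qed

end

lemma hopf: "wc_hopf_algebra U comult counit"
proof -
  interpret U: Ring.ring U by (rule wc_algebraD(4)[OF U])
  obtain S where S: "S \<in> cont_linear U U" "S \<one>\<^bsub>U\<^esub> = \<one>\<^bsub>U\<^esub>"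
    and S_mult: "\<And>x y. x \<in> carrier U \<Longrightarrow> y \<in> carrier U \<Longrightarrow> S (x \<otimes>\<^bsub>U\<^esub> y) = S y \<otimes>\<^bsub>U\<^esub> S x"
    and S_lam: "\<And>x. x \<in> carrier L \<Longrightarrow> S (lam x) = (-1) \<odot>\<^bsub>U\<^esub> lam x"
    by (rule antipode_ex) (rule that)
  have Sc: "clin U U S" using S by (simp add: cont_linear_iff)
  note Ic = ahomD(1)[OF idU] and laws = tvs_laws[OF T.tvA]
  note bl = sandwich_cbilin[OF Ic Sc] and br = sandwich_cbilin[OF Sc Ic]
  note pl = sandwich_pure[OF Ic Sc] and pr = sandwich_pure[OF Sc Ic]
  note cl = clinD(1)[OF Sc] T.pure_closed lam_closed
  have cx: "comult x \<in> carrier (tensor U U)" if "x \<in> carrier U" for x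
    using ahomD(2)[OF comult that] by simp
  \<comment> \<open>\<open>S\<close> reverses products, so with \<open>S\<close> on the right the
    product of two tensors acts by the second one first: a left action.\<close>
  have left: "sandwich idU S (comult x) \<one>\<^bsub>U\<^esub> = counit x \<odot>\<^bsub>U\<^esub> \<one>\<^bsub>U\<^esub>" if x: "x \<in> carrier U" for x
  proof (rule convolution_one[OF bl _ _ disjI1 x])
    \<comment> \<open>The two summands of the comultiplication give \<open>lam y\<close> and
      \<open>S (lam y)\<close>, which cancel.\<close>
    show "sandwich idU S (comult (lam y)) \<one>\<^bsub>U\<^esub> = \<zero>\<^bsub>U\<^esub>" if "y \<in> carrier L" for y
      using that by (simp add: comult_lam cbilinD[OF bl] cl pl S S_lam laws(4) U.r_neg)
    show "\<forall>s\<in>carrier (tensor U U). \<forall>t\<in>carrier (tensor U U). \<forall>m\<in>carrier U.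
        sandwich idU S (s \<otimes>\<^bsub>UU\<^esub> t) m = sandwich idU S s (sandwich idU S t m)"
    proof (intro ballI)
      fix s t m
      assume st: "s \<in> carrier (tensor U U)" "t \<in> carrier (tensor U U)" and m: "m \<in> carrier U"
      show "sandwich idU S (s \<otimes>\<^bsub>UU\<^esub> t) m = sandwich idU S s (sandwich idU S t m)"
        by (rule sandwich_extend[OF Ic Sc cbilin_comp[OF T.tvT T.tvT bl clin_id
              cbilin_left[OF bl clin_id m]] _ st m])
          (simp add: pl cl m S_mult U.m_assoc)
    qed
  qed (simp add: pl S)
  \<comment> \<open>With \<open>S\<close> on the left the product acts by the first tensor first: a
    right action. The nesting is therefore reversed, by means of \<open>cbilin_swap\<close>.\<close>
  have right: "sandwich S idU (comult x) \<one>\<^bsub>U\<^esub> = counit x \<odot>\<^bsub>U\<^esub> \<one>\<^bsub>U\<^esub>" if x: "x \<in> carrier U" for x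
  proof (rule convolution_one[OF br _ _ disjI2 x])
    show "sandwich S idU (comult (lam y)) \<one>\<^bsub>U\<^esub> = \<zero>\<^bsub>U\<^esub>" if "y \<in> carrier L" for y
      using that by (simp add: comult_lam cbilinD[OF br] cl pr S S_lam laws(4) U.l_neg)
    show "\<forall>s\<in>carrier (tensor U U). \<forall>t\<in>carrier (tensor U U). \<forall>m\<in>carrier U.
        sandwich S idU (s \<otimes>\<^bsub>UU\<^esub> t) m = sandwich S idU t (sandwich S idU s m)"
    proof (intro ballI)
      fix s t m
      assume st: "s \<in> carrier (tensor U U)" "t \<in> carrier (tensor U U)" and m: "m \<in> carrier U"
      show "sandwich S idU (s \<otimes>\<^bsub>UU\<^esub> t) m = sandwich S idU t (sandwich S idU s m)"
        by (rule sandwich_extend[OF Sc Ic cbilin_swap[OF T.tvT T.tvT cbilin_comp[OF T.tvT T.tvT br clin_id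
              cbilin_left[OF br clin_id m]]] _ st m])
          (simp add: pr cl m S_mult U.m_assoc)
    qed
  qed (simp add: pr S)
  show ?thesis
    unfolding wc_hopf_algebra_def Let_def
  proof (intro conjI ballI bexI[OF _ S(1)] U comult_alg_hom counit_alg_hom coassoc counit_left_right)
    fix x assume x: "x \<in> carrier U"
    show "tensor_lift U U U (\<lambda>(x, y). x \<otimes>\<^bsub>U\<^esub> y) (tensor_map U U U U S idU (comult x)) =
        counit x \<odot>\<^bsub>U\<^esub> \<one>\<^bsub>U\<^esub>"
      using x by (simp only: mult_tensor_map[OF Sc Ic] cx right)
    show "tensor_lift U U U (\<lambda>(x, y). x \<otimes>\<^bsub>U\<^esub> y) (tensor_map U U U U idU S (comult x)) =
        counit x \<odot>\<^bsub>U\<^esub> \<one>\<^bsub>U\<^esub>"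
      using x by (simp only: mult_tensor_map[OF Ic Sc] cx left)
  qed
qed

end

theorem corollary6p5:
  shows "(\<forall>(L :: (real, 'l) top_lie) (U :: (real, 'u) top_module) lam.
            wc_lie L \<and> enveloping_algebra L U lam \<longrightarrow>
            wc_hopf_algebra U (env_comult L U lam) (env_coidentity L U lam))
       \<and> (\<forall>(L :: (complex, 'l) top_lie) (U :: (complex, 'u) top_module) lam.
            wc_lie L \<and> enveloping_algebra L U lam \<longrightarrow>
            wc_hopf_algebra U (env_comult L U lam) (env_coidentity L U lam))"
  by (blast intro: enveloping.hopf enveloping.intro)

end
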